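(* Assume hypothesis $(H_{1/6})$. Then there is no polynomial time algorithm which, given an $n\times n$ matrix $\Phi$, outputs "yes" whenever $\delta_{n^{1/3}}(\Phi) \leq n^{-1/4}$ and outputs "no" whenever $\delta_{n^{1/3}}(\Phi) \geq n^{-1/6}/4$ (for all sufficiently large $n$).
   Context: A vector is $k$-sparse if it has at most $k$ nonzero coordinates. A matrix $\Phi$ satisfies the restricted isometry property (RIP) of order $k$ with parameter $\delta$ if $(1-\delta)\|x\|^2\leq\|\Phi x\|^2\leq(1+\delta)\|x\|^2$ for all $k$-sparse $x$; the RIP parameter of order $k$, $\delta_k(\Phi)$, is the smallest such $\delta \geq 0$. $G(n,1/2)$ denotes the uniform distribution on graphs with $n$ vertices. Hypothesis $(H_\epsilon)$: there is no polynomial time algorithm which, given as input a graph $G$ on $n$ vertices, (i) always outputs "yes" if $G$ contains a clique of size $n^{1/2-\epsilon}$, and (ii) outputs "no clique" with probability tending to $1$ as $n\to\infty$ when $G$ is drawn from $G(n,1/2)$. Floor and ceiling signs on quantities such as $n^{1/3}$ are omitted. *)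

theory Defs
  imports "HOL-Probability.Probability_Mass_Function" "Jordan_Normal_Form.Matrix"
begin

section \<open>Multi-tape Turing machines and polynomial time\<close>

type_synonym symbol = nat

abbreviation (input) blank :: symbol where "blank \<equiv> 0"

text \<open>
  A two-way infinite tape is a pair \<open>(l, r)\<close>: \<open>r\<close> starts at the scanned cell and extends to the
  right, \<open>l\<close> lists the cells to the left of the head, nearest first. Cells beyond the two lists
  are blank.
\<close>

type_synonym tape = "symbol list \<times> symbol list"

datatype move = Move_Left | Stay | Move_Right

fun tape_read :: "tape \<Rightarrow> symbol" where
  "tape_read (l, []) = blank"
| "tape_read (l, a # r) = a"

fun tape_act :: "symbol \<times> move \<Rightarrow> tape \<Rightarrow> tape" where
  "tape_act (a, Stay) (l, r) = (l, a # tl r)"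
| "tape_act (a, Move_Right) (l, r) = (a # l, tl r)"
| "tape_act (a, Move_Left) (l, r) = (tl l, tape_read ([], l) # a # tl r)"

record tm =
  tapes :: nat
  alphabet :: "symbol set"
  states :: "nat set"
  start :: nat
  yes_state :: nat
  no_state :: nat
  delta :: "nat \<Rightarrow> symbol list \<Rightarrow> nat \<times> (symbol \<times> move) list"

text \<open>
  Symbols \<open>1, \<dots>, 6\<close> are the input symbols (see the encodings below); the work alphabet may be any
  larger finite set.
\<close>

definition turing_machine :: "tm \<Rightarrow> bool" where
  "turing_machine M \<longleftrightarrow>
     tapes M \<ge> 1 \<and> finite (alphabet M) \<and> {0..6} \<subseteq> alphabet M \<and>
     finite (states M) \<and> {start M, yes_state M, no_state M} \<subseteq> states M \<and> yes_state M \<noteq> no_state M \<and>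
     (\<forall>q \<in> states M. \<forall>as. length as = tapes M \<and> set as \<subseteq> alphabet M \<longrightarrow>
        (case delta M q as of (q', acts) \<Rightarrow>
           q' \<in> states M \<and> length acts = tapes M \<and> fst ` set acts \<subseteq> alphabet M))"

definition tm_step :: "tm \<Rightarrow> nat \<times> tape list \<Rightarrow> nat \<times> tape list" where
  "tm_step M c = (case c of (q, ts) \<Rightarrow>
     if q = yes_state M \<or> q = no_state M then (q, ts)
     else (case delta M q (map tape_read ts) of (q', acts) \<Rightarrow> (q', map2 tape_act acts ts)))"

definition tm_init :: "tm \<Rightarrow> symbol list \<Rightarrow> nat \<times> tape list" where
  "tm_init M w = (start M, ([], w) # replicate (tapes M - 1) ([], []))"

definition state_after :: "tm \<Rightarrow> symbol list \<Rightarrow> nat \<Rightarrow> nat" where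
  "state_after M w t = fst ((tm_step M ^^ t) (tm_init M w))"

definition outputs_yes :: "tm \<Rightarrow> symbol list \<Rightarrow> bool" where
  "outputs_yes M w \<longleftrightarrow> (\<exists>t. state_after M w t = yes_state M)"

definition outputs_no :: "tm \<Rightarrow> symbol list \<Rightarrow> bool" where
  "outputs_no M w \<longleftrightarrow> (\<exists>t. state_after M w t = no_state M)"

text \<open>\<open>I\<close> is the set of (encodings of) problem instances; nothing is required on other strings.\<close>

definition poly_time_algorithm :: "symbol list set \<Rightarrow> tm \<Rightarrow> bool" where
  "poly_time_algorithm I M \<longleftrightarrow> turing_machine M \<and>
     (\<exists>p :: nat poly. \<forall>w \<in> I. \<exists>t \<le> poly p (length w). state_after M w t \<in> {yes_state M, no_state M})"


section \<open>Graphs, cliques and their encoding\<close>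

text \<open>A (simple) graph on the \<open>n\<close> vertices \<open>0, \<dots>, n - 1\<close> is given by its set of edges.\<close>

definition graphs :: "nat \<Rightarrow> nat set set set" where
  "graphs n = Pow {e. e \<subseteq> {..<n} \<and> card e = 2}"

definition has_clique :: "nat \<Rightarrow> nat set set \<Rightarrow> nat \<Rightarrow> bool" where
  "has_clique n E k \<longleftrightarrow>
     (\<exists>K \<subseteq> {..<n}. card K = k \<and> (\<forall>u \<in> K. \<forall>v \<in> K. u \<noteq> v \<longrightarrow> {u, v} \<in> E))"

definition G_half :: "nat \<Rightarrow> nat set set pmf" where
  "G_half n = pmf_of_set (graphs n)"

definition bit :: "bool \<Rightarrow> symbol" where "bit b = (if b then 2 else 1)"

abbreviation (input) minus_sym :: symbol where "minus_sym \<equiv> 3"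
abbreviation (input) slash_sym :: symbol where "slash_sym \<equiv> 4"
abbreviation (input) comma_sym :: symbol where "comma_sym \<equiv> 5"
abbreviation (input) end_row :: symbol where "end_row \<equiv> 6"

text \<open>The adjacency matrix, row by row.\<close>

definition encode_graph :: "nat \<Rightarrow> nat set set \<Rightarrow> symbol list" where
  "encode_graph n E =
     concat (map (\<lambda>u. map (\<lambda>v. bit ({u, v} \<in> E)) [0..<n] @ [end_row]) [0..<n])"

definition graph_instances :: "symbol list set" where
  "graph_instances = {encode_graph n E | n E. E \<in> graphs n}"


section \<open>The hidden clique hypothesis\<close>

definition hidden_clique_hypothesis :: "real \<Rightarrow> bool" where
  "hidden_clique_hypothesis \<epsilon> \<longleftrightarrow>
     \<not> (\<exists>M. poly_time_algorithm graph_instances M \<and>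
          (\<forall>n. \<forall>E \<in> graphs n. has_clique n E (nat \<lfloor>real n powr (1/2 - \<epsilon>)\<rfloor>) \<longrightarrow>
             outputs_yes M (encode_graph n E)) \<and>
          (\<lambda>n. measure_pmf.prob (G_half n) {E. outputs_no M (encode_graph n E)}) \<longlonglongrightarrow> 1)"


section \<open>The restricted isometry property\<close>

definition sparse :: "nat \<Rightarrow> real vec \<Rightarrow> bool" where
  "sparse k x \<longleftrightarrow> card {i. i < dim_vec x \<and> vec_index x i \<noteq> 0} \<le> k"

definition norm2 :: "real vec \<Rightarrow> real" where
  "norm2 x = sqrt (\<Sum>i<dim_vec x. (vec_index x i)\<^sup>2)"

definition RIP :: "nat \<Rightarrow> real \<Rightarrow> real mat \<Rightarrow> bool" where
  "RIP k \<delta> \<Phi> \<longleftrightarrow>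
     (\<forall>x \<in> carrier_vec (dim_col \<Phi>). sparse k x \<longrightarrow>
        (1 - \<delta>) * (norm2 x)\<^sup>2 \<le> (norm2 (\<Phi> *\<^sub>v x))\<^sup>2 \<and>
        (norm2 (\<Phi> *\<^sub>v x))\<^sup>2 \<le> (1 + \<delta>) * (norm2 x)\<^sup>2)"

definition rip_parameter :: "nat \<Rightarrow> real mat \<Rightarrow> real" where
  "rip_parameter k \<Phi> = (LEAST \<delta>. \<delta> \<ge> 0 \<and> RIP k \<delta> \<Phi>)"

lemma norm2_squared: "(norm2 x)\<^sup>2 = (\<Sum>i<dim_vec x. (vec_index x i)\<^sup>2)"
  unfolding norm2_def by (simp add: sum_nonneg)

lemma norm2_mult_mat_vec_le:
  assumes "x \<in> carrier_vec (dim_col \<Phi>)"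
  shows "(norm2 (\<Phi> *\<^sub>v x))\<^sup>2 \<le> (\<Sum>i<dim_row \<Phi>. \<Sum>j<dim_col \<Phi>. (\<Phi> $$ (i, j))\<^sup>2) * (norm2 x)\<^sup>2"
proof -
  have d: "dim_vec x = dim_col \<Phi>" using assms by auto
  have "(vec_index (\<Phi> *\<^sub>v x) i)\<^sup>2 \<le>
      (\<Sum>j<dim_col \<Phi>. (\<Phi> $$ (i, j))\<^sup>2) * (\<Sum>j<dim_col \<Phi>. (vec_index x j)\<^sup>2)"
    if "i < dim_row \<Phi>" for i
  proof -
    have "vec_index (\<Phi> *\<^sub>v x) i = (\<Sum>j<dim_col \<Phi>. \<Phi> $$ (i, j) * vec_index x j)"
      using that d by (auto simp: scalar_prod_def atLeast0LessThan intro!: sum.cong)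
    then show ?thesis by (simp add: Cauchy_Schwarz_ineq_sum)
  qed
  then show ?thesis
    by (auto simp: norm2_squared d sum_distrib_right intro!: sum_mono)
qed

text \<open>The least element in \<open>rip_parameter\<close> exists for every matrix.\<close>

lemma rip_parameter_least:
  shows "rip_parameter k \<Phi> \<ge> 0" and "RIP k (rip_parameter k \<Phi>) \<Phi>"
    and "\<lbrakk>\<delta> \<ge> 0; RIP k \<delta> \<Phi>\<rbrakk> \<Longrightarrow> rip_parameter k \<Phi> \<le> \<delta>"
proof -
  define S where "S = {\<delta>. \<delta> \<ge> 0 \<and> RIP k \<delta> \<Phi>}"
  define C where "C = (\<Sum>i<dim_row \<Phi>. \<Sum>j<dim_col \<Phi>. (\<Phi> $$ (i, j))\<^sup>2)"
  have C0: "C \<ge> 0" unfolding C_def by (simp add: sum_nonneg)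
  have "RIP k (1 + C) \<Phi>"
    unfolding RIP_def
  proof (intro ballI impI conjI)
    fix x :: "real vec"
    assume x: "x \<in> carrier_vec (dim_col \<Phi>)"
    have "(1 - (1 + C)) * (norm2 x)\<^sup>2 \<le> 0" using C0 by simp
    also have "\<dots> \<le> (norm2 (\<Phi> *\<^sub>v x))\<^sup>2" by simp
    finally show "(1 - (1 + C)) * (norm2 x)\<^sup>2 \<le> (norm2 (\<Phi> *\<^sub>v x))\<^sup>2" .
    have "(norm2 (\<Phi> *\<^sub>v x))\<^sup>2 \<le> C * (norm2 x)\<^sup>2"
      using norm2_mult_mat_vec_le[OF x] by (simp add: C_def)
    also have "\<dots> \<le> (1 + (1 + C)) * (norm2 x)\<^sup>2" by (intro mult_right_mono) auto
    finally show "(norm2 (\<Phi> *\<^sub>v x))\<^sup>2 \<le> (1 + (1 + C)) * (norm2 x)\<^sup>2" .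
  qed
  then have ne: "S \<noteq> {}" using C0 by (auto simp: S_def intro!: exI[of _ "1 + C"])
  have bdd: "bdd_below S" by (auto simp: S_def bdd_below_def)
  have Inf0: "Inf S \<ge> 0" using ne by (intro cInf_greatest) (auto simp: S_def)
  have lower: "Inf S \<le> \<delta>" if "\<delta> \<in> S" for \<delta> using that bdd by (rule cInf_lower)
  have "RIP k (Inf S) \<Phi>"
    unfolding RIP_def
  proof (intro ballI impI)
    fix x :: "real vec"
    assume x: "x \<in> carrier_vec (dim_col \<Phi>)" "sparse k x"
    let ?a = "(norm2 x)\<^sup>2" and ?b = "(norm2 (\<Phi> *\<^sub>v x))\<^sup>2"
    have S: "(1 - \<delta>) * ?a \<le> ?b \<and> ?b \<le> (1 + \<delta>) * ?a" if "\<delta> \<in> S" for \<delta>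
      using that x by (auto simp: S_def RIP_def)
    show "(1 - Inf S) * ?a \<le> ?b \<and> ?b \<le> (1 + Inf S) * ?a"
    proof (cases "?a = 0")
      case True
      then show ?thesis using S ne by auto
    next
      case False
      then have a: "?a > 0" using zero_le_power2[of "norm2 x"] by linarith
      have "\<bar>?b / ?a - 1\<bar> \<le> \<delta>" if "\<delta> \<in> S" for \<delta>
        using S[OF that] a by (auto simp: abs_le_iff field_simps)
      then have "\<bar>?b / ?a - 1\<bar> \<le> Inf S" using ne by (intro cInf_greatest) auto
      then have "1 - Inf S \<le> ?b / ?a" "?b / ?a \<le> 1 + Inf S" by linarith+
      then show ?thesis using a by (simp only: pos_le_divide_eq pos_divide_le_eq)
    qed
  qed
  then have "rip_parameter k \<Phi> = Inf S"
    unfolding rip_parameter_def using Inf0 lower by (intro Least_equality) (auto simp: S_def)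
  then show "rip_parameter k \<Phi> \<ge> 0" "RIP k (rip_parameter k \<Phi>) \<Phi>"
    "\<lbrakk>\<delta> \<ge> 0; RIP k \<delta> \<Phi>\<rbrakk> \<Longrightarrow> rip_parameter k \<Phi> \<le> \<delta>"
    using Inf0 lower \<open>RIP k (Inf S) \<Phi>\<close> by (auto simp: S_def)
qed


section \<open>Encoding of rational matrices\<close>

text \<open>Binary digits, least significant first, without leading zeros.\<close>

fun encode_nat :: "nat \<Rightarrow> symbol list" where
  "encode_nat n = (if n = 0 then [] else bit (odd n) # encode_nat (n div 2))"

declare encode_nat.simps [simp del]

text \<open>A rational is written as a reduced fraction with positive denominator.\<close>

definition encode_rat :: "rat \<Rightarrow> symbol list" where
  "encode_rat r = (case quotient_of r of (a, b) \<Rightarrow>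
     (if a < 0 then [minus_sym] else []) @ encode_nat (nat \<bar>a\<bar>) @ [slash_sym] @ encode_nat (nat b))"

definition encode_matrix :: "rat mat \<Rightarrow> symbol list" where
  "encode_matrix \<Phi> =
     concat (map (\<lambda>i. concat (map (\<lambda>j. encode_rat (\<Phi> $$ (i, j)) @ [comma_sym]) [0..<dim_col \<Phi>])
                      @ [end_row]) [0..<dim_row \<Phi>])"

definition matrix_instances :: "symbol list set" where
  "matrix_instances = {encode_matrix \<Phi> | n \<Phi>. \<Phi> \<in> carrier_mat n n}"

end

theory Submission
  imports Defs "HOL-Probability.Hoeffding" "HOL-Real_Asymp.Real_Asymp"
begin

text \<open>
  Let \<open>A\<close> be the \<open>\<plusminus>1\<close> adjacency matrix of a graph on \<open>n\<close> vertices and \<open>s = \<lceil>\<surd>n\<rceil>\<close>. Up to the order of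
  columns and zero rows, the graph is mapped to the \<open>2n \<times> 2n\<close> matrix \<open>\<Phi>\<close> with blocks \<open>[I, A/s]\<close>, so that
  \<open>\<parallel>\<Phi>(y, z)\<parallel>\<^sup>2 = \<parallel>y\<parallel>\<^sup>2 + (2/s) y\<^sup>TAz + \<parallel>Az\<parallel>\<^sup>2/s\<^sup>2\<close>. Two halves of size \<open>h\<close> of a clique, with both signs, show
  that the RIP parameter is at least \<open>h/s\<close>, which is of order \<open>n\<^bsup>-1/6\<^esup>/2\<close> for cliques of size \<open>n\<^bsup>1/3\<^esup>\<close>.

  For a random graph and fixed sparse \<open>y, z\<close> the form \<open>y\<^sup>TAz\<close> is subgaussian, and \<open>\<parallel>Az\<parallel>\<^sup>2\<close> is, up to the few
  rows in the support of \<open>z\<close>, a sum of independent terms that are bounded by \<open>n\<^bsup>1/3\<^esup>\<close> and have bounded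
  variance after normalization. The exponential moment method bounds both deviations by \<open>n\<^bsup>-1/4\<^esup>\<close> outside an
  event of probability \<open>exp (- c n\<^bsup>5/12\<^esup>)\<close>, which beats the \<open>exp (O(n\<^bsup>1/3\<^esup> log n))\<close> sparse vectors of an integer grid
  of polynomial width; rounding to this grid handles all sparse vectors.

  The map is computed by a multi-tape Turing machine that is compiled from a small imperative language and
  followed by the given machine with its two answers exchanged. Graphs with fewer than \<open>N\<close> vertices
  are answered with "yes" at once.
\<close>

text \<open>The identity block is what makes a clique visible. With \<open>A / s\<close> alone, the
  rows of a clique of size k raise the squared norm of its indicator by a relative k^2 / n, of order
  n^(-1/3), which drowns in the noise n^(-1/4); the mixed term is linear in \<open>A\<close> and
  yields h / s instead. The price is dimension 2n, and both thresholds are read there. The exponents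
  fit as follows. A distortion of order n^(-1/4) lets |Az|^2 deviate by t |z|^2 with t of order
  n^(3/4). Its summands are bounded by K |z|^2 with K of order n^(1/3), so an exponential moment at
  scale 1 / K gives exp (- t / K), of exponent n^(5/12), up to a second-order term n / K^2 of order
  n^(1/3). The union bound pays K log n. The rows in the support are estimated trivially and cost
  K^2 / n, of order n^(-1/3). Entries have to be rational, hence the ceiling in s; as s^2 - n is
  O(sqrt n), this costs n^(-1/2). The answers are exchanged because, for large n, a small parameter
  excludes the clique.\<close>

section \<open>Structured programs for Turing machines\<close>

text \<open>A head position and the contents of all cells, indexed by the integers.\<close>

type_synonym atape = "int \<times> (int \<Rightarrow> symbol)"

text \<open>\<open>nth_default 0\<close> makes absent cells blank, so lists that differ in trailing
  blanks represent the same tape. The origin is left open: every translate of \<open>a\<close> is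
  represented as well.\<close>

definition tape_repr :: "tape \<Rightarrow> atape \<Rightarrow> bool" where
  "tape_repr tp a \<longleftrightarrow> (\<forall>i. nth_default 0 (snd tp) i = snd a (fst a + int i) \<and>
     nth_default 0 (fst tp) i = snd a (fst a - 1 - int i))"

definition head_symbol :: "atape \<Rightarrow> symbol" where
  "head_symbol a = snd a (fst a)"

fun offset :: "move \<Rightarrow> int" where
  "offset Move_Left = - 1"
| "offset Stay = 0"
| "offset Move_Right = 1"

definition act :: "symbol \<times> move \<Rightarrow> atape \<Rightarrow> atape" where
  "act bd a = (fst a + offset (snd bd), (snd a)(fst a := fst bd))"

lemma tape_read_nth_default: "tape_read tp = nth_default 0 (snd tp) 0"
  by (cases tp; cases "snd tp") (auto simp: nth_default_def)

lemma tape_repr_read: "tape_repr tp a \<Longrightarrow> tape_read tp = head_symbol a"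
  by (auto simp: tape_repr_def head_symbol_def tape_read_nth_default dest: spec[of _ 0])

lemma nth_default_tl: "nth_default d (tl xs) i = nth_default d xs (Suc i)"
  by (cases xs) (auto simp: nth_default_def)

lemma tape_repr_act:
  assumes "tape_repr tp a"
  shows "tape_repr (tape_act bd tp) (act bd a)"
proof -
  obtain l r where tp: "tp = (l, r)" by force
  obtain b d where bd: "bd = (b, d)" by force
  have R: "nth_default 0 r i = snd a (fst a + int i)"
    and L: "nth_default 0 l i = snd a (fst a - 1 - int i)" for i
    using assms by (auto simp: tape_repr_def tp)
  have hd_l: "tape_read ([], l) = snd a (fst a - 1)"
    using L[of 0] by (simp add: tape_read_nth_default)
  show ?thesis
  proof (cases d)
    case Stay
    then show ?thesis
      by (auto simp: tp bd tape_repr_def act_def nth_default_Cons nth_default_tl R L algebra_simps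
               split: nat.split)
  next
    case Move_Right
    then show ?thesis
      by (auto simp: tp bd tape_repr_def act_def nth_default_Cons nth_default_tl R L algebra_simps
               split: nat.split)
  next
    case Move_Left
    then show ?thesis using hd_l
      by (auto simp: tp bd tape_repr_def act_def nth_default_Cons nth_default_tl R L algebra_simps
               split: nat.split)
  qed
qed

text \<open>Jumps and idle tapes have to write something. Rewriting the scanned symbol is neutral on
  cell contents, while on lists it may turn \<open>[]\<close> into \<open>[0]\<close>.\<close>

lemma act_head: "act (head_symbol a, Stay) a = a"
  by (simp add: act_def head_symbol_def)

definition input_tape :: "symbol list \<Rightarrow> atape" where
  "input_tape w = (0, \<lambda>i. if i < 0 then 0 else nth_default 0 w (nat i))"

lemma tape_repr_input: "tape_repr ([], w) (input_tape w)"
  by (auto simp: tape_repr_def input_tape_def)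

lemma input_tape_Nil: "input_tape [] = (0, \<lambda>_. 0)"
  by (auto simp: input_tape_def)

text \<open>The machine that takes over finds its input wherever the program has left it. Its
  behaviour depends on the contents relative to the head only, hence equality up to a shift
  \<open>k\<close>.\<close>

definition tape_equiv :: "tape \<Rightarrow> tape \<Rightarrow> bool" where
  "tape_equiv s t \<longleftrightarrow> (\<exists>a b k. tape_repr s a \<and> tape_repr t b \<and> fst b = fst a + k \<and> (\<forall>i. snd b (i + k) = snd a i))"

lemma tape_equivI:
  assumes "tape_repr s a" "tape_repr t b" "\<And>i. snd b (fst b + i) = snd a (fst a + i)"
  shows "tape_equiv s t"
proof -
  have "\<forall>i. snd b (i + (fst b - fst a)) = snd a i"
  proof
    fix i
    show "snd b (i + (fst b - fst a)) = snd a i"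
      using assms(3)[of "i - fst a"] by (simp add: algebra_simps)
  qed
  then show ?thesis unfolding tape_equiv_def using assms
    by (intro exI[of _ a] exI[of _ b] exI[of _ "fst b - fst a"]) auto
qed

lemma tape_equiv_read: "tape_equiv s t \<Longrightarrow> tape_read s = tape_read t"
  by (auto simp: tape_equiv_def tape_repr_read head_symbol_def)

lemma tape_equiv_act:
  assumes "tape_equiv s t"
  shows "tape_equiv (tape_act bd s) (tape_act bd t)"
proof -
  obtain a b k where *: "tape_repr s a" "tape_repr t b" "fst b = fst a + k" "\<forall>i. snd b (i + k) = snd a i"
    using assms by (auto simp: tape_equiv_def)
  show ?thesis unfolding tape_equiv_def
    using * tape_repr_act[OF *(1), of bd] tape_repr_act[OF *(2), of bd]
    by (intro exI[of _ "act bd a"] exI[of _ "act bd b"] exI[of _ k]) (auto simp: act_def)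
qed

section \<open>A while language on tapes and its compiler\<close>

type_synonym store = "nat \<Rightarrow> atape"

datatype com =
    Do nat "symbol \<Rightarrow> symbol \<times> move"
  | Seq com com (infixr ";;" 60)
  | If nat "symbol \<Rightarrow> bool" com com
  | While nat "symbol \<Rightarrow> bool" com

text \<open>The counts are exact for the compiled code: every test is one jump, and a taken first
  branch or a loop body is followed by a second, unconditional jump, while the other branch falls
  through.\<close>

inductive exec :: "com \<Rightarrow> store \<Rightarrow> nat \<Rightarrow> store \<Rightarrow> bool" where
  Do: "exec (Do t f) s 1 (s(t := act (f (head_symbol (s t))) (s t)))"
| Seq: "exec a s m s' \<Longrightarrow> exec b s' n s'' \<Longrightarrow> exec (a ;; b) s (m + n) s''"
| IfT: "P (head_symbol (s t)) \<Longrightarrow> exec a s m s' \<Longrightarrow> exec (If t P a b) s (m + 2) s'"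
| IfF: "\<not> P (head_symbol (s t)) \<Longrightarrow> exec b s m s' \<Longrightarrow> exec (If t P a b) s (m + 1) s'"
| WhileF: "\<not> P (head_symbol (s t)) \<Longrightarrow> exec (While t P c) s 1 s"
| WhileT: "P (head_symbol (s t)) \<Longrightarrow> exec c s m s' \<Longrightarrow> exec (While t P c) s' n s''
    \<Longrightarrow> exec (While t P c) s (m + n + 2) s''"

text \<open>The alphabet of the given machine is only known to contain \<open>{0..6}\<close>, so a
  program may write these symbols or the one just scanned.\<close>

fun com_wf :: "nat \<Rightarrow> com \<Rightarrow> bool" where
  "com_wf k (Do t f) \<longleftrightarrow> t < k \<and> (\<forall>a. fst (f a) = a \<or> fst (f a) \<le> 6)"
| "com_wf k (a ;; b) \<longleftrightarrow> com_wf k a \<and> com_wf k b"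
| "com_wf k (If t P a b) \<longleftrightarrow> t < k \<and> com_wf k a \<and> com_wf k b"
| "com_wf k (While t P c) \<longleftrightarrow> t < k \<and> com_wf k c"

type_synonym instr = "nat \<times> (symbol \<Rightarrow> (symbol \<times> move) \<times> nat)"

definition jump :: "nat \<Rightarrow> (symbol \<Rightarrow> nat) \<Rightarrow> instr" where
  "jump t g = (t, \<lambda>a. ((a, Stay), g a))"

fun code_size :: "com \<Rightarrow> nat" where
  "code_size (Do t f) = 1"
| "code_size (a ;; b) = code_size a + code_size b"
| "code_size (If t P a b) = code_size a + code_size b + 2"
| "code_size (While t P c) = code_size c + 2"

text \<open>Jump targets are absolute, hence the start address as first argument. Control leaves a
  block by reaching the address just behind it.\<close>

fun compile :: "nat \<Rightarrow> com \<Rightarrow> instr list" where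
  "compile i (Do t f) = [(t, \<lambda>a. (f a, i + 1))]"
| "compile i (a ;; b) = compile i a @ compile (i + code_size a) b"
| "compile i (If t P a b) =
     [jump t (\<lambda>x. if P x then i + 1 else i + code_size a + 2)] @ compile (i + 1) a @
     [jump t (\<lambda>_. i + code_size a + code_size b + 2)] @ compile (i + code_size a + 2) b"
| "compile i (While t P c) =
     [jump t (\<lambda>x. if P x then i + 1 else i + code_size c + 2)] @ compile (i + 1) c @
     [jump t (\<lambda>_. i)]"

lemma length_compile [simp]: "length (compile i c) = code_size c"
  by (induction c arbitrary: i) auto

definition istep :: "instr list \<Rightarrow> nat \<times> store \<Rightarrow> nat \<times> store" where
  "istep C qs = (case qs of (q, s) \<Rightarrow> case C ! q of (t, g) \<Rightarrow> case g (head_symbol (s t)) of (bd, q') \<Rightarrow>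
     (q', s(t := act bd (s t))))"

inductive iruns :: "instr list \<Rightarrow> nat \<times> store \<Rightarrow> nat \<Rightarrow> nat \<times> store \<Rightarrow> bool" for C where
  iruns_0: "iruns C x 0 x"
| iruns_Suc: "fst x < length C \<Longrightarrow> iruns C (istep C x) m y \<Longrightarrow> iruns C x (Suc m) y"

lemma iruns_trans: "iruns C x m y \<Longrightarrow> iruns C y n z \<Longrightarrow> iruns C x (m + n) z"
  by (induction rule: iruns.induct) (auto intro: iruns.intros)

lemma iruns_jump:
  assumes "q < length C" "C ! q = jump t g"
  shows "iruns C (q, s) 1 (g (head_symbol (s t)), s)"
proof -
  have "istep C (q, s) = (g (head_symbol (s t)), s)"
    using assms by (simp add: istep_def jump_def act_head)
  then show ?thesis using assms by (auto intro!: iruns.intros)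
qed

text \<open>Subprograms run inside the code of the whole program, so the code stands between
  arbitrary \<open>pre\<close> and \<open>post\<close>, and \<open>length pre\<close> is its
  address.\<close>

lemma iruns_compile:
  assumes "exec c s m s'" "C = pre @ compile (length pre) c @ post"
  shows "iruns C (length pre, s) m (length pre + code_size c, s')"
  using assms
proof (induction arbitrary: pre post rule: exec.induct)
  case (Do t f s)
  let ?i = "length pre" and ?s' = "s(t := act (f (head_symbol (s t))) (s t))"
  have "istep C (?i, s) = (?i + 1, ?s')" using Do by (simp add: istep_def)
  moreover have "?i < length C" using Do by simp
  ultimately show ?case using iruns_Suc[of "(?i, s)" C 0 "(?i + 1, ?s')"] iruns_0[of C "(?i + 1, ?s')"]
    by (simp del: fun_upd_apply)
next
  case (Seq a s m s' b n s'')
  have "iruns C (length pre, s) m (length pre + code_size a, s')"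
    using Seq.IH(1)[of pre "compile (length pre + code_size a) b @ post"] Seq.prems by simp
  moreover have "iruns C (length pre + code_size a, s') n (length pre + code_size a + code_size b, s'')"
    using Seq.IH(2)[of "pre @ compile (length pre) a" post] Seq.prems by simp
  ultimately show ?case using iruns_trans by (fastforce simp: add.assoc)
next
  case (IfT P s t a m s' b)
  let ?i = "length pre"
  have 1: "iruns C (?i, s) 1 (?i + 1, s)"
    using iruns_jump[of ?i C t _ s] IfT by (fastforce simp: nth_append)
  have 2: "iruns C (?i + 1, s) m (?i + 1 + code_size a, s')"
    using IfT.IH[of "pre @ [jump t (\<lambda>x. if P x then ?i + 1 else ?i + code_size a + 2)]"
        "[jump t (\<lambda>_. ?i + code_size a + code_size b + 2)] @ compile (?i + code_size a + 2) b @ post"]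
      IfT.prems by simp
  have 3: "iruns C (?i + 1 + code_size a, s') 1 (?i + code_size a + code_size b + 2, s')"
    using iruns_jump[of "?i + 1 + code_size a" C t _ s'] IfT by (fastforce simp: nth_append)
  show ?case using iruns_trans[OF iruns_trans[OF 1 2] 3] by (simp add: algebra_simps)
next
  case (IfF P s t b m s' a)
  let ?i = "length pre"
  have 1: "iruns C (?i, s) 1 (?i + code_size a + 2, s)"
    using iruns_jump[of ?i C t _ s] IfF by (fastforce simp: nth_append)
  have 2: "iruns C (?i + code_size a + 2, s) m (?i + code_size a + 2 + code_size b, s')"
    using IfF.IH[of "pre @ [jump t (\<lambda>x. if P x then ?i + 1 else ?i + code_size a + 2)] @
        compile (?i + 1) a @ [jump t (\<lambda>_. ?i + code_size a + code_size b + 2)]" post]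
      IfF.prems by (simp add: algebra_simps)
  show ?case using iruns_trans[OF 1 2] by (simp add: algebra_simps)
next
  case (WhileF P s t c)
  let ?i = "length pre"
  have 1: "iruns C (?i, s) 1 (?i + code_size c + 2, s)"
    using iruns_jump[of ?i C t _ s] WhileF by (fastforce simp: nth_append)
  then show ?case by simp
next
  case (WhileT P s t c m s' n s'')
  let ?i = "length pre"
  have 1: "iruns C (?i, s) 1 (?i + 1, s)"
    using iruns_jump[of ?i C t _ s] WhileT by (fastforce simp: nth_append)
  have 2: "iruns C (?i + 1, s) m (?i + 1 + code_size c, s')"
    using WhileT.IH(1)[of "pre @ [jump t (\<lambda>x. if P x then ?i + 1 else ?i + code_size c + 2)]"
        "[jump t (\<lambda>_. ?i)] @ post"]
      WhileT.prems by simp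
  have 3: "iruns C (?i + 1 + code_size c, s') 1 (?i, s')"
    using iruns_jump[of "?i + 1 + code_size c" C t _ s'] WhileT by (fastforce simp: nth_append)
  \<comment> \<open>The second jump returns to the first instruction of the loop, so the remaining
    rounds run with the same \<open>pre\<close> and \<open>post\<close>.\<close>
  have 4: "iruns C (?i, s') n (?i + code_size (While t P c), s'')"
    using WhileT.IH(2) WhileT.prems by simp
  show ?case using iruns_trans[OF iruns_trans[OF iruns_trans[OF 1 2] 3] 4] by (simp add: algebra_simps)
qed

section \<open>Upper bounds for running times\<close>

definition computes :: "com \<Rightarrow> store \<Rightarrow> nat \<Rightarrow> store \<Rightarrow> bool" where
  "computes c s T s' \<longleftrightarrow> (\<exists>m\<le>T. exec c s m s')"

lemma computes_mono: "computes c s T s' \<Longrightarrow> T \<le> T' \<Longrightarrow> computes c s T' s'"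
  unfolding computes_def by (meson le_trans)

lemma computes_Do: "s' = s(t := act (f (head_symbol (s t))) (s t)) \<Longrightarrow> computes (Do t f) s 1 s'"
  unfolding computes_def using exec.Do[of t f s] by blast

lemma computes_Seq: "computes a s m s' \<Longrightarrow> computes b s' n s'' \<Longrightarrow> computes (a ;; b) s (m + n) s''"
  unfolding computes_def by (meson exec.Seq add_mono)

lemma computes_If:
  assumes "P (head_symbol (s t)) \<Longrightarrow> computes a s T s'" "\<not> P (head_symbol (s t)) \<Longrightarrow> computes b s T s'"
  shows "computes (If t P a b) s (T + 2) s'"
proof (cases "P (head_symbol (s t))")
  case True
  then obtain m where "m \<le> T" "exec a s m s'" using assms by (auto simp: computes_def)
  then show ?thesis using exec.IfT[of P s t a m s' b] True by (auto simp: computes_def intro!: exI[of _ "m + 2"])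
next
  case False
  then obtain m where "m \<le> T" "exec b s m s'" using assms by (auto simp: computes_def)
  then have "m + 1 \<le> T + 2" "exec (If t P a b) s (m + 1) s'" using exec.IfF[of P s t b m s' a] False by auto
  then show ?thesis unfolding computes_def by blast
qed

text \<open>The sequence \<open>S\<close>, with \<open>S i\<close> the store before round
  \<open>i\<close>, takes the place of an invariant and fixes the number of rounds; the two jumps of
  a round are added to \<open>T\<close>.\<close>

lemma computes_While:
  assumes "\<And>i. i < n \<Longrightarrow> P (head_symbol (S i t))" "\<And>i. i < n \<Longrightarrow> computes c (S i) T (S (Suc i))"
    and "\<not> P (head_symbol (S n t))"
  shows "computes (While t P c) (S 0) (n * (T + 2) + 1) (S n)"
  using assms
proof (induction n arbitrary: S)
  case 0
  then show ?case using exec.WhileF[of P "S 0" t c] by (auto simp: computes_def)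
next
  case (Suc n)
  obtain m where m: "m \<le> T" "exec c (S 0) m (S 1)"
    using Suc.prems(2)[of 0] by (auto simp: computes_def)
  have "computes (While t P c) (S (Suc 0)) (n * (T + 2) + 1) (S (Suc n))"
    using Suc.IH[of "\<lambda>i. S (Suc i)"] Suc.prems by auto
  then obtain l where l: "l \<le> n * (T + 2) + 1" "exec (While t P c) (S 1) l (S (Suc n))"
    by (auto simp: computes_def)
  have "exec (While t P c) (S 0) (m + l + 2) (S (Suc n))"
    using exec.WhileT[OF Suc.prems(1) m(2) l(2)] by simp
  then show ?case using m l by (auto simp: computes_def intro!: exI[of _ "m + l + 2"])
qed

lemma computes_While':
  assumes "\<And>i. i < n \<Longrightarrow> P (head_symbol (S i t))" "\<And>i. i < n \<Longrightarrow> computes c (S i) T (S (Suc i))"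
    and "\<not> P (head_symbol (S n t))" "s = S 0" "s' = S n" "T' = n * (T + 2) + 1"
  shows "computes (While t P c) s T' s'"
  using computes_While[of n P S t c T] assms by simp

section \<open>Running a program in front of a given machine\<close>

text \<open>
  The machine \<open>prefixed k c M\<close> runs \<open>c\<close> and then, on all tapes but the first \<open>k\<close>, the machine \<open>M\<close>
  with its two answers exchanged. If the first tape of \<open>M\<close> scans a blank when \<open>c\<close> ends, then \<open>M\<close> is
  not started and the answer is "yes".
\<close>

definition prefixed :: "nat \<Rightarrow> com \<Rightarrow> tm \<Rightarrow> tm" where
  "prefixed k c M = (let L = code_size c; C = compile 0 c; shift = (\<lambda>q. L + 1 + q) in
     \<lparr> tapes = k + tapes M, alphabet = alphabet M, states = {..L} \<union> shift ` states M,
       start = 0, yes_state = shift (no_state M), no_state = shift (yes_state M),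
       delta = (\<lambda>q as.
         if q < L then (case C ! q of (t, g) \<Rightarrow> case g (as ! t) of (bd, q') \<Rightarrow>
            (q', map (\<lambda>i. if i = t then bd else (as ! i, Stay)) [0..<length as]))
         else if q = L then
            (if as ! k = 0 then shift (no_state M) else shift (start M), map (\<lambda>a. (a, Stay)) as)
         else (case delta M (q - (L + 1)) (drop k as) of (q', acts) \<Rightarrow>
            (shift q', map (\<lambda>a. (a, Stay)) (take k as) @ acts))) \<rparr>)"

lemma prefixed_simps:
  "tapes (prefixed k c M) = k + tapes M"
  "alphabet (prefixed k c M) = alphabet M"
  "states (prefixed k c M) = {..code_size c} \<union> (\<lambda>q. code_size c + 1 + q) ` states M"
  "start (prefixed k c M) = 0"
  "yes_state (prefixed k c M) = code_size c + 1 + no_state M"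
  "no_state (prefixed k c M) = code_size c + 1 + yes_state M"
  by (simp_all add: prefixed_def Let_def)

lemma delta_prefixed:
  "q < code_size c \<Longrightarrow> delta (prefixed k c M) q as =
     (case compile 0 c ! q of (t, g) \<Rightarrow> case g (as ! t) of (bd, q') \<Rightarrow>
        (q', map (\<lambda>i. if i = t then bd else (as ! i, Stay)) [0..<length as]))"
  "delta (prefixed k c M) (code_size c) as =
     (code_size c + 1 + (if as ! k = 0 then no_state M else start M), map (\<lambda>a. (a, Stay)) as)"
  "delta (prefixed k c M) (code_size c + 1 + p) as =
     (case delta M p (drop k as) of (q', acts) \<Rightarrow>
        (code_size c + 1 + q', map (\<lambda>a. (a, Stay)) (take k as) @ acts))"
  by (simp_all add: prefixed_def Let_def)

text \<open>Targets may reach the end of the code but not pass it. So \<open>{..code_size c}\<close>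
  contains all addresses, and its last element is the state that hands over to the machine.\<close>

lemma compile_wf:
  assumes "com_wf k c" "x \<in> set (compile i c)"
  shows "fst x < k \<and> (\<forall>a. (fst (fst (snd x a)) = a \<or> fst (fst (snd x a)) \<le> 6) \<and>
     snd (snd x a) \<le> i + code_size c)"
  using assms
proof (induction c arbitrary: i)
  case (Seq c1 c2)
  from Seq.prems(2) consider "x \<in> set (compile i c1)" | "x \<in> set (compile (i + code_size c1) c2)"
    by auto
  then show ?case
  proof cases
    case 1
    then show ?thesis using Seq.IH(1)[OF _ 1] Seq.prems(1) by (auto intro: le_trans)
  next
    case 2
    then show ?thesis using Seq.IH(2)[OF _ 2] Seq.prems(1) by (auto simp: add.assoc)
  qed
next
  case (If t P c1 c2)
  from If.prems(2) consider "x = jump t (\<lambda>x. if P x then i + 1 else i + code_size c1 + 2)"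
    | "x \<in> set (compile (i + 1) c1)" | "x = jump t (\<lambda>_. i + code_size c1 + code_size c2 + 2)"
    | "x \<in> set (compile (i + code_size c1 + 2) c2)" by auto
  then show ?case
  proof cases
    case 2
    then show ?thesis using If.IH(1)[OF _ 2] If.prems(1) by (auto intro: le_trans)
  next
    case 4
    then show ?thesis using If.IH(2)[OF _ 4] If.prems(1) by (auto simp: algebra_simps intro: le_trans)
  qed (use If.prems(1) in \<open>auto simp: jump_def\<close>)
next
  case (While t P c)
  from While.prems(2) consider "x = jump t (\<lambda>x. if P x then i + 1 else i + code_size c + 2)"
    | "x \<in> set (compile (i + 1) c)" | "x = jump t (\<lambda>_. i)" by auto
  then show ?case
  proof cases
    case 2
    then show ?thesis using While.IH[OF _ 2] While.prems(1) by (auto intro: le_trans)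
  qed (use While.prems(1) in \<open>auto simp: jump_def\<close>)
qed auto

lemma turing_machine_delta:
  assumes "turing_machine M" "q \<in> states M" "length as = tapes M" "set as \<subseteq> alphabet M"
    and "delta M q as = (q', acts)"
  shows "q' \<in> states M \<and> length acts = tapes M \<and> fst ` set acts \<subseteq> alphabet M"
proof -
  have "\<forall>q \<in> states M. \<forall>as. length as = tapes M \<and> set as \<subseteq> alphabet M \<longrightarrow>
        (case delta M q as of (q', acts) \<Rightarrow>
           q' \<in> states M \<and> length acts = tapes M \<and> fst ` set acts \<subseteq> alphabet M)"
    using assms(1) unfolding turing_machine_def by (elim conjE)
  from this[rule_format, OF assms(2), of as] show ?thesis using assms(3-5) by simp
qed

lemma turing_machine_prefixed:
  assumes M: "turing_machine M" and c: "com_wf (k + tapes M) c"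
  shows "turing_machine (prefixed k c M)"
proof -
  let ?L = "code_size c" and ?M = "prefixed k c M"
  have "case delta ?M q as of (q', acts) \<Rightarrow>
           q' \<in> states ?M \<and> length acts = tapes ?M \<and> fst ` set acts \<subseteq> alphabet ?M"
    if q: "q \<in> states ?M" and len: "length as = tapes ?M" and as: "set as \<subseteq> alphabet ?M" for q as
  proof -
    have alph: "{0..6} \<subseteq> alphabet M" using M by (auto simp: turing_machine_def)
    consider "q < ?L" | "q = ?L" | p where "q = ?L + 1 + p" "p \<in> states M"
      using q by (fastforce simp: prefixed_simps)
    then show ?thesis
    proof cases
      case 1
      obtain t g where tg: "compile 0 c ! q = (t, g)" by force
      obtain bd q' where g: "g (as ! t) = (bd, q')" by (metis surj_pair)
      have "(t, g) \<in> set (compile 0 c)" using 1 tg by (metis length_compile nth_mem)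
      from compile_wf[OF c this] len have "t < length as"
        and "(fst (fst (g (as ! t))) = as ! t \<or> fst (fst (g (as ! t))) \<le> 6) \<and> snd (g (as ! t)) \<le> ?L"
        by (auto simp: prefixed_simps)
      then have "t < length as" "fst bd = as ! t \<or> fst bd \<le> 6" "q' \<le> ?L"
        unfolding g by auto
      moreover from this have "as ! t \<in> alphabet M" using as by (auto simp: prefixed_simps)
      ultimately show ?thesis using alph as len
        by (auto simp: delta_prefixed 1 tg g prefixed_simps)
    next
      case 2
      have "start M \<in> states M" "no_state M \<in> states M" using M by (auto simp: turing_machine_def)
      then show ?thesis using as len 2
        by (auto simp: delta_prefixed prefixed_simps)
    next
      case 3
      obtain p' acts where d: "delta M p (drop k as) = (p', acts)" by force
      have "set (drop k as) \<subseteq> alphabet M" "length (drop k as) = tapes M"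
        using as len set_drop_subset[of k as] by (auto simp: prefixed_simps)
      then have "p' \<in> states M \<and> length acts = tapes M \<and> fst ` set acts \<subseteq> alphabet M"
        using turing_machine_delta[OF M 3(2) _ _ d] by blast
      then show ?thesis using as len d set_take_subset[of k as]
        unfolding 3(1) delta_prefixed(3) by (fastforce simp: prefixed_simps)
    qed
  qed
  then show ?thesis using M by (auto simp: turing_machine_def prefixed_simps)
qed

definition store_repr :: "nat \<Rightarrow> tape list \<Rightarrow> store \<Rightarrow> bool" where
  "store_repr k ts s \<longleftrightarrow> length ts = k \<and> (\<forall>i<k. tape_repr (ts ! i) (s i))"

text \<open>All tapes but the one of the instruction rewrite their scanned symbol, which by
  \<open>act_head\<close> leaves the represented store as it is. Addresses are smaller than both
  halting states, so the step is never frozen.\<close>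

lemma tm_step_prefixed_code:
  assumes "store_repr (k + tapes M) ts s" "q < code_size c" "com_wf (k + tapes M) c"
    and "istep (compile 0 c) (q, s) = (q', s')"
  shows "\<exists>ts'. tm_step (prefixed k c M) (q, ts) = (q', ts') \<and> store_repr (k + tapes M) ts' s'"
proof -
  let ?n = "k + tapes M"
  have len: "length ts = ?n" and rep: "\<And>i. i < ?n \<Longrightarrow> tape_repr (ts ! i) (s i)"
    using assms(1) by (auto simp: store_repr_def)
  obtain t g where tg: "compile 0 c ! q = (t, g)" by force
  have "(t, g) \<in> set (compile 0 c)" using assms(2) tg by (metis length_compile nth_mem)
  then have t: "t < ?n" using compile_wf[OF assms(3)] by fastforce
  obtain bd p where g: "g (head_symbol (s t)) = (bd, p)" by (metis surj_pair)
  have q': "q' = p" and s': "s' = s(t := act bd (s t))"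
    using assms(4) by (auto simp: istep_def tg g)
  have rd: "tape_read (ts ! t) = head_symbol (s t)" using tape_repr_read rep t by blast
  define ts' where "ts' = map2 tape_act (map (\<lambda>i. if i = t then bd else (map tape_read ts ! i, Stay))
      [0..<length (map tape_read ts)]) ts"
  have "tm_step (prefixed k c M) (q, ts) = (q', ts')"
    using assms(2) t g rd len
    by (simp add: tm_step_def prefixed_simps delta_prefixed tg q' ts'_def)
  moreover have "tape_repr (ts' ! i) (s' i)" if i: "i < ?n" for i
  proof -
    have "ts' ! i = tape_act (if i = t then bd else (head_symbol (s i), Stay)) (ts ! i)"
      using i len tape_repr_read[OF rep[OF i]] by (simp add: ts'_def)
    then show ?thesis using tape_repr_act[OF rep[OF i], of bd]
        tape_repr_act[OF rep[OF i], of "(head_symbol (s i), Stay)"]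
      by (auto simp: s' act_head)
  qed
  ultimately show ?thesis using len by (auto simp: store_repr_def ts'_def)
qed

lemma tm_steps_prefixed_code:
  assumes "iruns (compile 0 c) (q, s) m (q', s')" "store_repr (k + tapes M) ts s"
    and "com_wf (k + tapes M) c"
  shows "\<exists>ts'. (tm_step (prefixed k c M) ^^ m) (q, ts) = (q', ts') \<and> store_repr (k + tapes M) ts' s'"
  using assms
proof (induction m arbitrary: q s ts)
  case 0
  then show ?case by (auto elim: iruns.cases)
next
  case (Suc m)
  from Suc.prems(1) have q: "q < code_size c" and r: "iruns (compile 0 c) (istep (compile 0 c) (q, s)) m (q', s')"
    by (auto elim: iruns.cases)
  obtain q1 s1 where st: "istep (compile 0 c) (q, s) = (q1, s1)" by force
  obtain ts1 where "tm_step (prefixed k c M) (q, ts) = (q1, ts1)" "store_repr (k + tapes M) ts1 s1"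
    using tm_step_prefixed_code[OF Suc.prems(2) q Suc.prems(3) st] by blast
  then show ?case using Suc.IH[OF r[unfolded st] _ Suc.prems(3)]
    by (simp add: funpow_Suc_right del: funpow.simps)
qed

lemma store_repr_stay:
  assumes "store_repr n ts s"
  shows "store_repr n (map2 tape_act (map (\<lambda>a. (a, Stay)) (map tape_read ts)) ts) s"
  using assms tape_repr_act[of "ts ! i" "s i" "(head_symbol (s i), Stay)" for i]
  by (auto simp: store_repr_def tape_repr_read act_head)

text \<open>\<open>turing_machine\<close> constrains \<open>delta\<close> on words over the alphabet
  only. This invariant keeps the simulated run inside that domain.\<close>

definition symbols_in :: "symbol set \<Rightarrow> tape list \<Rightarrow> bool" where
  "symbols_in A ts \<longleftrightarrow> (\<forall>(l, r) \<in> set ts. set l \<union> set r \<subseteq> A)"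

lemma symbols_in_read:
  assumes "symbols_in A ts" "0 \<in> A"
  shows "set (map tape_read ts) \<subseteq> A"
proof -
  have "tape_read (l, r) \<in> A" if "set r \<subseteq> A" for l r
    using that assms(2) by (cases r) auto
  then show ?thesis using assms(1) by (fastforce simp: symbols_in_def)
qed

lemma symbols_in_act:
  assumes "symbols_in A ts" "0 \<in> A" "fst ` set acts \<subseteq> A"
  shows "symbols_in A (map2 tape_act acts ts)"
proof -
  have *: "set (fst (tape_act bd tp)) \<union> set (snd (tape_act bd tp)) \<subseteq> A"
    if "set (fst tp) \<union> set (snd tp) \<subseteq> A" "fst bd \<in> A" for bd tp
  proof -
    obtain l r b d where [simp]: "tp = (l, r)" "bd = (b, d)" by (cases tp; cases bd) auto
    have "set (tl l) \<subseteq> A" "set (tl r) \<subseteq> A" "tape_read ([], l) \<in> A"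
      using that assms(2) by (cases l; cases r; auto)+
    then show ?thesis using that by (cases d) auto
  qed
  show ?thesis unfolding symbols_in_def
  proof
    fix t
    assume "t \<in> set (map2 tape_act acts ts)"
    then obtain bd tp where t: "(bd, tp) \<in> set (zip acts ts)" "t = tape_act bd tp"
      unfolding set_map by (auto simp del: tape_act.simps)
    then have "bd \<in> set acts" "tp \<in> set ts" by (auto dest: set_zip_leftD set_zip_rightD)
    then have "set (fst t) \<union> set (snd t) \<subseteq> A"
      using *[of tp bd] assms(1,3) unfolding t(2) by (auto simp: symbols_in_def case_prod_beta)
    then show "case t of (l, r) \<Rightarrow> set l \<union> set r \<subseteq> A" by (simp add: case_prod_beta)
  qed
qed

text \<open>Since only alphabet symbols are scanned, \<open>acts\<close> has length
  \<open>tapes M\<close>; appended to the \<open>k\<close> idle actions it therefore pairs each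
  action with its tape. Halting states are frozen in both machines alike, so the simulation is step
  by step even after the answer.\<close>

lemma tm_step_prefixed_machine:
  assumes "length ts = k + tapes M" "list_all2 tape_equiv (drop k ts) us"
    and M: "turing_machine M" "p \<in> states M" "tm_step M (p, us) = (p', us')"
    and us: "symbols_in (alphabet M) us"
  shows "\<exists>ts'. tm_step (prefixed k c M) (code_size c + 1 + p, ts) = (code_size c + 1 + p', ts') \<and>
      length ts' = k + tapes M \<and> list_all2 tape_equiv (drop k ts') us' \<and> p' \<in> states M \<and>
      symbols_in (alphabet M) us'"
proof -
  have rd: "drop k (map tape_read ts) = map tape_read us"
    using assms(2) unfolding drop_map[symmetric]
    by (auto simp: list_all2_conv_all_nth tape_equiv_read drop_map intro!: nth_equalityI)
  have lus: "length us = tapes M" using assms(1,2) by (auto dest: list_all2_lengthD)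
  show ?thesis
  proof (cases "p = yes_state M \<or> p = no_state M")
    case True
    then show ?thesis using assms by (auto simp: tm_step_def prefixed_simps)
  next
    case False
    obtain r acts where d: "delta M p (map tape_read us) = (r, acts)" by force
    have zero: "0 \<in> alphabet M" using M(1) by (auto simp: turing_machine_def)
    have *: "r \<in> states M \<and> length acts = tapes M \<and> fst ` set acts \<subseteq> alphabet M"
      using turing_machine_delta[OF M(1,2) _ symbols_in_read[OF us zero] d] lus by simp
    moreover have pu: "p' = r" "us' = map2 tape_act acts us"
      using M(3) d False by (auto simp: tm_step_def)
    ultimately have len: "length acts = tapes M" and r: "p' \<in> states M"
      and sym: "symbols_in (alphabet M) us'" using symbols_in_act[OF us zero] by auto
    define ts' where "ts' = map2 tape_act (map (\<lambda>a. (a, Stay)) (take k (map tape_read ts)) @ acts) ts"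
    have "tm_step (prefixed k c M) (code_size c + 1 + p, ts) = (code_size c + 1 + p', ts')"
      using False d rd delta_prefixed(3)[of k c M p "map tape_read ts"]
      by (simp add: tm_step_def prefixed_simps pu ts'_def)
    moreover have "length ts' = k + tapes M" using len assms(1) by (simp add: ts'_def)
    moreover have "drop k ts' = map2 tape_act acts (drop k ts)"
      using assms(1) len by (auto simp: ts'_def drop_map drop_zip)
    then have "list_all2 tape_equiv (drop k ts') us'"
      using assms(2) len lus unfolding pu by (auto simp: list_all2_conv_all_nth tape_equiv_act)
    ultimately show ?thesis using r sym by blast
  qed
qed

lemma tm_steps_prefixed_machine:
  assumes "length ts = k + tapes M" "list_all2 tape_equiv (drop k ts) us"
    and "turing_machine M" "p \<in> states M" "symbols_in (alphabet M) us"
  shows "fst ((tm_step (prefixed k c M) ^^ m) (code_size c + 1 + p, ts)) =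
    code_size c + 1 + fst ((tm_step M ^^ m) (p, us))"
  using assms
proof (induction m arbitrary: p ts us)
  case (Suc m)
  obtain p' us' where st: "tm_step M (p, us) = (p', us')" by force
  from tm_step_prefixed_machine[OF Suc.prems(1-4) st Suc.prems(5), of c]
  obtain ts' where ts': "tm_step (prefixed k c M) (code_size c + 1 + p, ts) = (code_size c + 1 + p', ts')"
      "length ts' = k + tapes M" "list_all2 tape_equiv (drop k ts') us'" "p' \<in> states M"
      "symbols_in (alphabet M) us'" by blast
  show ?case using Suc.IH[OF ts'(2,3) Suc.prems(3) ts'(4,5)]
    by (simp only: funpow_Suc_right o_apply st ts'(1))
qed simp

definition input_store :: "symbol list \<Rightarrow> store" where
  "input_store v = (\<lambda>i. if i = 0 then input_tape v else input_tape [])"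

lemma prefixed_code_run:
  assumes M: "turing_machine M" and c: "com_wf (k + tapes M) c"
    and run: "computes c (input_store v) T s"
  obtains m ts where "m \<le> T" "store_repr (k + tapes M) ts s"
    "(tm_step (prefixed k c M) ^^ m) (tm_init (prefixed k c M) v) = (code_size c, ts)"
proof -
  obtain m where m: "m \<le> T" "exec c (input_store v) m s" using run by (auto simp: computes_def)
  have ir: "iruns (compile 0 c) (0, input_store v) m (code_size c, s)"
    using iruns_compile[OF m(2), of "compile 0 c" "[]" "[]"] by simp
  define ts0 where "ts0 = ([], v) # replicate (k + tapes M - 1) ([] :: symbol list, [] :: symbol list)"
  have "tapes M \<ge> 1" using M by (auto simp: turing_machine_def)
  then have "store_repr (k + tapes M) ts0 (input_store v)"
    by (auto simp: store_repr_def ts0_def input_store_def nth_Cons tape_repr_input split: nat.split)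
  from tm_steps_prefixed_code[OF ir this c] obtain ts where
    "(tm_step (prefixed k c M) ^^ m) (0, ts0) = (code_size c, ts)" "store_repr (k + tapes M) ts s" by blast
  then show ?thesis using m that[of m ts] by (simp add: tm_init_def prefixed_simps ts0_def)
qed

lemma prefixed_final_step:
  assumes "store_repr (k + tapes M) ts s" "tapes M \<ge> 1"
  obtains ts' where "store_repr (k + tapes M) ts' s"
    "tm_step (prefixed k c M) (code_size c, ts) =
      (code_size c + 1 + (if head_symbol (s k) = 0 then no_state M else start M), ts')"
proof
  show "store_repr (k + tapes M) (map2 tape_act (map (\<lambda>a. (a, Stay)) (map tape_read ts)) ts) s"
    using store_repr_stay[OF assms(1)] .
  have "tape_read (ts ! k) = head_symbol (s k)" "k < length ts"
    using assms tape_repr_read by (auto simp: store_repr_def)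
  then show "tm_step (prefixed k c M) (code_size c, ts) =
      (code_size c + 1 + (if head_symbol (s k) = 0 then no_state M else start M),
       map2 tape_act (map (\<lambda>a. (a, Stay)) (map tape_read ts)) ts)"
    by (simp add: tm_step_def prefixed_simps delta_prefixed(2))
qed

lemma prefixed_yes:
  assumes "turing_machine M" "com_wf (k + tapes M) c" "computes c (input_store v) T s"
    and "head_symbol (s k) = 0"
  shows "\<exists>m\<le>T + 1. state_after (prefixed k c M) v m = yes_state (prefixed k c M)"
proof -
  obtain m ts where m: "m \<le> T" "store_repr (k + tapes M) ts s"
    "(tm_step (prefixed k c M) ^^ m) (tm_init (prefixed k c M) v) = (code_size c, ts)"
    using prefixed_code_run[OF assms(1-3)] .
  have "tapes M \<ge> 1" using assms(1) by (auto simp: turing_machine_def)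
  obtain ts' where "tm_step (prefixed k c M) (code_size c, ts) = (yes_state (prefixed k c M), ts')"
    using prefixed_final_step[OF m(2) \<open>tapes M \<ge> 1\<close>, of c] unfolding assms(4) prefixed_simps by auto
  then have "fst ((tm_step (prefixed k c M) ^^ Suc m) (tm_init (prefixed k c M) v)) = yes_state (prefixed k c M)"
    unfolding funpow.simps o_apply m(3) by simp
  then show ?thesis using m(1) by (auto simp: state_after_def intro!: exI[of _ "Suc m"])
qed

text \<open>The hypotheses on \<open>s\<close> say that \<open>M\<close> meets its initial
  configuration up to a shift: the word from the head of tape \<open>k\<close> on, and blank tapes
  behind it. The delay \<open>m\<close> is chosen before \<open>l\<close>, so both the answers and
  the running time of \<open>M\<close> carry over.\<close>

lemma prefixed_simulates:
  assumes M: "turing_machine M" and c: "com_wf (k + tapes M) c"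
    and run: "computes c (input_store v) T s"
    and nonblank: "head_symbol (s k) \<noteq> 0" and w: "set w \<subseteq> alphabet M"
    and out: "\<And>i. snd (s k) (fst (s k) + i) = snd (input_tape w) i"
    and blank: "\<And>j. j > k \<Longrightarrow> s j = input_tape []"
  shows "\<exists>m\<le>T + 1. \<forall>l. state_after (prefixed k c M) v (l + m) = code_size c + 1 + state_after M w l"
proof -
  let ?P = "prefixed k c M"
  obtain m ts where m: "m \<le> T" "store_repr (k + tapes M) ts s"
    "(tm_step ?P ^^ m) (tm_init ?P v) = (code_size c, ts)"
    using prefixed_code_run[OF M c run] .
  have tM: "tapes M \<ge> 1" using M by (auto simp: turing_machine_def)
  obtain ts' where ts': "store_repr (k + tapes M) ts' s"
    "tm_step ?P (code_size c, ts) = (code_size c + 1 + start M, ts')"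
    using prefixed_final_step[OF m(2) tM, of c] nonblank by auto
  let ?us = "([], w) # replicate (tapes M - 1) ([] :: symbol list, [] :: symbol list)"
  have len: "length ts' = k + tapes M" and rep: "\<And>i. i < k + tapes M \<Longrightarrow> tape_repr (ts' ! i) (s i)"
    using ts'(1) by (auto simp: store_repr_def)
  have "tape_equiv (drop k ts' ! i) (?us ! i)" if i: "i < tapes M" for i
  proof (cases "i = 0")
    case True
    have "tape_equiv (ts' ! k) ([], w)"
      using rep[of k] tM out tape_equivI[OF _ tape_repr_input] by (simp add: input_tape_def)
    then show ?thesis using len True by simp
  next
    case False
    have "tape_equiv (ts' ! (k + i)) ([], [])"
      using rep[of "k + i"] i False blank[of "k + i"] tape_equivI[OF _ tape_repr_input]
      by (simp add: input_tape_Nil)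
    then show ?thesis using len i False by (simp add: nth_Cons')
  qed
  then have eq: "list_all2 tape_equiv (drop k ts') ?us" using len tM by (auto simp: list_all2_conv_all_nth)
  have "start M \<in> states M" using M by (auto simp: turing_machine_def)
  moreover have "symbols_in (alphabet M) ?us" using w by (auto simp: symbols_in_def)
  ultimately have *: "fst ((tm_step ?P ^^ l) (code_size c + 1 + start M, ts')) =
      code_size c + 1 + fst ((tm_step M ^^ l) (tm_init M w))" for l
    unfolding tm_init_def by (rule tm_steps_prefixed_machine[OF len eq M])
  have "(tm_step ?P ^^ Suc m) (tm_init ?P v) = (code_size c + 1 + start M, ts')"
    unfolding funpow.simps o_apply m(3) ts'(2) ..
  then have "state_after ?P v (l + Suc m) = code_size c + 1 + state_after M w l" for l
    unfolding state_after_def funpow_add o_apply by (simp only: *)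
  then show ?thesis using m(1) by (intro exI[of _ "Suc m"]) auto
qed

section \<open>The program computing the matrix\<close>

abbreviation "go t d \<equiv> Do t (\<lambda>a. (a, d))"
abbreviation "left t \<equiv> go t Move_Left"
abbreviation "right t \<equiv> go t Move_Right"
abbreviation "skip \<equiv> go 0 Stay"
abbreviation "write t b \<equiv> Do t (\<lambda>_. (b, Stay))"
abbreviation "nonblank \<equiv> (\<lambda>a :: symbol. a \<noteq> 0)"

abbreviation "out_tape \<equiv> 5 :: nat"

text \<open>The output grows to the left, so that the head ends on its first symbol, where the next
  machine expects it.\<close>

definition push :: "symbol \<Rightarrow> com" where
  "push b = left out_tape ;; write out_tape b"

fun push_list :: "symbol list \<Rightarrow> com" where
  "push_list [] = skip"
| "push_list (b # bs) = push_list bs ;; push b"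

definition move_head :: "int \<Rightarrow> atape \<Rightarrow> atape" where
  "move_head k a = (fst a + k, snd a)"

definition put :: "symbol \<Rightarrow> atape \<Rightarrow> atape" where
  "put b a = (fst a, (snd a)(fst a := b))"

lemma move_head_Pair [simp]: "move_head k (p, c) = (p + k, c)"
  by (simp add: move_head_def)

lemma put_Pair [simp]: "put b (p, c) = (p, c(p := b))"
  by (simp add: put_def)

lemma head_symbol_Pair [simp]: "head_symbol (p, c) = c p"
  by (simp add: head_symbol_def)

lemma computes_go: "computes (go t d) s 1 (s(t := move_head (offset d) (s t)))"
  by (rule computes_Do) (simp add: act_def move_head_def head_symbol_def)

lemma computes_write: "computes (write t b) s 1 (s(t := put b (s t)))"
  by (rule computes_Do) (simp add: act_def put_def)

lemma computes_skip: "computes skip s 1 s"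
  by (rule computes_Do) (simp add: act_head)

lemma computes_at: "computes c s T s' \<Longrightarrow> t = s \<Longrightarrow> computes c t T s'"
  by simp

lemma computes_weaken: "computes c s T s' \<Longrightarrow> s' = t \<Longrightarrow> T \<le> T' \<Longrightarrow> computes c s T' t"
  using computes_mono by blast

text \<open>The word fills the cells from \<open>- length w\<close> to -1 with the head on its first
  symbol, as pushes starting from cell 0 of a blank tape leave it.\<close>

definition out :: "symbol list \<Rightarrow> atape" where
  "out w = (- int (length w), \<lambda>i. if i < - int (length w) then 0 else nth_default 0 w (nat (i + int (length w))))"

lemma out_Nil: "out [] = input_tape []"
  by (auto simp: out_def input_tape_def)

lemma out_input_tape: "snd (out w) (fst (out w) + i) = snd (input_tape w) i"
  by (auto simp: out_def input_tape_def)

lemma out_Cons: "out (b # w) = put b (move_head (- 1) (out w))"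
proof
  show "fst (out (b # w)) = fst (put b (move_head (- 1) (out w)))"
    by (simp add: out_def)
  show "snd (out (b # w)) = snd (put b (move_head (- 1) (out w)))"
  proof
    fix i :: int
    have "nat (i + (1 + int (length w))) = Suc (nat (i + int (length w)))" if "i \<ge> - int (length w)"
      using that by linarith
    then show "snd (out (b # w)) i = snd (put b (move_head (- 1) (out w))) i"
      by (cases "i < - int (length w)") (auto simp: out_def)
  qed
qed

lemma computes_push:
  assumes "s out_tape = out w"
  shows "computes (push b) s 2 (s(out_tape := out (b # w)))"
  unfolding push_def
  by (rule computes_weaken, rule computes_Seq, rule computes_go, rule computes_write)
    (auto simp: assms out_Cons)

lemma computes_push_list:
  assumes "s out_tape = out w"
  shows "computes (push_list bs) s (2 * length bs + 1) (s(out_tape := out (bs @ w)))"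
proof (induction bs)
  case Nil
  then show ?case using computes_skip[of s] assms by (simp add: fun_upd_idem)
next
  case (Cons b bs)
  let ?s = "s(out_tape := out (bs @ w))"
  have "computes (push b) ?s 2 (?s(out_tape := out (b # bs @ w)))"
    by (rule computes_push) simp
  from computes_Seq[OF Cons this] show ?case by (simp del: fun_upd_apply)
qed

lemma computes_scan:
  assumes "s t = (p, c)" "\<And>i. i < n \<Longrightarrow> P (c (p + int i * offset d))" "\<not> P (c (p + int n * offset d))"
  shows "computes (While t P (go t d)) s (3 * n + 1) (s(t := (p + int n * offset d, c)))"
proof (rule computes_While'[where S = "\<lambda>i. s(t := (p + int i * offset d, c))" and T = 1 and n = n])
  show "computes (go t d) (s(t := (p + int i * offset d, c))) 1 (s(t := (p + int (Suc i) * offset d, c)))" for i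
    by (rule computes_weaken, rule computes_go) (auto simp: algebra_simps)
qed (use assms in \<open>auto simp: fun_upd_idem\<close>)

lemma computes_scan2:
  assumes "s t = (p, c)" "s t' = (p', c')" "t \<noteq> t'"
    "\<And>i. i < n \<Longrightarrow> P (c (p + int i * offset d))" "\<not> P (c (p + int n * offset d))"
  shows "computes (While t P (go t d ;; go t' d')) s (4 * n + 1)
    (s(t := (p + int n * offset d, c), t' := (p' + int n * offset d', c')))"
proof (rule computes_While'[where
    S = "\<lambda>i. s(t := (p + int i * offset d, c), t' := (p' + int i * offset d', c'))" and T = 2 and n = n])
  show "computes (go t d ;; go t' d') (s(t := (p + int i * offset d, c), t' := (p' + int i * offset d', c'))) 2
     (s(t := (p + int (Suc i) * offset d, c), t' := (p' + int (Suc i) * offset d', c')))" for i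
    using assms(3)
    by (intro computes_weaken[OF computes_Seq[OF computes_go computes_go]]) (auto simp: algebra_simps)
qed (use assms in \<open>auto simp: fun_upd_idem\<close>)

definition ones :: "nat \<Rightarrow> int \<Rightarrow> symbol" where
  "ones n = (\<lambda>i. if 0 \<le> i \<and> i < int n then 1 else 0)"

definition cells :: "symbol list \<Rightarrow> int \<Rightarrow> symbol" where
  "cells w = snd (input_tape w)"

lemma cells_nth: "i < length w \<Longrightarrow> cells w (int i) = w ! i"
  by (simp add: cells_def input_tape_def nth_default_nth)

lemma cells_outside: "i < 0 \<or> i \<ge> int (length w) \<Longrightarrow> cells w i = 0"
  by (auto simp: cells_def input_tape_def nth_default_def)

lemma input_tape_cells: "input_tape w = (0, cells w)"
  by (simp add: cells_def input_tape_def)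

lemma ones_Suc: "(ones n)(int n := Suc 0) = ones (Suc n)"
  by (auto simp: ones_def)

text \<open>The tapes in order: input, \<open>1\<^sup>n\<close>, the square root in unary and in binary, the diagonal mark, output.\<close>

definition st :: "atape \<Rightarrow> atape \<Rightarrow> atape \<Rightarrow> atape \<Rightarrow> atape \<Rightarrow> atape \<Rightarrow> store" where
  "st I D C S X O' = (\<lambda>i. if i = 0 then I else if i = 1 then D else if i = 2 then C else
     if i = 3 then S else if i = 4 then X else if i = 5 then O' else input_tape [])"

lemma st_simps [simp]:
  "st I D C S X O' 0 = I" "st I D C S X O' (Suc 0) = D" "st I D C S X O' 2 = C" "st I D C S X O' 3 = S"
  "st I D C S X O' 4 = X" "st I D C S X O' 5 = O'"
  by (auto simp: st_def)

lemma st_update [simp]: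
  "(st I D C S X O')(0 := x) = st x D C S X O'"
  "(st I D C S X O')(Suc 0 := x) = st I x C S X O'"
  "(st I D C S X O')(2 := x) = st I D x S X O'"
  "(st I D C S X O')(3 := x) = st I D C x X O'"
  "(st I D C S X O')(4 := x) = st I D C S x O'"
  "(st I D C S X O')(5 := x) = st I D C S X x"
  by (auto simp: st_def)

lemma encode_nat_0: "encode_nat 0 = []"
  by (simp add: encode_nat.simps)

lemma encode_nat_rec: "n > 0 \<Longrightarrow> encode_nat n = bit (odd n) # encode_nat (n div 2)"
  by (subst encode_nat.simps) simp

lemma input_store_st:
  "input_store v = st (0, cells v) (0, ones 0) (0, ones 0) (0, cells (encode_nat 0)) (0, ones 0) (out [])"
proof -
  have "(0, ones 0) = input_tape []" by (auto simp: input_tape_Nil ones_def)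
  moreover have "(0, cells []) = input_tape []" by (simp add: input_tape_cells)
  ultimately show ?thesis
    by (auto simp: fun_eq_iff st_def input_store_def out_Nil encode_nat_0 input_tape_cells[of v])
qed

text \<open>This is the test n >= N: from cell n, just behind 1^n, \<open>N\<close> steps to the
  left lead to a 1 exactly if 1 <= N <= n.\<close>

fun lefts :: "nat \<Rightarrow> com" where
  "lefts 0 = skip"
| "lefts (Suc N) = left 1 ;; lefts N"

text \<open>The first row has length n and ends with the symbol 6; the blank is met instead if the
  graph has no vertices and the input is empty.\<close>

definition count_vertices :: com where
  "count_vertices = While 0 (\<lambda>a. a \<noteq> 0 \<and> a \<noteq> 6) (write 1 1 ;; right 1 ;; right 0)"

text \<open>Least significant digit first, with 2 for the digit one and 1 for the digit zero: the
  carry clears the leading ones, sets the next digit or the first blank, and the head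
  returns.\<close>

definition incr :: com where
  "incr = While 3 (\<lambda>a. a = 2) (write 3 1 ;; right 3) ;; write 3 2 ;; While 3 nonblank (left 3) ;; right 3"

text \<open>
  The head of the second tape walks to the left over \<open>1\<^sup>n\<close> by the consecutive odd numbers \<open>2c + 1\<close>,
  so that it leaves \<open>1\<^sup>n\<close> after \<open>c\<close> rounds for the least \<open>c\<close> with \<open>n \<le> c\<^sup>2\<close>.
\<close>

definition root_step :: com where
  "root_step = left 2 ;; While 2 nonblank (left 2 ;; left 1) ;; right 2 ;;
     While 2 nonblank (right 2 ;; left 1) ;; write 2 1 ;; right 2 ;; left 1 ;; incr"

definition find_root :: com where
  "find_root = While 1 nonblank (right 1) ;; left 1 ;; While 1 nonblank root_step"

definition reset_heads :: com where
  "reset_heads = While 1 (\<lambda>a. a = 0) (right 1) ;; While 1 nonblank (right 1) ;; left 1 ;;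
     While 0 nonblank (right 0) ;; left 0 ;; write 4 1"

definition emit_root :: com where
  "emit_root = While 3 nonblank (right 3) ;; left 3 ;;
     While 3 nonblank (If 3 (\<lambda>a. a = 1) (push 1) (push 2) ;; left 3) ;; right 3"

text \<open>One bit of the graph yields two adjacent entries, pushed backwards: the comma, the root
  in binary, \<open>1/\<close>, a minus sign for a non-edge, and then the entry of the identity,
  where \<open>[2, 4, 2, 5]\<close> spells \<open>1/1,\<close> and \<open>[4, 2, 5]\<close> spells
  \<open>0/1,\<close> with the empty numeral for 0.\<close>

definition emit_entry :: com where
  "emit_entry = push 5 ;; emit_root ;; push_list [2, 4] ;; If 0 (\<lambda>a. a = 1) (push_list [3]) (push_list []) ;;
     If 4 nonblank (push_list [2, 4, 2, 5]) (push_list [4, 2, 5]) ;; left 1 ;; left 4 ;; left 0"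

text \<open>
  The input is read and the output written from right to left. The fifth tape carries a single mark,
  and its head scans it exactly at the diagonal entries: per row it moves \<open>n\<close> cells to the left and
  \<open>n + 1\<close> cells back to the right while the zero row is written.
\<close>

definition emit_row :: com where
  "emit_row = push 6 ;; left 0 ;; While 1 nonblank emit_entry ;; push 6 ;; right 1 ;;
     While 1 nonblank (push_list [4, 2, 5, 4, 2, 5] ;; right 1 ;; right 4) ;; left 1 ;; right 4"

text \<open>For n < N nothing is emitted; the blank under the output head then makes
  \<open>prefixed\<close> answer "yes".\<close>

definition reduction :: "nat \<Rightarrow> com" where
  "reduction N = count_vertices ;; lefts N ;;
     If 1 nonblank (find_root ;; reset_heads ;; While 0 nonblank emit_row) skip"

section \<open>Correctness and running time of the program\<close>

lemma com_wf_push: "k > out_tape \<Longrightarrow> com_wf k (push b) \<longleftrightarrow> b \<le> 6"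
  by (auto simp: push_def dest: spec[of _ "Suc b"])

lemma com_wf_push_list: "k > out_tape \<Longrightarrow> com_wf k (push_list bs) \<longleftrightarrow> set bs \<subseteq> {..6}"
  by (induction bs) (auto simp: com_wf_push)

lemma com_wf_reduction:
  assumes "k > out_tape"
  shows "com_wf k (reduction N)"
proof -
  have "com_wf k (lefts N)" using assms by (induction N) auto
  then show ?thesis using assms
    by (simp add: reduction_def count_vertices_def find_root_def root_step_def incr_def reset_heads_def
        emit_root_def emit_entry_def emit_row_def com_wf_push com_wf_push_list)
qed

lemma computes_lefts:
  "computes (lefts N) (st I (p, c) C S X O') (N + 1) (st I (p - int N, c) C S X O')"
proof (induction N arbitrary: p)
  case 0
  then show ?case using computes_skip[of "st I (p, c) C S X O'"] by simp
next
  case (Suc N)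
  show ?case unfolding lefts.simps
    by (rule computes_weaken, rule computes_Seq, rule computes_go, simp, rule Suc) (auto simp: algebra_simps)
qed

lemma computes_count_vertices:
  assumes "\<And>i. i < n \<Longrightarrow> cells v (int i) \<noteq> 0 \<and> cells v (int i) \<noteq> 6"
    and "cells v (int n) = 0 \<or> cells v (int n) = 6"
  shows "computes count_vertices (st (0, cells v) (0, ones 0) C S X O') (5 * n + 1)
    (st (int n, cells v) (int n, ones n) C S X O')"
  unfolding count_vertices_def
proof (rule computes_While'[where S = "\<lambda>i. st (int i, cells v) (int i, ones i) C S X O'" and T = 3 and n = n])
  show "computes (write 1 1;; right 1;; right 0) (st (int i, cells v) (int i, ones i) C S X O') 3
          (st (int (Suc i), cells v) (int (Suc i), ones (Suc i)) C S X O')" for i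
    by (rule computes_weaken, rule computes_Seq, rule computes_write, rule computes_Seq, rule computes_go,
        rule computes_go) (auto simp: ones_Suc add.commute)
qed (use assms in auto)

text \<open>The carry runs through \<open>r\<close> digits one. With \<open>xs = []\<close> it
  overflows into a new leading digit, otherwise it replaces a digit zero; \<open>tl\<close> covers
  both cases.\<close>

lemma encode_nat_Suc:
  "\<exists>r xs. encode_nat s = replicate r 2 @ xs \<and> encode_nat (Suc s) = replicate r 1 @ 2 # tl xs \<and>
     (xs = [] \<or> hd xs = 1)"
proof (induction s rule: less_induct)
  case (less s)
  consider "s = 0" | "s > 0" "even s" | "odd s" by auto
  then show ?case
  proof cases
    case 1
    have "encode_nat 0 = []" "encode_nat (Suc 0) = [2]" by (simp_all add: encode_nat_0 encode_nat_rec bit_def)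
    then show ?thesis unfolding 1 by (intro exI[of _ 0] exI[of _ "[]"]) simp
  next
    case 2
    then have "encode_nat s = 1 # encode_nat (s div 2)" "encode_nat (Suc s) = 2 # encode_nat (s div 2)"
      using encode_nat_rec[of s] encode_nat_rec[of "Suc s"] by (auto simp: bit_def)
    then show ?thesis by (intro exI[of _ 0] exI[of _ "encode_nat s"]) simp
  next
    case 3
    then have e: "encode_nat s = 2 # encode_nat (s div 2)" "encode_nat (Suc s) = 1 # encode_nat (Suc (s div 2))"
      using encode_nat_rec[of s] encode_nat_rec[of "Suc s"] by (auto simp: bit_def)
    have "s div 2 < s" using 3 by (cases s) auto
    from less.IH[OF this] obtain r xs where
      "encode_nat (s div 2) = replicate r 2 @ xs" "encode_nat (Suc (s div 2)) = replicate r 1 @ 2 # tl xs"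
      "xs = [] \<or> hd xs = 1" by blast
    then show ?thesis using e by (intro exI[of _ "Suc r"] exI[of _ xs]) simp
  qed
qed

lemma length_encode_nat_le: "length (encode_nat s) \<le> s"
proof (induction s rule: less_induct)
  case (less s)
  show ?case
  proof (cases "s = 0")
    case False
    then have "length (encode_nat s) = Suc (length (encode_nat (s div 2)))" using encode_nat_rec by simp
    moreover have "length (encode_nat (s div 2)) \<le> s div 2" using False less[of "s div 2"] by simp
    ultimately show ?thesis using False by linarith
  qed (simp add: encode_nat_0)
qed

lemma set_encode_nat: "set (encode_nat s) \<subseteq> {1, 2}"
proof (induction s rule: less_induct)
  case (less s)
  show ?case
  proof (cases "s = 0")
    case False
    then have "encode_nat s = bit (odd s) # encode_nat (s div 2)" using encode_nat_rec by simp
    then show ?thesis using False less[of "s div 2"] by (auto simp: bit_def)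
  qed (simp add: encode_nat_0)
qed

lemma cells_update:
  "i < length w \<Longrightarrow> (cells w)(int i := b) = cells (w[i := b])"
  "(cells w)(int (length w) := b) = cells (w @ [b])"
proof -
  show "(cells w)(int i := b) = cells (w[i := b])" if "i < length w"
  proof
    fix j
    show "((cells w)(int i := b)) j = cells (w[i := b]) j"
      using that by (cases "j < 0"; cases "nat j < length w")
        (auto simp: cells_def input_tape_def nth_default_def nth_list_update)
  qed
  show "(cells w)(int (length w) := b) = cells (w @ [b])"
  proof
    fix j
    show "((cells w)(int (length w) := b)) j = cells (w @ [b]) j"
      by (cases "j < 0") (auto simp: cells_def input_tape_def nth_default_def nth_append)
  qed
qed

lemma computes_incr:
  "computes incr (st I D C (0, cells (encode_nat s)) X O') (7 * s + 10)
     (st I D C (0, cells (encode_nat (Suc s))) X O')"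
proof -
  obtain r xs where xs: "encode_nat s = replicate r 2 @ xs"
    "encode_nat (Suc s) = replicate r 1 @ 2 # tl xs" "xs = [] \<or> hd xs = 1"
    using encode_nat_Suc[of s] by blast
  have r: "r \<le> s" using length_encode_nat_le[of s] xs(1) by simp
  let ?w = "\<lambda>i. replicate i 1 @ replicate (r - i) 2 @ xs"
  have 1: "computes (While 3 (\<lambda>a. a = 2) (write 3 1 ;; right 3)) (st I D C (0, cells (encode_nat s)) X O')
      (r * (2 + 2) + 1) (st I D C (int r, cells (?w r)) X O')"
  proof (rule computes_While'[where S = "\<lambda>i. st I D C (int i, cells (?w i)) X O'" and T = 2 and n = r])
    fix i
    assume i: "i < r"
    then have eq: "replicate (r - i) (2 :: symbol) = 2 # replicate (r - Suc i) 2"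
      by (metis Suc_diff_Suc replicate_Suc)
    show "head_symbol (st I D C (int i, cells (?w i)) X O' 3) = 2"
      using i by (simp add: cells_nth nth_append)
    have "(cells (?w i))(int i := 1) = cells (?w (Suc i))"
      using i by (subst cells_update) (auto simp: eq list_update_append replicate_app_Cons_same)
    then show "computes (write 3 1 ;; right 3) (st I D C (int i, cells (?w i)) X O') 2
        (st I D C (int (Suc i), cells (?w (Suc i))) X O')"
      by (intro computes_weaken[OF computes_Seq[OF computes_write computes_go]]) (auto simp: add.commute)
  next
    have "cells (?w r) (int r) \<noteq> 2"
    proof (cases xs)
      case Nil
      then show ?thesis by (simp add: cells_outside)
    next
      case (Cons y ys)
      then show ?thesis using xs(3) by (simp add: cells_nth nth_append)
    qed
    then show "\<not> head_symbol (st I D C (int r, cells (?w r)) X O' 3) = 2" by simp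
  qed (use xs in auto)
  have upd: "(cells (?w r))(int r := 2) = cells (encode_nat (Suc s))"
  proof (cases xs)
    case Nil
    then show ?thesis using cells_update(2)[of "replicate r 1" 2] xs by simp
  next
    case (Cons y ys)
    then show ?thesis using xs by (subst cells_update) (auto simp: list_update_append)
  qed
  have 2: "computes (While 3 nonblank (left 3)) (st I D C (int r, cells (encode_nat (Suc s))) X O')
      (3 * (r + 1) + 1) (st I D C (- 1, cells (encode_nat (Suc s))) X O')"
  proof (rule computes_weaken[OF computes_scan[where p = "int r" and n = "r + 1"]])
    fix i
    assume "i < r + 1"
    then have j: "int r + int i * offset Move_Left = int (r - i)" "r - i < length (encode_nat (Suc s))"
      using xs by auto
    then have "encode_nat (Suc s) ! (r - i) \<in> {1, 2}" using set_encode_nat[of "Suc s"] nth_mem by blast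
    then show "cells (encode_nat (Suc s)) (int r + int i * offset Move_Left) \<noteq> 0"
      unfolding j(1) using j(2) by (auto simp: cells_nth)
  qed (auto simp: cells_outside)
  show ?thesis unfolding incr_def
    apply (rule computes_weaken)
      apply (rule computes_Seq, rule 1)
      apply (rule computes_Seq, rule computes_write)
      apply (rule computes_Seq, rule computes_at[OF 2], simp add: upd[simplified])
      apply (rule computes_go)
    using r by simp_all
qed

lemma computes_root_step:
  "computes root_step (st I (p, ones n) (int c, ones c) (0, cells (encode_nat c)) X O') (15 * c + 17)
     (st I (p - 2 * int c - 1, ones n) (int (Suc c), ones (Suc c)) (0, cells (encode_nat (Suc c))) X O')"
proof -
  let ?S = "(0, cells (encode_nat c))"
  have 1: "computes (While 2 nonblank (left 2 ;; left 1)) (st I (p, ones n) (int c - 1, ones c) ?S X O') (4 * c + 1)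
      (st I (p - int c, ones n) (- 1, ones c) ?S X O')"
    by (rule computes_weaken[OF computes_scan2[where n = c and p = "int c - 1" and c = "ones c" and p' = p and c' = "ones n"]])
      (auto simp: ones_def)
  have 2: "computes (While 2 nonblank (right 2 ;; left 1)) (st I (p - int c, ones n) (0, ones c) ?S X O') (4 * c + 1)
      (st I (p - 2 * int c, ones n) (int c, ones c) ?S X O')"
    by (rule computes_weaken[OF computes_scan2[where n = c and p = 0 and c = "ones c" and p' = "p - int c" and c' = "ones n"]])
      (auto simp: ones_def)
  show ?thesis unfolding root_step_def
    apply (rule computes_weaken)
      apply (rule computes_Seq, rule computes_go)
      apply (rule computes_Seq, rule computes_at[OF 1], simp)
      apply (rule computes_Seq, rule computes_go)
      apply (rule computes_Seq, rule computes_at[OF 2], simp)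
      apply (rule computes_Seq, rule computes_write)
      apply (rule computes_Seq, rule computes_go)
      apply (rule computes_Seq, rule computes_go)
      apply (rule computes_at[OF computes_incr], simp)
     apply (simp_all add: ones_Suc add.commute)
    done
qed

text \<open>As 1 + 3 + ... + (2c - 1) = c^2, the head is at cell n - 1 - c^2 after c rounds, which
  carries a 1 exactly while c^2 < n.\<close>

lemma computes_root:
  assumes s: "\<And>i. i < s \<Longrightarrow> i\<^sup>2 < n" "n \<le> s\<^sup>2" and N: "N \<le> n"
  shows "computes find_root (st I (int n - int N, ones n) (0, ones 0) (0, cells (encode_nat 0)) X O')
      (3 * N + 3 + s * (15 * s + 19))
      (st I (int n - 1 - int (s\<^sup>2), ones n) (int s, ones s) (0, cells (encode_nat s)) X O')"
proof -
  have 1: "computes (While 1 nonblank (right 1))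
      (st I (int n - int N, ones n) (0, ones 0) (0, cells (encode_nat 0)) X O') (3 * N + 1)
      (st I (int n, ones n) (0, ones 0) (0, cells (encode_nat 0)) X O')"
    by (rule computes_weaken[OF computes_scan[where n = N and p = "int n - int N" and c = "ones n"]])
      (use N in \<open>auto simp: ones_def\<close>)
  have 2: "computes (While 1 nonblank root_step)
      (st I (int n - 1, ones n) (0, ones 0) (0, cells (encode_nat 0)) X O') (s * (15 * s + 17 + 2) + 1)
      (st I (int n - 1 - int (s\<^sup>2), ones n) (int s, ones s) (0, cells (encode_nat s)) X O')"
  proof (rule computes_While'[where n = s and T = "15 * s + 17" and
        S = "\<lambda>i. st I (int n - 1 - int (i\<^sup>2), ones n) (int i, ones i) (0, cells (encode_nat i)) X O'"])
    fix i
    assume "i < s"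
    show "computes root_step
       (st I (int n - 1 - int (i\<^sup>2), ones n) (int i, ones i) (0, cells (encode_nat i)) X O') (15 * s + 17)
       (st I (int n - 1 - int ((Suc i)\<^sup>2), ones n) (int (Suc i), ones (Suc i)) (0, cells (encode_nat (Suc i))) X O')"
      using \<open>i < s\<close> by (intro computes_weaken[OF computes_root_step]) (auto simp: power2_eq_square algebra_simps)
    show "nonblank (head_symbol (st I (int n - 1 - int (i\<^sup>2), ones n) (int i, ones i) (0, cells (encode_nat i)) X O' 1))"
      using s(1)[OF \<open>i < s\<close>] by (auto simp: ones_def simp flip: of_nat_power)
  qed (use s(2) in \<open>auto simp: ones_def simp flip: of_nat_power\<close>)
  show ?thesis unfolding find_root_def
    apply (rule computes_weaken)
      apply (rule computes_Seq, rule computes_at[OF 1], simp)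
      apply (rule computes_Seq, rule computes_go)
      apply (rule computes_at[OF 2], simp)
     apply simp_all
    done
qed

text \<open>Here \<open>k\<close> is the square of the root. By n <= k the head of the second tape
  has fallen off the left end of 1^n, so the first loop leads it back to cell 0.\<close>

lemma computes_reset_heads:
  assumes "n \<ge> 1" "n \<le> k" and m: "m \<le> length v" and v: "0 \<notin> set v"
  shows "computes reset_heads (st (int m, cells v) (int n - 1 - int k, ones n) C S (0, ones 0) O')
     (3 * k + 3 * n + 3 * length v + 9)
     (st (int (length v) - 1, cells v) (int n - 1, ones n) C S (0, ones 1) O')"
proof -
  have 1: "computes (While 1 (\<lambda>a. a = 0) (right 1))
      (st (int m, cells v) (int n - 1 - int k, ones n) C S (0, ones 0) O') (3 * (k + 1 - n) + 1)
      (st (int m, cells v) (0, ones n) C S (0, ones 0) O')"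
    by (rule computes_weaken[OF computes_scan[where n = "k + 1 - n" and p = "int n - 1 - int k" and c = "ones n"]])
      (use assms(1,2) in \<open>auto simp: ones_def\<close>)
  have 2: "computes (While 1 nonblank (right 1))
      (st (int m, cells v) (0, ones n) C S (0, ones 0) O') (3 * n + 1)
      (st (int m, cells v) (int n, ones n) C S (0, ones 0) O')"
    by (rule computes_weaken[OF computes_scan[where n = n and p = 0 and c = "ones n"]])
      (auto simp: ones_def)
  have 3: "computes (While 0 nonblank (right 0))
      (st (int m, cells v) (int n - 1, ones n) C S (0, ones 0) O') (3 * (length v - m) + 1)
      (st (int (length v), cells v) (int n - 1, ones n) C S (0, ones 0) O')"
  proof (rule computes_weaken[OF computes_scan[where n = "length v - m" and p = "int m" and c = "cells v"]])
    fix i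
    assume "i < length v - m"
    then have "m + i < length v" by simp
    moreover from this have "v ! (m + i) \<noteq> 0" using v by (metis nth_mem)
    ultimately have "cells v (int (m + i)) \<noteq> 0" by (simp add: cells_nth del: of_nat_add)
    then show "nonblank (cells v (int m + int i * offset Move_Right))" by simp
  qed (use m in \<open>auto simp: cells_outside\<close>)
  show ?thesis unfolding reset_heads_def
    apply (rule computes_weaken)
      apply (rule computes_Seq, rule computes_at[OF 1], simp)
      apply (rule computes_Seq, rule computes_at[OF 2], simp)
      apply (rule computes_Seq, rule computes_go)
      apply (rule computes_Seq, rule computes_at[OF 3], simp)
      apply (rule computes_Seq, rule computes_go)
      apply (rule computes_write)
    using ones_Suc[of 0] assms(1) by (simp_all add: algebra_simps)
qed

lemma computes_emit_root:
  assumes es: "set es \<subseteq> {1, 2}"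
  shows "computes emit_root (st I D C (0, cells es) X (out w)) (10 * length es + 4)
     (st I D C (0, cells es) X (out (es @ w)))"
proof -
  let ?L = "length es"
  have nz: "cells es (int i) = es ! i \<and> es ! i \<in> {1, 2}" if "i < ?L" for i
    using that es nth_mem by (auto simp: cells_nth)
  have 1: "computes (While 3 nonblank (right 3)) (st I D C (0, cells es) X (out w)) (3 * ?L + 1)
      (st I D C (int ?L, cells es) X (out w))"
  proof (rule computes_weaken[OF computes_scan[where n = ?L and p = 0 and c = "cells es"]])
    show "nonblank (cells es (0 + int i * offset Move_Right))" if "i < ?L" for i
      using nz[OF that] by auto
  qed (auto simp: cells_outside)
  have 2: "computes (While 3 nonblank (If 3 (\<lambda>a. a = 1) (push 1) (push 2) ;; left 3))
      (st I D C (int ?L - 1, cells es) X (out w)) (?L * (5 + 2) + 1)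
      (st I D C (- 1, cells es) X (out (es @ w)))"
  proof (rule computes_While'[where n = ?L and T = 5 and
        S = "\<lambda>i. st I D C (int ?L - 1 - int i, cells es) X (out (drop (?L - i) es @ w))"])
    fix i
    assume i: "i < ?L"
    then have pos: "int ?L - 1 - int i = int (?L - Suc i)" by linarith
    have j: "?L - Suc i < ?L" using i by simp
    have dr: "drop (?L - Suc i) es = es ! (?L - Suc i) # drop (?L - i) es"
      using Cons_nth_drop_Suc[OF j] i by (simp add: Suc_diff_Suc)
    show "nonblank (head_symbol (st I D C (int ?L - 1 - int i, cells es) X (out (drop (?L - i) es @ w)) 3))"
      unfolding pos using nz[OF j] by auto
    have "computes (If 3 (\<lambda>a. a = 1) (push 1) (push 2))
        (st I D C (int (?L - Suc i), cells es) X (out (drop (?L - i) es @ w))) (2 + 2)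
        (st I D C (int (?L - Suc i), cells es) X (out (drop (?L - Suc i) es @ w)))"
      using nz[OF j] dr
      by (intro computes_If computes_weaken[OF computes_push]) auto
    from computes_Seq[OF this computes_go]
    show "computes (If 3 (\<lambda>a. a = 1) (push 1) (push 2) ;; left 3)
        (st I D C (int ?L - 1 - int i, cells es) X (out (drop (?L - i) es @ w))) 5
        (st I D C (int ?L - 1 - int (Suc i), cells es) X (out (drop (?L - Suc i) es @ w)))"
      unfolding pos by (rule computes_weaken) (use i in auto)
  qed (auto simp: cells_outside)
  show ?thesis unfolding emit_root_def
    apply (rule computes_weaken)
      apply (rule computes_Seq, rule computes_at[OF 1], simp)
      apply (rule computes_Seq, rule computes_go)
      apply (rule computes_Seq, rule computes_at[OF 2], simp)
      apply (rule computes_go)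
     apply simp_all
    done
qed

lemma ones_Suc_0: "ones (Suc 0) x = (if x = 0 then 1 else 0)"
  by (auto simp: ones_def)

definition entry_string :: "symbol list \<Rightarrow> symbol list \<Rightarrow> int \<Rightarrow> int \<Rightarrow> symbol list" where
  "entry_string v es a x = (if x = 0 then [2, 4, 2, 5] else [4, 2, 5]) @
     (if cells v a = 1 then [3] else []) @ [2, 4] @ es @ [5]"

lemma computes_entry:
  assumes "set es \<subseteq> {1, 2}"
  shows "computes emit_entry (st (a, cells v) (d, D) C (0, cells es) (x, ones 1) (out w)) (10 * length es + 30)
     (st (a - 1, cells v) (d - 1, D) C (0, cells es) (x - 1, ones 1) (out (entry_string v es a x @ w)))"
proof -
  let ?st = "\<lambda>w. st (a, cells v) (d, D) C (0, cells es) (x, ones 1) (out w)"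
  let ?minus = "if cells v a = 1 then [3] else []"
  let ?diag = "if x = 0 then [2, 4, 2, 5] else [4, 2, 5]"
  have 1: "computes (If 0 (\<lambda>a. a = 1) (push_list [3]) (push_list [])) (?st w) (3 + 2)
      (?st (?minus @ w))" for w
    by (intro computes_If computes_weaken[OF computes_push_list]) auto
  have 2: "computes (If 4 nonblank (push_list [2, 4, 2, 5]) (push_list [4, 2, 5])) (?st w) (9 + 2)
      (?st (?diag @ w))" for w
    by (intro computes_If computes_weaken[OF computes_push_list]) (auto simp: ones_Suc_0)
  show ?thesis unfolding emit_entry_def
    apply (rule computes_weaken)
      apply (rule computes_Seq, rule computes_push, simp)
      apply (rule computes_Seq, rule computes_at[OF computes_emit_root[OF assms]], simp)
      apply (rule computes_Seq, rule computes_push_list, simp)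
      apply (rule computes_Seq, rule computes_at[OF 1], simp)
      apply (rule computes_Seq, rule computes_at[OF 2], simp)
      apply (rule computes_Seq, rule computes_go)
      apply (rule computes_Seq, rule computes_go)
      apply (rule computes_go)
     apply (simp_all add: entry_string_def)
    done
qed

text \<open>The zero row comes first in reading order and is therefore written last.
  \<open>a\<close> is the position of the end-of-row symbol in the input, \<open>x\<close> the
  position on the mark tape at the last column.\<close>

definition row_string :: "symbol list \<Rightarrow> symbol list \<Rightarrow> nat \<Rightarrow> int \<Rightarrow> int \<Rightarrow> symbol list" where
  "row_string v es n a x = concat (replicate n [4, 2, 5, 4, 2, 5]) @ [6] @
     concat (map (\<lambda>j. entry_string v es (a - int n + int j) (x - int n + 1 + int j)) [0..<n]) @ [6]"

lemma computes_row:
  assumes "set es \<subseteq> {1, 2}"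
  shows "computes emit_row (st (a, cells v) (int n - 1, ones n) C (0, cells es) (x, ones 1) (out w))
       (n * (10 * length es + 49) + 12)
     (st (a - int n - 1, cells v) (int n - 1, ones n) C (0, cells es) (x + 1, ones 1)
       (out (row_string v es n a x @ w)))"
proof -
  let ?E = "\<lambda>j. entry_string v es (a - int n + int j) (x - int n + 1 + int j)"
  let ?Es = "concat (map ?E [0..<n])" and ?z = "[4, 2, 5, 4, 2, 5] :: symbol list"
  have 1: "computes (While 1 nonblank emit_entry)
      (st (a - 1, cells v) (int n - 1, ones n) C (0, cells es) (x, ones 1) (out w))
      (n * (10 * length es + 30 + 2) + 1)
      (st (a - int n - 1, cells v) (- 1, ones n) C (0, cells es) (x - int n, ones 1) (out (?Es @ w)))" for w
  proof (rule computes_While'[where n = n and T = "10 * length es + 30" and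
        S = "\<lambda>i. st (a - 1 - int i, cells v) (int n - 1 - int i, ones n) C (0, cells es) (x - int i, ones 1)
          (out (concat (map ?E [n - i..<n]) @ w))"])
    fix i
    assume i: "i < n"
    then have "[n - Suc i..<n] = (n - Suc i) # [n - i..<n]"
      by (metis Suc_diff_Suc diff_less_Suc less_imp_Suc_add upt_conv_Cons zero_less_Suc diff_less gr_implies_not0 not_gr_zero)
    then have "concat (map ?E [n - Suc i..<n]) @ w =
        entry_string v es (a - 1 - int i) (x - int i) @ concat (map ?E [n - i..<n]) @ w"
      using i by (simp add: of_nat_diff algebra_simps)
    then show "computes emit_entry
       (st (a - 1 - int i, cells v) (int n - 1 - int i, ones n) C (0, cells es) (x - int i, ones 1)
          (out (concat (map ?E [n - i..<n]) @ w))) (10 * length es + 30)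
       (st (a - 1 - int (Suc i), cells v) (int n - 1 - int (Suc i), ones n) C (0, cells es) (x - int (Suc i), ones 1)
          (out (concat (map ?E [n - Suc i..<n]) @ w)))"
      by (intro computes_weaken[OF computes_entry[OF assms]]) (auto simp: algebra_simps)
  qed (auto simp: ones_def algebra_simps)
  have 2: "computes (While 1 nonblank (push_list ?z ;; right 1 ;; right 4))
      (st I (0, ones n) C S (y, ones 1) (out w)) (n * (15 + 2) + 1)
      (st I (int n, ones n) C S (y + int n, ones 1) (out (concat (replicate n ?z) @ w)))" for y I S w
  proof (rule computes_While'[where n = n and T = 15 and
        S = "\<lambda>i. st I (int i, ones n) C S (y + int i, ones 1) (out (concat (replicate i ?z) @ w))"])
    fix i
    show "computes (push_list ?z ;; right 1 ;; right 4)
       (st I (int i, ones n) C S (y + int i, ones 1) (out (concat (replicate i ?z) @ w))) 15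
       (st I (int (Suc i), ones n) C S (y + int (Suc i), ones 1) (out (concat (replicate (Suc i) ?z) @ w)))"
      apply (rule computes_weaken)
        apply (rule computes_Seq, rule computes_push_list, simp)
        apply (rule computes_Seq, rule computes_go)
        apply (rule computes_go)
       apply (simp_all add: algebra_simps)
      done
  qed (auto simp: ones_def)
  show ?thesis unfolding emit_row_def
    apply (rule computes_weaken)
      apply (rule computes_Seq, rule computes_push, simp)
      apply (rule computes_Seq, rule computes_go)
      apply (rule computes_Seq, rule computes_at[OF 1], simp)
      apply (rule computes_Seq, rule computes_push, simp)
      apply (rule computes_Seq, rule computes_go)
      apply (rule computes_Seq, rule computes_at[OF 2], simp)
      apply (rule computes_Seq, rule computes_go)
      apply (rule computes_go)
     apply (simp_all add: row_string_def algebra_simps)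
    done
qed

text \<open>The head of the mark tape is at n - 1 - u when row u is entered from the right; hence it
  is at j - u in column j and meets the mark at cell 0 exactly on the diagonal.\<close>

definition matrix_string :: "symbol list \<Rightarrow> nat \<Rightarrow> nat \<Rightarrow> symbol list" where
  "matrix_string v n s = concat (map (\<lambda>u. row_string v (encode_nat s) n
     (int (u * (n + 1) + n)) (int n - 1 - int u)) [0..<n])"

lemma computes_rows:
  assumes len: "length v = n * (n + 1)" and v: "0 \<notin> set v"
  shows "computes (While 0 nonblank emit_row)
      (st (int (length v) - 1, cells v) (int n - 1, ones n) C (0, cells (encode_nat s)) (0, ones 1) (out []))
      (n * (n * (10 * s + 49) + 14) + 1)
      (st (- 1, cells v) (int n - 1, ones n) C (0, cells (encode_nat s)) (int n, ones 1)
        (out (matrix_string v n s)))"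
proof -
  let ?R = "\<lambda>u. row_string v (encode_nat s) n (int (u * (n + 1) + n)) (int n - 1 - int u)"
  have R: "matrix_string v n s = concat (map ?R [0..<n])" by (simp add: matrix_string_def)
  show ?thesis unfolding R
  proof (rule computes_While'[where n = n and T = "n * (10 * s + 49) + 12" and
        S = "\<lambda>i. st (int (length v) - 1 - int (i * (n + 1)), cells v) (int n - 1, ones n) C
          (0, cells (encode_nat s)) (int i, ones 1) (out (concat (map ?R [n - i..<n])))"])
    fix i
    assume i: "i < n"
    then have up: "[n - Suc i..<n] = (n - Suc i) # [n - i..<n]"
      by (metis Suc_diff_Suc diff_less_Suc less_imp_Suc_add upt_conv_Cons zero_less_Suc diff_less gr_implies_not0 not_gr_zero)
    obtain u where u: "n = Suc (u + i)" using i less_imp_Suc_add by (metis add.commute)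
    have pos: "int (length v) - 1 - int (i * (n + 1)) = int (u * (n + 1) + n)"
      unfolding len u by (simp add: algebra_simps)
    have "u * (n + 1) + n < length v" unfolding len u by (simp add: algebra_simps)
    then show "nonblank (head_symbol (st (int (length v) - 1 - int (i * (n + 1)), cells v) (int n - 1, ones n) C
          (0, cells (encode_nat s)) (int i, ones 1) (out (concat (map ?R [n - i..<n]))) 0))"
      unfolding pos using v by (metis cells_nth head_symbol_Pair nth_mem st_simps(1))
    have "n - Suc i = u" "int n - 1 - int u = int i" using u by auto
    then have out: "concat (map ?R [n - Suc i..<n]) =
        row_string v (encode_nat s) n (int (u * (n + 1) + n)) (int i) @ concat (map ?R [n - i..<n])"
      unfolding up by simp
    have next_pos: "int (length v) - 1 - int (Suc i * (n + 1)) = int (u * (n + 1) + n) - int n - 1"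
      using pos by simp
    have "n * (10 * length (encode_nat s) + 49) \<le> n * (10 * s + 49)"
      using length_encode_nat_le[of s] by (intro mult_left_mono) auto
    then show "computes emit_row (st (int (length v) - 1 - int (i * (n + 1)), cells v) (int n - 1, ones n) C
          (0, cells (encode_nat s)) (int i, ones 1) (out (concat (map ?R [n - i..<n]))))
        (n * (10 * s + 49) + 12)
        (st (int (length v) - 1 - int (Suc i * (n + 1)), cells v) (int n - 1, ones n) C
          (0, cells (encode_nat s)) (int (Suc i), ones 1) (out (concat (map ?R [n - Suc i..<n]))))"
      unfolding pos next_pos out
      by (intro computes_weaken[OF computes_row[OF set_encode_nat]]) (simp_all add: add.commute)
  qed (auto simp: len cells_outside)
qed

lemma
  assumes v: "length v = n * (n + 1)" "0 \<notin> set v"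
    and first_row: "\<And>i. i < n \<Longrightarrow> v ! i \<noteq> 6" "n > 0 \<Longrightarrow> v ! n = 6"
  shows computes_reduction_small:
      "n < N \<Longrightarrow> computes (reduction N) (input_store v) (5 * n + N + 5)
        (st (int n, cells v) (int n - int N, ones n) (0, ones 0) (0, cells (encode_nat 0)) (0, ones 0) (out []))"
    and computes_reduction_large:
      "\<lbrakk>N \<ge> 1; N \<le> n; \<And>i. i < s \<Longrightarrow> i\<^sup>2 < n; n \<le> s\<^sup>2\<rbrakk> \<Longrightarrow> computes (reduction N) (input_store v)
        (18 * s\<^sup>2 + 19 * s + 10 * s * n\<^sup>2 + 52 * n\<^sup>2 + 25 * n + 4 * N + 17)
        (st (- 1, cells v) (int n - 1, ones n) (int s, ones s) (0, cells (encode_nat s)) (int n, ones 1)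
          (out (matrix_string v n s)))"
proof -
  have cv: "cells v (int i) \<noteq> 0 \<and> cells v (int i) \<noteq> 6" if "i < n" for i
  proof -
    have "i < length v" using that v(1) by (simp add: less_le_trans)
    then show ?thesis using first_row(1)[OF that] v(2) by (metis cells_nth nth_mem)
  qed
  have cn: "cells v (int n) = 0 \<or> cells v (int n) = 6"
  proof (cases "n = 0")
    case True
    then show ?thesis using v by (simp add: cells_outside)
  next
    case False
    then have "n < length v" using v(1) by (cases n) auto
    then show ?thesis using first_row(2) False by (simp add: cells_nth)
  qed
  have "computes count_vertices (input_store v) (5 * n + 1)
      (st (int n, cells v) (int n, ones n) (0, ones 0) (0, cells (encode_nat 0)) (0, ones 0) (out []))"
    unfolding input_store_st by (rule computes_count_vertices) (use cv cn in blast)+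
  note init = computes_Seq[OF this computes_Seq[OF computes_lefts[of N]]]
  show "computes (reduction N) (input_store v) (5 * n + N + 5)
        (st (int n, cells v) (int n - int N, ones n) (0, ones 0) (0, cells (encode_nat 0)) (0, ones 0) (out []))"
    if "n < N"
  proof -
    have "computes (If 1 nonblank (find_root ;; reset_heads ;; While 0 nonblank emit_row) skip)
       (st (int n, cells v) (int n - int N, ones n) (0, ones 0) (0, cells (encode_nat 0)) (0, ones 0) (out [])) (1 + 2)
       (st (int n, cells v) (int n - int N, ones n) (0, ones 0) (0, cells (encode_nat 0)) (0, ones 0) (out []))"
      using that by (intro computes_If computes_skip) (auto simp: ones_def)
    from init[OF this] show ?thesis unfolding reduction_def by (rule computes_mono) simp
  qed
  show "computes (reduction N) (input_store v)
        (18 * s\<^sup>2 + 19 * s + 10 * s * n\<^sup>2 + 52 * n\<^sup>2 + 25 * n + 4 * N + 17)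
        (st (- 1, cells v) (int n - 1, ones n) (int s, ones s) (0, cells (encode_nat s)) (int n, ones 1)
          (out (matrix_string v n s)))"
    if N: "N \<ge> 1" "N \<le> n" and s: "\<And>i. i < s \<Longrightarrow> i\<^sup>2 < n" "n \<le> s\<^sup>2"
  proof -
    have n: "n \<le> length v" "n \<ge> 1" using v(1) N by auto
    note main = computes_Seq[OF computes_root[OF s N(2)]
      computes_Seq[OF computes_reset_heads[OF n(2) s(2) n(1) v(2)] computes_rows[OF v]]]
    have "computes (If 1 nonblank (find_root ;; reset_heads ;; While 0 nonblank emit_row) skip)
       (st (int n, cells v) (int n - int N, ones n) (0, ones 0) (0, cells (encode_nat 0)) (0, ones 0) (out []))
       (3 * N + 3 + s * (15 * s + 19) + (3 * s\<^sup>2 + 3 * n + 3 * length v + 9 + (n * (n * (10 * s + 49) + 14) + 1)) + 2)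
       (st (- 1, cells v) (int n - 1, ones n) (int s, ones s) (0, cells (encode_nat s)) (int n, ones 1)
          (out (matrix_string v n s)))"
      using N by (intro computes_If main) (auto simp: ones_def)
    from init[OF this] show ?thesis unfolding reduction_def
      by (rule computes_mono) (simp add: v(1) algebra_simps power2_eq_square)
  qed
qed

section \<open>The matrix and its encoding\<close>

text \<open>
  The even columns carry the identity and the odd columns the \<open>\<plusminus>1\<close> adjacency matrix divided by \<open>s\<close>,
  both in the odd rows only; the even rows are zero and only make the matrix square.
\<close>

definition reduced_entry :: "nat set set \<Rightarrow> nat \<Rightarrow> nat \<times> nat \<Rightarrow> rat" where
  "reduced_entry E s = (\<lambda>(i, j). if even i then 0 else if even j then (if i = Suc j then 1 else 0)
     else (if {i div 2, j div 2} \<in> E then 1 else - 1) / of_nat s)"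

definition reduced_matrix :: "nat \<Rightarrow> nat set set \<Rightarrow> nat \<Rightarrow> rat mat" where
  "reduced_matrix n E s = mat (2 * n) (2 * n) (reduced_entry E s)"

lemma nth_concat_uniform:
  assumes "\<And>u. u < m \<Longrightarrow> length (f u) = l" "u < m" "j < l"
  shows "concat (map f [0..<m]) ! (u * l + j) = f u ! j"
  using assms
proof (induction m)
  case (Suc m)
  have len: "length (concat (map f [0..<m])) = m * l"
  proof -
    have "map (\<lambda>u. length (f u)) [0..<m] = map (\<lambda>_. l) [0..<m]" using Suc.prems(1) by auto
    then show ?thesis unfolding length_concat map_map o_def by (simp only: sum_list_triv length_upt diff_zero of_nat_id)
  qed
  show ?case
  proof (cases "u = m")
    case True
    then show ?thesis using len by (simp add: nth_append)
  next
    case False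
    then have "Suc u * l \<le> m * l" using Suc.prems(2) by (intro mult_right_mono) auto
    then have "u * l + j < m * l" using Suc.prems(3) by simp
    then show ?thesis using Suc False len by (simp add: nth_append)
  qed
qed simp

lemma concat_map_double:
  "concat (map f [0..<2 * n]) = concat (map (\<lambda>u. f (2 * u) @ f (Suc (2 * u))) [0..<n])"
  by (induction n) auto

lemma encode_graph_row:
  assumes "u < n"
  shows "j < n \<Longrightarrow> encode_graph n E ! (u * (n + 1) + j) = bit ({u, j} \<in> E)"
    and "encode_graph n E ! (u * (n + 1) + n) = 6"
  unfolding encode_graph_def using assms
  by (subst nth_concat_uniform[where l = "n + 1"]; simp add: nth_append)+

lemma length_encode_graph: "length (encode_graph n E) = n * (n + 1)"
  by (simp add: encode_graph_def length_concat o_def sum_list_triv)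

lemma zero_notin_encode_graph: "0 \<notin> set (encode_graph n E)"
  by (auto simp: encode_graph_def bit_def)

lemma encode_nat_1: "encode_nat (Suc 0) = [2]"
  by (simp add: encode_nat_rec encode_nat_0 bit_def)

lemma encode_rat_simps:
  "encode_rat 0 = [4, 2]" "encode_rat 1 = [2, 4, 2]"
  "s > 0 \<Longrightarrow> encode_rat (1 / of_nat s) = [2, 4] @ encode_nat s"
  "s > 0 \<Longrightarrow> encode_rat (- (1 / of_nat s)) = [3, 2, 4] @ encode_nat s"
proof -
  have "quotient_of (1 / of_nat s) = (1, int s)" "quotient_of (- 1 / of_nat s) = (- 1, int s)" if "s > 0"
    using that quotient_of_Fract[of 1 "int s"] quotient_of_Fract[of "- 1" "int s"]
    by (auto simp: Fract_of_int_quotient Rat.normalize_def)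
  then show "s > 0 \<Longrightarrow> encode_rat (1 / of_nat s) = [2, 4] @ encode_nat s"
    "s > 0 \<Longrightarrow> encode_rat (- (1 / of_nat s)) = [3, 2, 4] @ encode_nat s"
    by (simp_all add: encode_rat_def encode_nat_1 flip: minus_divide_left)
qed (simp_all add: encode_rat_def encode_nat_0 encode_nat_1)

text \<open>Rows 2u, 2u + 1 and columns 2j, 2j + 1 are adjacent in the encoding, so both strings are
  concatenations over the same pairs u, j. This is the reason for interleaving the blocks: a single
  backward pass over the graph produces the matrix.\<close>

lemma matrix_string_encode:
  assumes "s > 0"
  shows "matrix_string (encode_graph n E) n s = encode_matrix (reduced_matrix n E s)"
proof -
  let ?e = "\<lambda>i j. encode_rat (reduced_entry E s (i, j)) @ [5]"
  let ?emit_row = "\<lambda>i. concat (map (?e i) [0..<2 * n]) @ [6]"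
  have emit_entry: "entry_string (encode_graph n E) (encode_nat s) (int (u * (n + 1) + j)) (int j - int u) =
      ?e (Suc (2 * u)) (2 * j) @ ?e (Suc (2 * u)) (Suc (2 * j))" if "u < n" "j < n" for u j
  proof -
    have "u * (n + 1) + j < length (encode_graph n E)"
    proof -
      have "u * (n + 1) + j < Suc u * (n + 1)" using that by simp
      also have "\<dots> \<le> n * (n + 1)" using that by (intro mult_right_mono) auto
      finally show ?thesis by (simp add: length_encode_graph)
    qed
    then have "cells (encode_graph n E) (int (u * (n + 1) + j)) = bit ({u, j} \<in> E)"
      using that encode_graph_row(1)[of u n j E] by (simp only: cells_nth)
    then show ?thesis using assms
      by (auto simp: entry_string_def reduced_entry_def encode_rat_simps bit_def)
  qed
  have "row_string (encode_graph n E) (encode_nat s) n (int (u * (n + 1) + n)) (int n - 1 - int u) =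
      ?emit_row (2 * u) @ ?emit_row (Suc (2 * u))" if u: "u < n" for u
  proof -
    have "concat (map (\<lambda>j. ?e (2 * u) (2 * j) @ ?e (2 * u) (Suc (2 * j))) [0..<n]) =
        concat (replicate n [4, 2, 5, 4, 2, 5])"
      by (simp add: reduced_entry_def encode_rat_simps map_replicate_const)
    moreover have "concat (map (\<lambda>j. entry_string (encode_graph n E) (encode_nat s)
          (int (u * (n + 1) + n) - int n + int j) (int n - 1 - int u - int n + 1 + int j)) [0..<n]) =
        concat (map (\<lambda>j. ?e (Suc (2 * u)) (2 * j) @ ?e (Suc (2 * u)) (Suc (2 * j))) [0..<n])"
    proof (intro arg_cong[where f = concat] map_cong refl)
      fix j
      assume "j \<in> set [0..<n]"
      then have "j < n" by simp
      have "int (u * (n + 1) + n) - int n + int j = int (u * (n + 1) + j)"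
        "int n - 1 - int u - int n + 1 + int j = int j - int u" by simp_all
      then show "entry_string (encode_graph n E) (encode_nat s)
          (int (u * (n + 1) + n) - int n + int j) (int n - 1 - int u - int n + 1 + int j) =
          ?e (Suc (2 * u)) (2 * j) @ ?e (Suc (2 * u)) (Suc (2 * j))"
        using emit_entry[OF u \<open>j < n\<close>] by presburger
    qed
    ultimately show ?thesis unfolding row_string_def concat_map_double by simp
  qed
  then have "matrix_string (encode_graph n E) n s = concat (map ?emit_row [0..<2 * n])"
    unfolding matrix_string_def concat_map_double[of ?emit_row]
    by (intro arg_cong[where f = concat] map_cong) auto
  also have "\<dots> = encode_matrix (reduced_matrix n E s)"
    unfolding encode_matrix_def
    by (intro arg_cong[where f = concat] arg_cong2[where f = append] map_cong) (auto simp: reduced_matrix_def)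
  finally show ?thesis .
qed

section \<open>The machine deciding cliques\<close>

definition ceil_sqrt :: "nat \<Rightarrow> nat" where
  "ceil_sqrt n = (LEAST s. n \<le> s\<^sup>2)"

lemma ceil_sqrt: "n \<le> (ceil_sqrt n)\<^sup>2" "i < ceil_sqrt n \<Longrightarrow> i\<^sup>2 < n" "ceil_sqrt n \<le> n"
proof -
  have n: "n \<le> n\<^sup>2" by (simp add: power2_eq_square)
  show "n \<le> (ceil_sqrt n)\<^sup>2" unfolding ceil_sqrt_def by (rule LeastI[of "\<lambda>s. n \<le> s\<^sup>2", OF n])
  show "ceil_sqrt n \<le> n" unfolding ceil_sqrt_def by (rule Least_le[of "\<lambda>s. n \<le> s\<^sup>2", OF n])
  show "i < ceil_sqrt n \<Longrightarrow> i\<^sup>2 < n" unfolding ceil_sqrt_def by (drule not_less_Least) simp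
qed

lemma poly_nat_mono:
  fixes p :: "nat poly"
  shows "x \<le> y \<Longrightarrow> poly p x \<le> poly p y"
  by (induction p) (auto intro: add_left_mono mult_mono)

lemma set_encode_rat: "set (encode_rat r) \<subseteq> {1..4}"
proof -
  have "set (encode_nat m) \<subseteq> {1..4}" for m using set_encode_nat[of m] by auto
  then show ?thesis by (auto simp: encode_rat_def split: prod.split)
qed

lemma set_encode_matrix: "set (encode_matrix A) \<subseteq> {1..6}"
proof -
  have "set (encode_rat r) \<subseteq> {1..6}" for r using set_encode_rat[of r] by fastforce
  then show ?thesis by (auto simp: encode_matrix_def)
qed

lemma length_concat_map_le:
  assumes "\<And>x. x \<in> set xs \<Longrightarrow> length (f x) \<le> b"
  shows "length (concat (map f xs)) \<le> length xs * b"
  using assms by (induction xs) (auto intro: add_mono)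

lemma length_matrix_string:
  "length (matrix_string v n s) \<le> n * (n * (length (encode_nat s) + 14) + 2)"
proof -
  let ?es = "encode_nat s"
  have e: "length (entry_string v ?es a x) \<le> length ?es + 8" for a x by (simp add: entry_string_def)
  have "length (row_string v ?es n a x) \<le> n * (length ?es + 14) + 2" for a x
  proof -
    have "length (concat (map (\<lambda>j. entry_string v ?es (a - int n + int j) (x - int n + 1 + int j)) [0..<n]))
        \<le> length [0..<n] * (length ?es + 8)"
      by (rule length_concat_map_le) (rule e)
    moreover have "length (concat (replicate n ([4, 2, 5, 4, 2, 5] :: symbol list))) = n * 6"
      by (simp add: length_concat sum_list_replicate)
    ultimately show ?thesis unfolding row_string_def by (simp add: algebra_simps)
  qed
  then have "length (matrix_string v n s) \<le> length [0..<n] * (n * (length ?es + 14) + 2)"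
    unfolding matrix_string_def by (intro length_concat_map_le)
  then show ?thesis by simp
qed

text \<open>\<open>M\<close> is the supposed algorithm for matrices. \<open>N\<close> will be a size
  from which both its promise and the clique estimate hold; all facts up to the time bound are
  independent of that choice.\<close>

locale clique_to_rip =
  fixes M :: tm and N :: nat
  assumes M: "poly_time_algorithm matrix_instances M" and N: "N \<ge> 1"
begin

definition "machine = prefixed out_tape (reduction N) M"

definition "instance_matrix n E = reduced_matrix n E (ceil_sqrt n)"

lemma tm: "turing_machine M"
  using M by (simp add: poly_time_algorithm_def)

lemma tapes: "tapes M \<ge> 1"
  using tm by (simp add: turing_machine_def)

lemma wf: "com_wf (out_tape + tapes M) (reduction N)"
  using tapes by (intro com_wf_reduction) auto

lemma graph_string:
  "length (encode_graph n E) = n * (n + 1)" "0 \<notin> set (encode_graph n E)"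
  "i < n \<Longrightarrow> encode_graph n E ! i \<noteq> 6" "n > 0 \<Longrightarrow> encode_graph n E ! n = 6"
  using encode_graph_row(1)[of 0 n i E] encode_graph_row(2)[of 0 n E]
  by (auto simp: length_encode_graph zero_notin_encode_graph bit_def)

lemma small:
  assumes "n < N"
  shows "\<exists>m\<le>5 * n + N + 5 + 1. state_after machine (encode_graph n E) m = yes_state machine"
proof -
  note run = computes_reduction_small[where v = "encode_graph n E" and n = n, OF graph_string(1,2) graph_string(3,4) assms]
  have "head_symbol (out []) = 0" by (simp add: out_Nil input_tape_Nil)
  then show ?thesis unfolding machine_def by (intro prefixed_yes[OF tm wf run]) simp_all
qed

lemma large:
  assumes "n \<ge> N"
  shows "\<exists>m\<le>10 * n ^ 3 + 70 * n\<^sup>2 + 44 * n + 4 * N + 18. \<forall>l.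
    state_after machine (encode_graph n E) (l + m) =
    code_size (reduction N) + 1 + state_after M (encode_matrix (instance_matrix n E)) l"
proof -
  let ?s = "ceil_sqrt n" and ?w = "encode_matrix (instance_matrix n E)"
  have s: "?s > 0" using ceil_sqrt(1)[of n] assms N by (cases "?s") auto
  have w: "matrix_string (encode_graph n E) n ?s = ?w"
    unfolding instance_matrix_def by (rule matrix_string_encode[OF s])
  note run = computes_reduction_large[where v = "encode_graph n E" and n = n,
      OF graph_string(1,2) graph_string(3,4) N assms ceil_sqrt(2,1), unfolded w]
  have bound: "18 * ?s\<^sup>2 + 19 * ?s + 10 * ?s * n\<^sup>2 + 52 * n\<^sup>2 + 25 * n + 4 * N + 17 \<le>
     10 * n ^ 3 + 70 * n\<^sup>2 + 44 * n + 4 * N + 17"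
  proof -
    have "?s\<^sup>2 \<le> n\<^sup>2" "?s * n\<^sup>2 \<le> n * n\<^sup>2" "n * n\<^sup>2 = n ^ 3"
      using ceil_sqrt(3)[of n] power_mono[of "ceil_sqrt n" n 2] by (auto intro: mult_right_mono simp: power2_eq_square power3_eq_cube)
    then show ?thesis using ceil_sqrt(3)[of n] by (simp only: mult.assoc)
  qed
  have "?w \<noteq> []"
    using N assms unfolding w[symmetric] by (cases n) (auto simp: matrix_string_def row_string_def upt_conv_Cons simp del: upt_Suc)
  then have hd: "cells ?w 0 = ?w ! 0" "?w ! 0 \<in> set ?w" using cells_nth[of 0 ?w] by auto
  have *: "\<exists>m\<le>10 * n ^ 3 + 70 * n\<^sup>2 + 44 * n + 4 * N + 17 + 1. \<forall>l.
    state_after (prefixed out_tape (reduction N) M) (encode_graph n E) (l + m) =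
    code_size (reduction N) + 1 + state_after M ?w l"
  proof (rule prefixed_simulates[OF tm wf computes_mono[OF run bound]])
    have "head_symbol (out ?w) = ?w ! 0"
      using out_input_tape[of ?w 0] hd(1) by (simp add: head_symbol_def cells_def)
    then show "head_symbol (st (- 1, cells (encode_graph n E)) (int n - 1, ones n) (int ?s, ones ?s)
      (0, cells (encode_nat ?s)) (int n, ones 1) (out ?w) out_tape) \<noteq> 0"
      using hd(2) set_encode_matrix[of "instance_matrix n E"] by auto
    show "set ?w \<subseteq> alphabet M"
      using tm set_encode_matrix[of "instance_matrix n E"] unfolding turing_machine_def by fastforce
  qed (auto simp: out_input_tape st_def)
  have "10 * n ^ 3 + 70 * n\<^sup>2 + 44 * n + 4 * N + 17 + 1 = 10 * n ^ 3 + 70 * n\<^sup>2 + 44 * n + 4 * N + 18"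
    by simp
  from *[unfolded this] show ?thesis unfolding machine_def .
qed

lemma instance_matrix_carrier: "instance_matrix n E \<in> carrier_mat (2 * n) (2 * n)"
  by (simp add: instance_matrix_def reduced_matrix_def)

lemma machine_yes_small: "n < N \<Longrightarrow> outputs_yes machine (encode_graph n E)"
  using small unfolding outputs_yes_def by blast

lemma machine_large:
  assumes "n \<ge> N"
  shows "outputs_no M (encode_matrix (instance_matrix n E)) \<Longrightarrow> outputs_yes machine (encode_graph n E)"
    and "outputs_yes M (encode_matrix (instance_matrix n E)) \<Longrightarrow> outputs_no machine (encode_graph n E)"
proof -
  obtain m where m: "\<And>l. state_after machine (encode_graph n E) (l + m) =
    code_size (reduction N) + 1 + state_after M (encode_matrix (instance_matrix n E)) l"
    using large[OF assms] by blast
  show "outputs_no M (encode_matrix (instance_matrix n E)) \<Longrightarrow> outputs_yes machine (encode_graph n E)"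
    unfolding outputs_no_def outputs_yes_def using m by (metis machine_def prefixed_simps(5))
  show "outputs_yes M (encode_matrix (instance_matrix n E)) \<Longrightarrow> outputs_no machine (encode_graph n E)"
    unfolding outputs_no_def outputs_yes_def using m by (metis machine_def prefixed_simps(6))
qed

lemma poly_time: "poly_time_algorithm graph_instances machine"
proof -
  obtain p :: "nat poly" where p: "\<And>w. w \<in> matrix_instances \<Longrightarrow>
      \<exists>t\<le>poly p (length w). state_after M w t \<in> {yes_state M, no_state M}"
    using M by (auto simp: poly_time_algorithm_def)
  \<comment> \<open>This is n (n (n + 14) + 2), a bound for the length of the produced matrix in
    which the binary length of the root is estimated by n.\<close>
  define q :: "nat poly" where "q = [:0, 2, 14, 1:]"
  define P :: "nat poly" where "P = [:4 * N + 18, 44, 70, 10:] + pcompose p q"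
  have P: "poly P x = 10 * x ^ 3 + 70 * x\<^sup>2 + 44 * x + 4 * N + 18 + poly p (poly q x)" for x
    by (simp add: P_def poly_pcompose algebra_simps power2_eq_square power3_eq_cube)
  have "\<exists>t\<le>poly P (length w). state_after machine w t \<in> {yes_state machine, no_state machine}"
    if inst: "w \<in> graph_instances" for w
  proof -
    obtain n E where w: "w = encode_graph n E" using inst by (auto simp: graph_instances_def)
    have n: "n \<le> length w" by (simp add: w length_encode_graph)
    show ?thesis
    proof (cases "n < N")
      case True
      obtain m where "m \<le> 5 * n + N + 5 + 1" "state_after machine w m = yes_state machine"
        using small[OF True] w by blast
      moreover have "5 * n + N + 5 + 1 \<le> poly P (length w)" unfolding P using n by linarith
      ultimately show ?thesis by (metis insertI1 le_trans)
    next
      case False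
      let ?A = "encode_matrix (instance_matrix n E)"
      obtain m where m: "m \<le> 10 * n ^ 3 + 70 * n\<^sup>2 + 44 * n + 4 * N + 18"
        "\<And>l. state_after machine w (l + m) = code_size (reduction N) + 1 + state_after M ?A l"
        using large[of n E] False w by auto
      obtain t where t: "t \<le> poly p (length ?A)" "state_after M ?A t \<in> {yes_state M, no_state M}"
        using p[of ?A] instance_matrix_carrier[of n E] unfolding matrix_instances_def by blast
      have "state_after machine w (t + m) \<in> {yes_state machine, no_state machine}"
        using t(2) unfolding m(2) by (auto simp: machine_def prefixed_simps)
      moreover have "t + m \<le> poly P (length w)"
      proof -
        have s: "ceil_sqrt n > 0" using ceil_sqrt(1)[of n] False N by (cases "ceil_sqrt n") auto
        have "length ?A \<le> n * (n * (length (encode_nat (ceil_sqrt n)) + 14) + 2)"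
          using length_matrix_string[of "encode_graph n E" n "ceil_sqrt n"]
          unfolding matrix_string_encode[OF s] by (simp add: instance_matrix_def)
        also have "\<dots> \<le> n * (n * (n + 14) + 2)"
          using le_trans[OF length_encode_nat_le ceil_sqrt(3)[of n]]
          by (intro mult_left_mono add_right_mono) auto
        also have "\<dots> = poly q n" by (simp add: q_def algebra_simps)
        also have "\<dots> \<le> poly q (length w)" using n by (rule poly_nat_mono)
        finally have "poly p (length ?A) \<le> poly p (poly q (length w))" by (rule poly_nat_mono)
        moreover have "n ^ 3 \<le> length w ^ 3" "n\<^sup>2 \<le> (length w)\<^sup>2" using n by (auto intro: power_mono)
        ultimately show ?thesis unfolding P using t(1) m(1) n by linarith
      qed
      ultimately show ?thesis by blast
    qed
  qed
  moreover have "turing_machine machine"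
    unfolding machine_def by (rule turing_machine_prefixed[OF tm wf])
  ultimately show ?thesis unfolding poly_time_algorithm_def by blast
qed

end

section \<open>Random subsets\<close>

text \<open>A random sign is subgaussian with variance one: the auxiliary inequality of Hoeffding's
  lemma at probability 1/2 and argument 2x, exponentiated and multiplied by exp (- x).\<close>

lemma cosh_le_exp_half_square:
  fixes x :: real
  shows "(exp x + exp (- x)) / 2 \<le> exp (x\<^sup>2 / 2)"
proof -
  have pos: "(exp x + exp (- x)) / 2 \<le> exp (x\<^sup>2 / 2)" if "x \<ge> 0" for x :: real
  proof -
    have "- (2 * x) * (1 / 2) + ln (1 + 1 / 2 * (exp (2 * x) - 1)) \<le> (2 * x)\<^sup>2 / 8"
      using Hoeffdings_lemma_aux[of "2 * x" "1 / 2"] that by simp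
    then have "ln ((1 + exp (2 * x)) / 2) \<le> x + x\<^sup>2 / 2" by (simp add: field_simps power2_eq_square)
    moreover have "0 < (1 + exp (2 * x)) / 2" by (simp add: add_pos_pos)
    ultimately have "(1 + exp (2 * x)) / 2 \<le> exp (x + x\<^sup>2 / 2)"
      by (metis exp_le_cancel_iff exp_ln)
    then have "exp (- x) * ((1 + exp (2 * x)) / 2) \<le> exp (- x) * exp (x + x\<^sup>2 / 2)"
      by (intro mult_left_mono) auto
    also have "exp (- x) * exp (x + x\<^sup>2 / 2) = exp (x\<^sup>2 / 2)" by (simp flip: exp_add)
    also have "exp (- x) * ((1 + exp (2 * x)) / 2) = (exp x + exp (- x)) / 2"
      by (simp add: field_simps flip: exp_add)
    finally show ?thesis .
  qed
  show ?thesis using pos[of x] pos[of "- x"] by (cases "x \<ge> 0") (auto simp: add.commute)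
qed

text \<open>For x = - u < 0 the claim reads 1 <= exp u (1 - u + u^2), and the quadratic Taylor
  polynomial of exp u is already large enough.\<close>

lemma exp_le_quadratic:
  fixes x :: real
  assumes "\<bar>x\<bar> \<le> 1"
  shows "exp x \<le> 1 + x + x\<^sup>2"
proof (cases "x \<ge> 0")
  case True
  then show ?thesis using exp_bound[of x] assms by simp
next
  case False
  define u where "u = - x"
  have u: "0 < u" "x = - u" using False by (auto simp: u_def)
  have "1 \<le> (1 + u + u\<^sup>2 / 2) * (1 - u + u\<^sup>2)"
  proof -
    have "(1 + u + u\<^sup>2 / 2) * (1 - u + u\<^sup>2) = 1 + u\<^sup>2 / 2 + u ^ 3 / 2 + u ^ 4 / 2"
      by (simp add: field_simps power2_eq_square power3_eq_cube power4_eq_xxxx)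
    then show ?thesis using u by simp
  qed
  also have "\<dots> \<le> exp u * (1 - u + u\<^sup>2)"
  proof (rule mult_right_mono)
    show "1 + u + u\<^sup>2 / 2 \<le> exp u" using exp_lower_Taylor_quadratic[of u] u by simp
    have "u \<le> 1" using assms u by simp
    then show "0 \<le> 1 - u + u\<^sup>2" using zero_le_power2[of u] by linarith
  qed
  finally show ?thesis unfolding u(2) by (simp add: exp_minus field_simps)
qed

text \<open>Expectation over a uniform random subset of \<open>X\<close>, whose elements occur
  independently with probability 1/2. It is a finite sum; a measure enters only where the count of
  bad graphs becomes a probability.\<close>

definition mean :: "'a set \<Rightarrow> ('a set \<Rightarrow> real) \<Rightarrow> real" where
  "mean X f = (\<Sum>E\<in>Pow X. f E) / 2 ^ card X"

lemma mean_cong: "(\<And>E. E \<subseteq> X \<Longrightarrow> f E = g E) \<Longrightarrow> mean X f = mean X g"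
  unfolding mean_def by (auto intro!: sum.cong arg_cong2[where f = "(/)"])

lemma mean_mono: "(\<And>E. E \<subseteq> X \<Longrightarrow> f E \<le> g E) \<Longrightarrow> mean X f \<le> mean X g"
  unfolding mean_def by (intro divide_right_mono sum_mono) auto

lemma mean_nonneg: "(\<And>E. E \<subseteq> X \<Longrightarrow> 0 \<le> f E) \<Longrightarrow> 0 \<le> mean X f"
  unfolding mean_def by (intro divide_nonneg_nonneg sum_nonneg) auto

lemma mean_const: "finite X \<Longrightarrow> mean X (\<lambda>_. c) = c"
  by (simp add: mean_def card_Pow)

lemma mean_add: "mean X (\<lambda>E. f E + g E) = mean X f + mean X g"
  by (simp add: mean_def sum.distrib add_divide_distrib)

lemma mean_cmult: "mean X (\<lambda>E. c * f E) = c * mean X f"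
  by (simp add: mean_def sum_distrib_left)

lemma mean_empty: "mean {} f = f {}"
  by (simp add: mean_def)

text \<open>Independence of disjoint blocks: intersecting with \<open>X\<close> and with
  \<open>Y\<close> identifies \<open>Pow (X \<union> Y)\<close> with the product of the two power
  sets.\<close>

lemma mean_Un:
  assumes "finite X" "finite Y" "X \<inter> Y = {}"
  shows "mean (X \<union> Y) (\<lambda>E. f (E \<inter> X) * g (E \<inter> Y)) = mean X f * mean Y g"
proof -
  have "(\<Sum>E\<in>Pow (X \<union> Y). f (E \<inter> X) * g (E \<inter> Y)) = (\<Sum>(A, B)\<in>Pow X \<times> Pow Y. f A * g B)"
    by (rule sum.reindex_bij_witness[where i = "\<lambda>(A, B). A \<union> B" and j = "\<lambda>E. (E \<inter> X, E \<inter> Y)"])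
      (use assms in auto)
  then show ?thesis using assms
    by (simp add: mean_def sum_product sum.cartesian_product card_Un_disjoint power_add)
qed

lemma mean_superset:
  assumes "finite Y" "X \<subseteq> Y"
  shows "mean Y (\<lambda>E. f (E \<inter> X)) = mean X f"
proof -
  have "X \<union> (Y - X) = Y" "finite X" using assms finite_subset by auto
  then show ?thesis using mean_Un[of X "Y - X" f "\<lambda>_. 1"] assms by (simp add: mean_const)
qed

lemma mean_insert:
  assumes "finite X" "a \<notin> X"
  shows "mean (insert a X) f = (mean X (\<lambda>E. f (insert a E)) + mean X f) / 2"
proof -
  have "(\<Sum>E\<in>Pow (insert a X). f E) = (\<Sum>E\<in>Pow X. f E) + (\<Sum>E\<in>insert a ` Pow X. f E)"
    unfolding Pow_insert using assms by (intro sum.union_disjoint) auto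
  also have "(\<Sum>E\<in>insert a ` Pow X. f E) = (\<Sum>E\<in>Pow X. f (insert a E))"
    using assms(2) by (subst sum.reindex) (auto simp: inj_on_def)
  finally show ?thesis using assms by (simp add: mean_def field_simps)
qed

lemma mean_prod_disjoint:
  assumes "finite U" "\<And>u. u \<in> U \<Longrightarrow> finite (B u)" "\<And>u v. u \<in> U \<Longrightarrow> v \<in> U \<Longrightarrow> u \<noteq> v \<Longrightarrow> B u \<inter> B v = {}"
  shows "mean (\<Union>u\<in>U. B u) (\<lambda>E. \<Prod>u\<in>U. f u (E \<inter> B u)) = (\<Prod>u\<in>U. mean (B u) (f u))"
  using assms
proof (induction U rule: finite_induct)
  case (insert a U)
  let ?Y = "\<Union>u\<in>U. B u"
  have "mean (B a \<union> ?Y) (\<lambda>E. \<Prod>u\<in>insert a U. f u (E \<inter> B u)) =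
      mean (B a \<union> ?Y) (\<lambda>E. f a (E \<inter> B a) * (\<Prod>u\<in>U. f u ((E \<inter> ?Y) \<inter> B u)))"
  proof (rule mean_cong)
    fix E
    have "(\<Prod>u\<in>U. f u (E \<inter> B u)) = (\<Prod>u\<in>U. f u ((E \<inter> ?Y) \<inter> B u))"
      by (intro prod.cong refl arg_cong2[where f = f]) auto
    then show "(\<Prod>u\<in>insert a U. f u (E \<inter> B u)) = f a (E \<inter> B a) * (\<Prod>u\<in>U. f u ((E \<inter> ?Y) \<inter> B u))"
      using insert.hyps by simp
  qed
  also have "\<dots> = mean (B a) (f a) * mean ?Y (\<lambda>E. \<Prod>u\<in>U. f u (E \<inter> B u))"
  proof (rule mean_Un)
    show "B a \<inter> ?Y = {}" using insert.prems(2) insert.hyps(2) by blast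
  qed (use insert in auto)
  finally show ?case using insert by simp
qed (simp add: mean_empty)

lemma mean_image:
  assumes "inj_on h X"
  shows "mean (h ` X) f = mean X (\<lambda>E. f (h ` E))"
proof -
  have "(\<Sum>E\<in>Pow (h ` X). f E) = (\<Sum>E\<in>Pow X. f (h ` E))"
    unfolding image_Pow_surj[OF refl, symmetric] by (rule sum.reindex_cong[OF inj_on_image_Pow[OF assms]]) auto
  then show ?thesis using assms by (simp add: mean_def card_image)
qed

text \<open>Markov's inequality in the form of a count.\<close>

lemma card_le_mean:
  assumes X: "finite X" and f: "\<And>E. E \<subseteq> X \<Longrightarrow> 0 \<le> f E" "\<And>E. E \<subseteq> X \<Longrightarrow> P E \<Longrightarrow> 1 \<le> f E"
  shows "card {E. E \<subseteq> X \<and> P E} \<le> 2 ^ card X * mean X f"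
proof -
  have "real (card {E. E \<subseteq> X \<and> P E}) = (\<Sum>E\<in>{E. E \<subseteq> X \<and> P E}. 1)" by simp
  also have "\<dots> \<le> (\<Sum>E\<in>{E. E \<subseteq> X \<and> P E}. f E)" using f by (intro sum_mono) auto
  also have "\<dots> \<le> (\<Sum>E\<in>Pow X. f E)" using X f by (intro sum_mono2) auto
  finally show ?thesis by (simp add: mean_def)
qed

section \<open>Moments of sums of random signs\<close>

definition pm_one :: "bool \<Rightarrow> real" where
  "pm_one b = (if b then 1 else - 1)"

lemma pm_one_square [simp]: "(pm_one b)\<^sup>2 = 1"
  by (simp add: pm_one_def)

definition rademacher_sum :: "'a set \<Rightarrow> ('a \<Rightarrow> real) \<Rightarrow> 'a set \<Rightarrow> real" where
  "rademacher_sum S z T = (\<Sum>v\<in>S. pm_one (v \<in> T) * z v)"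

lemma rademacher_sum_insert:
  assumes "finite S" "a \<notin> S"
  shows "T \<subseteq> S \<Longrightarrow> rademacher_sum (insert a S) z T = rademacher_sum S z T - z a"
    and "rademacher_sum (insert a S) z (insert a T) = rademacher_sum S z T + z a"
proof -
  show "T \<subseteq> S \<Longrightarrow> rademacher_sum (insert a S) z T = rademacher_sum S z T - z a"
    using assms by (auto simp: rademacher_sum_def pm_one_def)
  have "(\<Sum>v\<in>S. pm_one (v \<in> insert a T) * z v) = (\<Sum>v\<in>S. pm_one (v \<in> T) * z v)"
    using assms by (intro sum.cong arg_cong2[where f = "(*)"] arg_cong[where f = pm_one]) auto
  then show "rademacher_sum (insert a S) z (insert a T) = rademacher_sum S z T + z a"
    using assms by (simp add: rademacher_sum_def pm_one_def)
qed

text \<open>Averaging over the sign of a new element with coefficient c cancels the odd powers. With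
  N the sum of the old squares, the fourth moment grows by at most 6 c^2 N + c^4, while 3 N^2 grows
  by 6 c^2 N + 3 c^4.\<close>

lemma rademacher_moments:
  assumes "finite S"
  shows "mean S (\<lambda>T. (rademacher_sum S z T)\<^sup>2) = (\<Sum>v\<in>S. (z v)\<^sup>2)"
    and "mean S (\<lambda>T. (rademacher_sum S z T) ^ 4) \<le> 3 * (\<Sum>v\<in>S. (z v)\<^sup>2)\<^sup>2"
proof -
  have "mean S (\<lambda>T. (rademacher_sum S z T)\<^sup>2) = (\<Sum>v\<in>S. (z v)\<^sup>2) \<and>
     mean S (\<lambda>T. (rademacher_sum S z T) ^ 4) \<le> 3 * (\<Sum>v\<in>S. (z v)\<^sup>2)\<^sup>2"
    using assms
  proof (induction S rule: finite_induct)
    case empty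
    then show ?case by (simp add: mean_empty rademacher_sum_def)
  next
    case (insert a S)
    let ?X = "rademacher_sum S z" and ?N = "\<Sum>v\<in>S. (z v)\<^sup>2"
    have step: "mean (insert a S) (\<lambda>T. \<phi> (rademacher_sum (insert a S) z T)) =
        mean S (\<lambda>T. (\<phi> (?X T + z a) + \<phi> (?X T - z a)) / 2)" for \<phi> :: "real \<Rightarrow> real"
    proof -
      have "mean S (\<lambda>T. \<phi> (rademacher_sum (insert a S) z T)) = mean S (\<lambda>T. \<phi> (?X T - z a))"
        by (rule mean_cong) (simp add: rademacher_sum_insert insert)
      then have "mean (insert a S) (\<lambda>T. \<phi> (rademacher_sum (insert a S) z T)) =
          (mean S (\<lambda>T. \<phi> (?X T + z a)) + mean S (\<lambda>T. \<phi> (?X T - z a))) / 2"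
        using insert by (simp add: mean_insert rademacher_sum_insert)
      also have "\<dots> = mean S (\<lambda>T. 1 / 2 * (\<phi> (?X T + z a) + \<phi> (?X T - z a)))"
        by (simp only: mean_add mean_cmult)
      finally show ?thesis by simp
    qed
    have 2: "mean (insert a S) (\<lambda>T. (rademacher_sum (insert a S) z T)\<^sup>2) = ?N + (z a)\<^sup>2"
    proof -
      have "((?X T + z a)\<^sup>2 + (?X T - z a)\<^sup>2) / 2 = (?X T)\<^sup>2 + (z a)\<^sup>2" for T
        by (simp add: power2_eq_square algebra_simps)
      then show ?thesis unfolding step[of "\<lambda>x. x\<^sup>2"]
        using insert by (simp only: mean_add mean_const)
    qed
    have "((?X T + z a) ^ 4 + (?X T - z a) ^ 4) / 2 = (?X T) ^ 4 + (6 * (z a)\<^sup>2 * (?X T)\<^sup>2 + (z a) ^ 4)" for T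
      by (simp add: power4_eq_xxxx power2_eq_square algebra_simps)
    then have "mean (insert a S) (\<lambda>T. (rademacher_sum (insert a S) z T) ^ 4) =
        mean S (\<lambda>T. (?X T) ^ 4) + (6 * (z a)\<^sup>2 * ?N + (z a) ^ 4)"
      unfolding step[of "\<lambda>x. x ^ 4"] using insert by (simp only: mean_add mean_const mean_cmult)
    also have "\<dots> \<le> 3 * ?N\<^sup>2 + (6 * (z a)\<^sup>2 * ?N + (z a) ^ 4)" using insert by simp
    also have "\<dots> = 3 * (?N + (z a)\<^sup>2)\<^sup>2 - 2 * ((z a)\<^sup>2)\<^sup>2"
      by (simp add: power2_eq_square power4_eq_xxxx algebra_simps)
    also have "\<dots> \<le> 3 * (?N + (z a)\<^sup>2)\<^sup>2" by simp
    finally show ?case using 2 insert by (simp add: add.commute)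
  qed
  then show "mean S (\<lambda>T. (rademacher_sum S z T)\<^sup>2) = (\<Sum>v\<in>S. (z v)\<^sup>2)"
    and "mean S (\<lambda>T. (rademacher_sum S z T) ^ 4) \<le> 3 * (\<Sum>v\<in>S. (z v)\<^sup>2)\<^sup>2" by auto
qed

lemma rademacher_sum_square_le:
  fixes z :: "'a \<Rightarrow> real"
  assumes "finite S"
  shows "(rademacher_sum S z T)\<^sup>2 \<le> card S * (\<Sum>v\<in>S. (z v)\<^sup>2)"
proof -
  have "(rademacher_sum S z T)\<^sup>2 \<le> (\<Sum>v\<in>S. (pm_one (v \<in> T))\<^sup>2) * (\<Sum>v\<in>S. (z v)\<^sup>2)"
    unfolding rademacher_sum_def by (rule Cauchy_Schwarz_ineq_sum)
  then show ?thesis by simp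
qed

text \<open>The scale \<open>1 / (K * N)\<close> keeps the exponent in [-1, 1], where
  \<open>exp_le_quadratic\<close> applies. The linear term has mean zero, and the fourth moment
  bounds the variance of the square by 2 N^2, which leaves 2 / K^2. Both signs \<open>\<mu>\<close>
  are needed for a two-sided tail.\<close>

lemma mean_exp_rademacher_square:
  fixes S :: "'a set" and z :: "'a \<Rightarrow> real" and K N \<mu> :: real
  assumes S: "finite S" "card S \<le> K" "1 \<le> K" and \<mu>: "\<bar>\<mu>\<bar> = 1" and N: "N = (\<Sum>v\<in>S. (z v)\<^sup>2)" "N > 0"
  shows "mean S (\<lambda>T. exp (\<mu> / (K * N) * ((rademacher_sum S z T)\<^sup>2 - N))) \<le> exp (2 / K\<^sup>2)"
proof -
  let ?W = "\<lambda>T. (rademacher_sum S z T)\<^sup>2 - N" and ?l = "\<mu> / (K * N)"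
  have KN: "K * N > 0" using S N by simp
  have W: "\<bar>?W T\<bar> \<le> K * N" for T
  proof -
    have "(rademacher_sum S z T)\<^sup>2 \<le> card S * N" using rademacher_sum_square_le[OF S(1)] N by simp
    also have "\<dots> \<le> K * N" using S N by (intro mult_right_mono) auto
    finally have "(rademacher_sum S z T)\<^sup>2 \<le> K * N" .
    moreover have "N \<le> K * N" using S(3) N(2) by simp
    ultimately show ?thesis using zero_le_power2[of "rademacher_sum S z T"] N(2) by linarith
  qed
  have "exp (?l * ?W T) \<le> 1 + (?l * ?W T + ?l\<^sup>2 * (?W T)\<^sup>2)" for T
  proof -
    have "\<bar>?l * ?W T\<bar> = \<bar>?W T\<bar> / (K * N)" using \<mu> S(3) N(2) by (simp add: abs_mult)
    also have "\<dots> \<le> 1" using W[of T] KN by (simp add: pos_divide_le_eq)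
    finally have "exp (?l * ?W T) \<le> 1 + ?l * ?W T + (?l * ?W T)\<^sup>2" by (rule exp_le_quadratic)
    then show ?thesis unfolding power_mult_distrib by linarith
  qed
  then have "mean S (\<lambda>T. exp (?l * ?W T)) \<le> mean S (\<lambda>T. 1 + (?l * ?W T + ?l\<^sup>2 * (?W T)\<^sup>2))"
    by (intro mean_mono)
  also have "\<dots> = 1 + (?l * mean S ?W + ?l\<^sup>2 * mean S (\<lambda>T. (?W T)\<^sup>2))"
    by (simp only: mean_add mean_cmult mean_const[OF S(1)])
  also have "mean S ?W = 0"
  proof -
    have "mean S ?W = mean S (\<lambda>T. (rademacher_sum S z T)\<^sup>2 + (- N))" by simp
    then show ?thesis by (simp only: mean_add mean_const[OF S(1)] rademacher_moments(1)[OF S(1)] N(1))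
  qed
  also have "mean S (\<lambda>T. (?W T)\<^sup>2) \<le> 2 * N\<^sup>2"
  proof -
    have "(?W T)\<^sup>2 = (rademacher_sum S z T) ^ 4 + (- 2 * N * (rademacher_sum S z T)\<^sup>2 + N\<^sup>2)" for T
      by (simp add: power2_eq_square power4_eq_xxxx algebra_simps)
    then have "mean S (\<lambda>T. (?W T)\<^sup>2) = mean S (\<lambda>T. (rademacher_sum S z T) ^ 4) + (- 2 * N * N + N\<^sup>2)"
      by (simp only: mean_add mean_cmult mean_const[OF S(1)] rademacher_moments(1)[OF S(1)] N(1)[symmetric])
    then show ?thesis using rademacher_moments(2)[OF S(1), of z] N(1) by (simp add: power2_eq_square)
  qed
  also have "1 + (?l * 0 + ?l\<^sup>2 * (2 * N\<^sup>2)) = 1 + 2 / K\<^sup>2"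
  proof -
    have "\<mu>\<^sup>2 = 1" using \<mu> by (metis one_power2 power2_abs)
    then show ?thesis using N by (simp add: power_divide power_mult_distrib)
  qed
  also have "\<dots> \<le> exp (2 / K\<^sup>2)" by (rule exp_ge_add_one_self)
  finally show ?thesis by (simp add: mult_left_mono)
qed

section \<open>Concentration for random graphs\<close>

definition edges :: "nat \<Rightarrow> nat set set" where
  "edges n = {e. e \<subseteq> {..<n} \<and> card e = 2}"

lemma graphs_Pow: "graphs n = Pow (edges n)"
  by (simp add: graphs_def edges_def)

lemma finite_edges: "finite (edges n)"
  by (rule finite_subset[of _ "Pow {..<n}"]) (auto simp: edges_def)

lemma insert_in_edges: "u < n \<Longrightarrow> v < n \<Longrightarrow> u \<noteq> v \<Longrightarrow> {u, v} \<in> edges n"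
  by (auto simp: edges_def)

definition adj :: "nat set set \<Rightarrow> nat \<Rightarrow> nat \<Rightarrow> real" where
  "adj E u v = pm_one ({u, v} \<in> E)"

text \<open>The diagonal of the encoded matrix looks like a non-edge, so it carries -1 rather than
  0. It is not random and is split off from the bilinear form in
  \<open>sum_row_product\<close>.\<close>

lemma adj_same: "E \<subseteq> edges n \<Longrightarrow> adj E u u = - 1"
  by (auto simp: adj_def pm_one_def edges_def)

lemma abs_adj [simp]: "\<bar>adj E u v\<bar> = 1"
  by (simp add: adj_def pm_one_def)

definition sq_norm :: "nat \<Rightarrow> (nat \<Rightarrow> real) \<Rightarrow> real" where
  "sq_norm n y = (\<Sum>u<n. (y u)\<^sup>2)"

lemma sq_norm_nonneg: "0 \<le> sq_norm n y"
  by (simp add: sq_norm_def sum_nonneg)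

definition cross :: "nat \<Rightarrow> nat set set \<Rightarrow> (nat \<Rightarrow> real) \<Rightarrow> (nat \<Rightarrow> real) \<Rightarrow> real" where
  "cross n E y z = (\<Sum>(u, v)\<in>{(u, v). u < n \<and> v < n \<and> u \<noteq> v}. y u * z v * adj E u v)"

text \<open>The coefficient y_u z_v + y_v z_u of the sign of the edge e = {u, v}. The matrix is
  symmetric, so the two orientations are not independent and have to be collected.\<close>

definition coupling :: "nat \<Rightarrow> (nat \<Rightarrow> real) \<Rightarrow> (nat \<Rightarrow> real) \<Rightarrow> nat set \<Rightarrow> real" where
  "coupling n y z e = (\<Sum>(u, v)\<in>{(u, v). u < n \<and> v < n \<and> u \<noteq> v \<and> {u, v} = e}. y u * z v)"

lemma finite_pairs: "finite {(u, v). u < n \<and> v < n \<and> u \<noteq> (v :: nat)}"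
  by (rule finite_subset[of _ "{..<n} \<times> {..<n}"]) auto

lemma cross_edges: "cross n E y z = (\<Sum>e\<in>edges n. pm_one (e \<in> E) * coupling n y z e)"
proof -
  let ?P = "{(u, v). u < n \<and> v < n \<and> u \<noteq> (v :: nat)}"
  have "(\<Sum>e\<in>edges n. \<Sum>p\<in>{p \<in> ?P. {fst p, snd p} = e}. y (fst p) * z (snd p) * adj E (fst p) (snd p)) =
      (\<Sum>p\<in>?P. y (fst p) * z (snd p) * adj E (fst p) (snd p))"
    by (rule sum.group[OF finite_pairs finite_edges]) (auto simp: insert_in_edges)
  also have "\<dots> = cross n E y z" by (simp add: cross_def case_prod_beta)
  finally have "cross n E y z = (\<Sum>e\<in>edges n. \<Sum>p\<in>{p \<in> ?P. {fst p, snd p} = e}. y (fst p) * z (snd p) * adj E (fst p) (snd p))"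
    by simp
  also have "\<dots> = (\<Sum>e\<in>edges n. pm_one (e \<in> E) * coupling n y z e)"
  proof (rule sum.cong[OF refl])
    fix e
    have P: "{(u, v). u < n \<and> v < n \<and> u \<noteq> v \<and> {u, v} = e} = {p \<in> ?P. {fst p, snd p} = e}" by auto
    have c: "coupling n y z e = (\<Sum>p\<in>{p \<in> ?P. {fst p, snd p} = e}. y (fst p) * z (snd p))"
      unfolding coupling_def P by (simp add: case_prod_beta)
    show "(\<Sum>p\<in>{p \<in> ?P. {fst p, snd p} = e}. y (fst p) * z (snd p) * adj E (fst p) (snd p)) =
        pm_one (e \<in> E) * coupling n y z e"
      unfolding c sum_distrib_left
    proof (rule sum.cong[OF refl])
      fix p
      assume "p \<in> {p \<in> ?P. {fst p, snd p} = e}"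
      then have "adj E (fst p) (snd p) = pm_one (e \<in> E)" by (simp add: adj_def)
      then show "y (fst p) * z (snd p) * adj E (fst p) (snd p) = pm_one (e \<in> E) * (y (fst p) * z (snd p))"
        by simp
    qed
  qed
  finally show ?thesis .
qed

text \<open>The factor 2 comes from (a + b)^2 <= 2 (a^2 + b^2), applied to the two orientations of
  an edge.\<close>

lemma sum_coupling_square:
  "(\<Sum>e\<in>edges n. (coupling n y z e)\<^sup>2) \<le> 2 * sq_norm n y * sq_norm n z"
proof -
  let ?P = "{(u, v). u < n \<and> v < n \<and> u \<noteq> (v :: nat)}"
  have "(coupling n y z e)\<^sup>2 \<le> 2 * (\<Sum>p\<in>{p \<in> ?P. {fst p, snd p} = e}. (y (fst p) * z (snd p))\<^sup>2)"
    if e: "e \<in> edges n" for e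
  proof -
    obtain i j where ij: "e = {i, j}" "i \<noteq> j" "i < n" "j < n"
      using e by (auto simp: edges_def card_2_iff)
    then have P: "{p \<in> ?P. {fst p, snd p} = e} = {(i, j), (j, i)}"
      "{(u, v). u < n \<and> v < n \<and> u \<noteq> v \<and> {u, v} = e} = {(i, j), (j, i)}"
      by (auto simp: doubleton_eq_iff)
    have "(y i * z j + y j * z i)\<^sup>2 \<le> 2 * ((y i * z j)\<^sup>2 + (y j * z i)\<^sup>2)"
      using zero_le_power2[of "y i * z j - y j * z i"] by (simp add: power2_eq_square algebra_simps)
    then show ?thesis using ij(2) unfolding coupling_def P by simp
  qed
  then have "(\<Sum>e\<in>edges n. (coupling n y z e)\<^sup>2) \<le>
      (\<Sum>e\<in>edges n. 2 * (\<Sum>p\<in>{p \<in> ?P. {fst p, snd p} = e}. (y (fst p) * z (snd p))\<^sup>2))"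
    by (rule sum_mono)
  also have "\<dots> = 2 * (\<Sum>p\<in>?P. (y (fst p) * z (snd p))\<^sup>2)"
    unfolding sum_distrib_left[symmetric]
    by (subst sum.group[OF finite_pairs finite_edges]) (auto simp: insert_in_edges)
  also have "(\<Sum>p\<in>?P. (y (fst p) * z (snd p))\<^sup>2) \<le> (\<Sum>p\<in>{..<n} \<times> {..<n}. (y (fst p) * z (snd p))\<^sup>2)"
    by (rule sum_mono2) auto
  also have "\<dots> = sq_norm n y * sq_norm n z"
    by (simp add: sq_norm_def sum_product sum.cartesian_product power_mult_distrib case_prod_beta)
  finally show ?thesis by simp
qed

text \<open>The edge signs are independent and each contributes cosh (l c) <= exp (l^2 c^2 / 2) with
  its coefficient c; the factor 2 of \<open>sum_coupling_square\<close> cancels the 1/2.\<close>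

lemma mean_exp_cross:
  "mean (edges n) (\<lambda>E. exp (l * cross n E y z)) \<le> exp (l\<^sup>2 * sq_norm n y * sq_norm n z)"
proof -
  let ?c = "coupling n y z"
  have "mean (edges n) (\<lambda>E. exp (l * cross n E y z)) =
      mean (\<Union>e\<in>edges n. {e}) (\<lambda>E. \<Prod>e\<in>edges n. exp (l * ?c e * pm_one (e \<in> E \<inter> {e})))"
    unfolding UN_singleton
    by (rule mean_cong)
      (auto simp: cross_edges exp_sum[OF finite_edges] sum_distrib_left algebra_simps intro!: prod.cong)
  also have "\<dots> = (\<Prod>e\<in>edges n. mean {e} (\<lambda>F. exp (l * ?c e * pm_one (e \<in> F))))"
    by (rule mean_prod_disjoint) (auto simp: finite_edges)
  also have "\<dots> \<le> (\<Prod>e\<in>edges n. exp ((l * ?c e)\<^sup>2 / 2))"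
  proof (rule prod_mono)
    fix e
    have "mean {e} (\<lambda>F. exp (l * ?c e * pm_one (e \<in> F))) = (exp (l * ?c e) + exp (- (l * ?c e))) / 2"
      by (simp add: mean_insert mean_empty pm_one_def)
    also have "\<dots> \<le> exp ((l * ?c e)\<^sup>2 / 2)" by (rule cosh_le_exp_half_square)
    finally show "0 \<le> mean {e} (\<lambda>F. exp (l * ?c e * pm_one (e \<in> F))) \<and>
        mean {e} (\<lambda>F. exp (l * ?c e * pm_one (e \<in> F))) \<le> exp ((l * ?c e)\<^sup>2 / 2)"
      by (auto intro: mean_nonneg)
  qed
  also have "\<dots> = exp (l\<^sup>2 / 2 * (\<Sum>e\<in>edges n. (?c e)\<^sup>2))"
    by (simp add: exp_sum[OF finite_edges, symmetric] sum_distrib_left power_mult_distrib)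
  also have "\<dots> \<le> exp (l\<^sup>2 * sq_norm n y * sq_norm n z)"
    using mult_left_mono[OF sum_coupling_square, of "l\<^sup>2 / 2" n y z] by simp
  finally show ?thesis .
qed

lemma card_cross_large:
  assumes \<tau>: "\<tau> \<ge> 0" and N: "sq_norm n y + sq_norm n z > 0"
  shows "card {E. E \<subseteq> edges n \<and> \<bar>cross n E y z\<bar> \<ge> \<tau> * (sq_norm n y + sq_norm n z)}
     \<le> 2 ^ card (edges n) * (2 * exp (- \<tau>\<^sup>2))"
proof -
  let ?N = "sq_norm n y + sq_norm n z"
  \<comment> \<open>The minimizer of l^2 N^2 / 4 - l \<tau> N with N the sum of both squared norms,
    where 4 |y|^2 |z|^2 <= N^2 has been used; the minimum is - \<tau>^2.\<close>
  define l where "l = 2 * \<tau> / ?N"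
  let ?f = "\<lambda>E. exp (- 2 * \<tau>\<^sup>2) * exp (l * cross n E y z) + exp (- 2 * \<tau>\<^sup>2) * exp (- l * cross n E y z)"
  have lN: "l * (\<tau> * ?N) = 2 * \<tau>\<^sup>2" using N by (simp add: l_def power2_eq_square)
  have l: "l \<ge> 0" using \<tau> N by (simp add: l_def)
  have "l\<^sup>2 * sq_norm n y * sq_norm n z \<le> \<tau>\<^sup>2"
  proof -
    have "4 * (sq_norm n y * sq_norm n z) \<le> ?N\<^sup>2"
      using zero_le_power2[of "sq_norm n y - sq_norm n z"] by (simp add: power2_eq_square algebra_simps)
    then have "l\<^sup>2 * (4 * (sq_norm n y * sq_norm n z)) \<le> l\<^sup>2 * ?N\<^sup>2" by (rule mult_left_mono) simp
    also have "l\<^sup>2 * ?N\<^sup>2 = 4 * \<tau>\<^sup>2" using N by (simp add: l_def power_divide power_mult_distrib)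
    finally show ?thesis by simp
  qed
  then have e: "mean (edges n) (\<lambda>E. exp (\<mu> * cross n E y z)) \<le> exp (\<tau>\<^sup>2)" if "\<mu> = l \<or> \<mu> = - l" for \<mu>
    using mean_exp_cross[of n \<mu> y z] that by (auto intro: order_trans)
  have "card {E. E \<subseteq> edges n \<and> \<bar>cross n E y z\<bar> \<ge> \<tau> * ?N} \<le> 2 ^ card (edges n) * mean (edges n) ?f"
  proof (rule card_le_mean[OF finite_edges])
    fix E
    assume "\<bar>cross n E y z\<bar> \<ge> \<tau> * ?N"
    then have "l * (\<tau> * ?N) \<le> l * \<bar>cross n E y z\<bar>" using l by (rule mult_left_mono)
    then have "- 2 * \<tau>\<^sup>2 + l * cross n E y z \<ge> 0 \<or> - 2 * \<tau>\<^sup>2 + - l * cross n E y z \<ge> 0"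
      unfolding lN by (cases "cross n E y z \<ge> 0") auto
    then have "1 \<le> exp (- 2 * \<tau>\<^sup>2 + l * cross n E y z) \<or> 1 \<le> exp (- 2 * \<tau>\<^sup>2 + - l * cross n E y z)"
      by simp
    then show "1 \<le> ?f E" unfolding exp_add by (auto intro: add_increasing add_increasing2)
  qed (auto intro: add_nonneg_nonneg)
  also have "mean (edges n) ?f \<le> exp (- 2 * \<tau>\<^sup>2) * exp (\<tau>\<^sup>2) + exp (- 2 * \<tau>\<^sup>2) * exp (\<tau>\<^sup>2)"
    unfolding mean_add mean_cmult using e[of l] e[of "- l"] by (intro add_mono mult_left_mono) auto
  also have "\<dots> = 2 * exp (- \<tau>\<^sup>2)" by (simp flip: exp_add)
  finally show ?thesis by simp
qed

definition row_product :: "nat \<Rightarrow> nat set set \<Rightarrow> (nat \<Rightarrow> real) \<Rightarrow> nat \<Rightarrow> real" where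
  "row_product n E z u = (\<Sum>v<n. adj E u v * z v)"

text \<open>
  The rows outside the support \<open>S\<close> see disjoint blocks of edges, hence are independent. The
  exponent \<open>1 / (K N)\<close> is the largest for which the summands stay in \<open>[- 1, 1]\<close>.
\<close>

lemma mean_exp_rows:
  fixes K \<mu> :: real
  assumes S: "S \<subseteq> {..<n}" "\<And>v. v < n \<Longrightarrow> v \<notin> S \<Longrightarrow> z v = 0" "card S \<le> K" "1 \<le> K"
    and \<mu>: "\<bar>\<mu>\<bar> = 1" and N: "sq_norm n z > 0"
  shows "mean (edges n) (\<lambda>E. exp (\<mu> / (K * sq_norm n z) *
      (\<Sum>u\<in>{..<n} - S. (row_product n E z u)\<^sup>2 - sq_norm n z))) \<le> exp (n * (2 / K\<^sup>2))"
proof -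
  let ?N = "sq_norm n z" and ?U = "{..<n} - S" and ?B = "\<lambda>u. (\<lambda>v. {u, v}) ` S"
  let ?l = "\<mu> / (K * ?N)"
  let ?g = "\<lambda>u F. exp (?l * ((\<Sum>v\<in>S. pm_one ({u, v} \<in> F) * z v)\<^sup>2 - ?N))"
  have fS: "finite S" using S(1) finite_subset by blast
  have NS: "?N = (\<Sum>v\<in>S. (z v)\<^sup>2)"
    unfolding sq_norm_def using S by (intro sum.mono_neutral_right) auto
  have row: "row_product n E z u = (\<Sum>v\<in>S. adj E u v * z v)" for E u
    unfolding row_product_def using S by (intro sum.mono_neutral_right) auto
  have sub: "(\<Union>u\<in>?U. ?B u) \<subseteq> edges n" using S(1) by (auto intro!: insert_in_edges)
  have "mean (edges n) (\<lambda>E. exp (?l * (\<Sum>u\<in>?U. (row_product n E z u)\<^sup>2 - ?N))) =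
      mean (edges n) (\<lambda>E. \<Prod>u\<in>?U. ?g u (E \<inter> (\<Union>u\<in>?U. ?B u) \<inter> ?B u))"
  proof (rule mean_cong)
    fix E
    have "(\<Sum>v\<in>S. pm_one ({u, v} \<in> E \<inter> (\<Union>u\<in>?U. ?B u) \<inter> ?B u) * z v) = row_product n E z u" if "u \<in> ?U" for u
      unfolding row using that
      by (intro sum.cong refl arg_cong2[where f = "(*)"]) (auto simp: adj_def intro!: arg_cong[where f = pm_one])
    then show "exp (?l * (\<Sum>u\<in>?U. (row_product n E z u)\<^sup>2 - ?N)) =
        (\<Prod>u\<in>?U. ?g u (E \<inter> (\<Union>u\<in>?U. ?B u) \<inter> ?B u))"
      by (simp add: exp_sum sum_distrib_left)
  qed
  also have "\<dots> = mean (\<Union>u\<in>?U. ?B u) (\<lambda>E. \<Prod>u\<in>?U. ?g u (E \<inter> ?B u))"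
    by (rule mean_superset[OF finite_edges sub])
  also have "\<dots> = (\<Prod>u\<in>?U. mean (?B u) (?g u))"
    \<comment> \<open>The blocks are disjoint: if {u, v} = {u', v'} with u and u' distinct, then u =
      v' lies in \<open>S\<close>, which is excluded.\<close>
    using fS by (intro mean_prod_disjoint) (auto simp: doubleton_eq_iff)
  also have "\<dots> \<le> (\<Prod>u\<in>?U. exp (2 / K\<^sup>2))"
  proof (rule prod_mono)
    fix u
    assume "u \<in> ?U"
    have inj: "inj_on (\<lambda>v. {u, v}) S" by (auto simp: inj_on_def doubleton_eq_iff)
    have mem: "{u, v} \<in> (\<lambda>v. {u, v}) ` T \<longleftrightarrow> v \<in> T" for v T by (auto simp: doubleton_eq_iff)
    have "mean (?B u) (?g u) = mean S (\<lambda>T. exp (?l * ((rademacher_sum S z T)\<^sup>2 - ?N)))"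
      unfolding mean_image[OF inj] mem rademacher_sum_def ..
    also have "\<dots> \<le> exp (2 / K\<^sup>2)" by (rule mean_exp_rademacher_square[OF fS S(3,4) \<mu> NS N])
    finally show "0 \<le> mean (?B u) (?g u) \<and> mean (?B u) (?g u) \<le> exp (2 / K\<^sup>2)"
      by (auto intro: mean_nonneg)
  qed
  also have "\<dots> = exp (card ?U * (2 / K\<^sup>2))" by (simp only: prod_constant exp_of_nat_mult)
  also have "\<dots> \<le> exp (n * (2 / K\<^sup>2))"
    using card_mono[of "{..<n}" ?U] unfolding exp_le_cancel_iff by (intro mult_right_mono) auto
  finally show ?thesis .
qed

text \<open>Markov's inequality for the exponents \<open>1 / (K * N)\<close> and
  \<open>- 1 / (K * N)\<close>: the threshold turns into - t / K, and the at most n rows add 2 n /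
  K^2.\<close>

lemma card_rows_large:
  fixes K t :: real
  assumes S: "S \<subseteq> {..<n}" "\<And>v. v < n \<Longrightarrow> v \<notin> S \<Longrightarrow> z v = 0" "card S \<le> K" "1 \<le> K"
    and N: "sq_norm n z > 0"
  shows "card {E. E \<subseteq> edges n \<and> \<bar>\<Sum>u\<in>{..<n} - S. (row_product n E z u)\<^sup>2 - sq_norm n z\<bar> \<ge> t * sq_norm n z}
     \<le> 2 ^ card (edges n) * (2 * exp (- t / K + 2 * real n / K\<^sup>2))"
proof -
  let ?N = "sq_norm n z"
  let ?W = "\<lambda>E. \<Sum>u\<in>{..<n} - S. (row_product n E z u)\<^sup>2 - ?N"
  let ?f = "\<lambda>E. exp (- t / K) * exp (1 / (K * ?N) * ?W E) + exp (- t / K) * exp (- 1 / (K * ?N) * ?W E)"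
  have KN: "K * ?N > 0" "K > 0" using S N by auto
  have "card {E. E \<subseteq> edges n \<and> \<bar>?W E\<bar> \<ge> t * ?N} \<le> 2 ^ card (edges n) * mean (edges n) ?f"
  proof (rule card_le_mean[OF finite_edges])
    fix E
    assume "\<bar>?W E\<bar> \<ge> t * ?N"
    then have "t * ?N / (K * ?N) \<le> \<bar>?W E\<bar> / (K * ?N)" using KN by (intro divide_right_mono) auto
    then have "t / K \<le> \<bar>?W E\<bar> / (K * ?N)" using N by simp
    then have "- t / K + 1 / (K * ?N) * ?W E \<ge> 0 \<or> - t / K + - 1 / (K * ?N) * ?W E \<ge> 0"
      by (cases "?W E \<ge> 0") auto
    then have "1 \<le> exp (- t / K + 1 / (K * ?N) * ?W E) \<or> 1 \<le> exp (- t / K + - 1 / (K * ?N) * ?W E)"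
      by (simp only: one_le_exp_iff)
    then show "1 \<le> ?f E" unfolding exp_add by (auto intro: add_increasing add_increasing2)
  qed (auto intro: add_nonneg_nonneg)
  also have "mean (edges n) ?f \<le> exp (- t / K) * exp (n * (2 / K\<^sup>2)) + exp (- t / K) * exp (n * (2 / K\<^sup>2))"
    unfolding mean_add mean_cmult
    using mean_exp_rows[OF S _ N, of 1] mean_exp_rows[OF S _ N, of "- 1"]
    by (intro add_mono mult_left_mono) auto
  also have "\<dots> = 2 * exp (- t / K + 2 * real n / K\<^sup>2)" by (simp add: mult.commute flip: exp_add)
  finally show ?thesis by simp
qed

section \<open>Distortion of sparse vectors\<close>

text \<open>The difference |\<Phi>x|^2 - |x|^2, where \<open>y\<close> holds the coordinates of x at
  the identity columns and \<open>z\<close> those at the columns of A / s.\<close>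

definition distortion :: "nat \<Rightarrow> real \<Rightarrow> nat set set \<Rightarrow> (nat \<Rightarrow> real) \<Rightarrow> (nat \<Rightarrow> real) \<Rightarrow> real" where
  "distortion n s E y z = (\<Sum>u<n. (y u + row_product n E z u / s)\<^sup>2) - (sq_norm n y + sq_norm n z)"

lemma distortion_expand:
  "distortion n s E y z = 2 / s * (\<Sum>u<n. y u * row_product n E z u) +
     (\<Sum>u<n. (row_product n E z u)\<^sup>2) / s\<^sup>2 - sq_norm n z"
proof -
  have "(y u + row_product n E z u / s)\<^sup>2 =
      (y u)\<^sup>2 + (2 / s * (y u * row_product n E z u) + (row_product n E z u)\<^sup>2 / s\<^sup>2)" for u
    by (simp add: power2_sum power_divide)
  then show ?thesis
    by (simp only: distortion_def sum.distrib sum_divide_distrib sum_distrib_left sq_norm_def)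
qed

lemma sum_row_product:
  assumes "E \<subseteq> edges n"
  shows "(\<Sum>u<n. y u * row_product n E z u) = cross n E y z - (\<Sum>u<n. y u * z u)"
proof -
  let ?f = "\<lambda>(u, v). y u * z v * adj E u v"
  let ?P = "{(u, v). u < n \<and> v < n \<and> u \<noteq> v}" and ?D = "(\<lambda>u. (u, u)) ` {..<n}"
  have "(\<Sum>u<n. y u * row_product n E z u) = (\<Sum>p\<in>{..<n} \<times> {..<n}. ?f p)"
    by (simp add: row_product_def sum_distrib_left sum.cartesian_product[symmetric] algebra_simps)
  also have "{..<n} \<times> {..<n} = ?P \<union> ?D" by auto
  also have "(\<Sum>p\<in>?P \<union> ?D. ?f p) = (\<Sum>p\<in>?P. ?f p) + (\<Sum>p\<in>?D. ?f p)"
    by (rule sum.union_disjoint[OF finite_pairs]) auto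
  also have "(\<Sum>p\<in>?D. ?f p) = - (\<Sum>u<n. y u * z u)"
    using assms by (subst sum.reindex) (auto simp: inj_on_def adj_same sum_negf)
  finally show ?thesis by (simp add: cross_def)
qed

lemma abs_sum_mult_le: "\<bar>\<Sum>u<n. y u * z u\<bar> \<le> (sq_norm n y + sq_norm n z) / 2"
proof -
  have "\<bar>y u * z u\<bar> \<le> ((y u)\<^sup>2 + (z u)\<^sup>2) / 2" for u
    using sum_squares_bound[of "\<bar>y u\<bar>" "\<bar>z u\<bar>"] by (simp add: abs_mult)
  then have "\<bar>\<Sum>u<n. y u * z u\<bar> \<le> (\<Sum>u<n. ((y u)\<^sup>2 + (z u)\<^sup>2) / 2)"
    by (intro order_trans[OF sum_abs] sum_mono)
  then show ?thesis by (simp add: sq_norm_def sum.distrib flip: sum_divide_distrib)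
qed

lemma row_product_square_le:
  assumes "S \<subseteq> {..<n}" "\<And>v. v < n \<Longrightarrow> v \<notin> S \<Longrightarrow> z v = 0"
  shows "(row_product n E z u)\<^sup>2 \<le> card S * sq_norm n z"
proof -
  have fS: "finite S" using assms(1) finite_subset by blast
  have "row_product n E z u = (\<Sum>v\<in>S. adj E u v * z v)"
    unfolding row_product_def using assms by (intro sum.mono_neutral_right) auto
  also have "\<dots>\<^sup>2 \<le> (\<Sum>v\<in>S. (adj E u v)\<^sup>2) * (\<Sum>v\<in>S. (z v)\<^sup>2)" by (rule Cauchy_Schwarz_ineq_sum)
  also have "(\<Sum>v\<in>S. (adj E u v)\<^sup>2) = card S" by (simp add: adj_def)
  also have "(\<Sum>v\<in>S. (z v)\<^sup>2) = sq_norm n z"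
    unfolding sq_norm_def using assms by (intro sum.mono_neutral_left) auto
  finally show ?thesis .
qed

text \<open>The error budget, free of probability. The bilinear term gives 2 \<tau> / s and its
  diagonal 1 / s. Over s^2 there are K^2 for at most K rows in the support, each at most K |z|^2; K
  for the multiples of |z|^2 that these rows should have supplied; t for the random rows; and 2 sqrt
  n + 1 for replacing n by s^2.\<close>

lemma distortion_bound:
  fixes K t \<tau> s :: real
  assumes E: "E \<subseteq> edges n"
    and S: "S \<subseteq> {..<n}" "\<And>v. v < n \<Longrightarrow> v \<notin> S \<Longrightarrow> z v = 0" "card S \<le> K"
    and s: "s > 0" "n \<le> s\<^sup>2" "s\<^sup>2 \<le> n + 2 * sqrt n + 1" and t: "t \<ge> 0"
    and cr: "\<bar>cross n E y z\<bar> \<le> \<tau> * (sq_norm n y + sq_norm n z)"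
    and rows: "\<bar>\<Sum>u\<in>{..<n} - S. (row_product n E z u)\<^sup>2 - sq_norm n z\<bar> \<le> t * sq_norm n z"
  shows "\<bar>distortion n s E y z\<bar> \<le>
    ((2 * \<tau> + 1) / s + (K\<^sup>2 + K + t + 2 * sqrt n + 1) / s\<^sup>2) * (sq_norm n y + sq_norm n z)"
proof -
  let ?Ny = "sq_norm n y" and ?Nz = "sq_norm n z" and ?r = "\<lambda>u. (row_product n E z u)\<^sup>2"
  have fS: "finite S" using S(1) finite_subset by blast
  have K: "K \<ge> 0" using S(3) of_nat_0_le_iff[of "card S"] by linarith
  have Nz: "?Nz \<ge> 0" and Ny: "?Ny \<ge> 0" by (rule sq_norm_nonneg)+
  have 1: "\<bar>\<Sum>u<n. y u * row_product n E z u\<bar> \<le> (\<tau> + 1 / 2) * (?Ny + ?Nz)"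
  proof -
    have "(\<tau> + 1 / 2) * (?Ny + ?Nz) = \<tau> * (?Ny + ?Nz) + (?Ny + ?Nz) / 2" by (simp add: algebra_simps add_divide_distrib)
    then show ?thesis unfolding sum_row_product[OF E] using cr abs_sum_mult_le[of y z n]
        abs_triangle_ineq4[of "cross n E y z" "\<Sum>u<n. y u * z u"] by linarith
  qed
  have "(\<Sum>u\<in>S. ?r u) \<le> (\<Sum>u\<in>S. K * ?Nz)"
    using mult_right_mono[OF S(3) Nz] by (intro sum_mono order_trans[OF row_product_square_le[OF S(1,2)]]) auto
  also have "\<dots> = card S * (K * ?Nz)" by simp
  also have "\<dots> \<le> K * (K * ?Nz)" using S(3) K Nz by (intro mult_right_mono) auto
  finally have inS: "(\<Sum>u\<in>S. ?r u) \<le> K\<^sup>2 * ?Nz" by (simp add: power2_eq_square)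
  have inS0: "0 \<le> (\<Sum>u\<in>S. ?r u)" by (simp add: sum_nonneg)
  have cS: "card S * ?Nz \<le> K * ?Nz" by (rule mult_right_mono[OF S(3) Nz])
  have cle: "card S \<le> n" using card_mono[OF _ S(1)] by simp
  have "(\<Sum>u<n. ?r u) = (\<Sum>u\<in>S. ?r u) + (\<Sum>u\<in>{..<n} - S. ?r u)"
    using sum.subset_diff[OF S(1), of ?r] by simp
  also have "(\<Sum>u\<in>{..<n} - S. ?r u) = (\<Sum>u\<in>{..<n} - S. ?r u - ?Nz) + (n - card S) * ?Nz"
    using fS S(1) cle by (simp add: sum_subtractf card_Diff_subset of_nat_diff)
  finally have 2: "\<bar>(\<Sum>u<n. ?r u) - n * ?Nz\<bar> \<le> (K\<^sup>2 + K + t) * ?Nz"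
    using inS inS0 cS rows cle of_nat_0_le_iff[of "card S"] mult_nonneg_nonneg[OF of_nat_0_le_iff[of "card S"] Nz]
    by (simp add: of_nat_diff distrib_right left_diff_distrib abs_le_iff)
  have 3: "\<bar>n * ?Nz - s\<^sup>2 * ?Nz\<bar> \<le> (2 * sqrt n + 1) * ?Nz"
  proof -
    have "\<bar>n * ?Nz - s\<^sup>2 * ?Nz\<bar> = (s\<^sup>2 - n) * ?Nz"
      using s(2) mult_right_mono[OF s(2) Nz] by (simp add: left_diff_distrib)
    also have "\<dots> \<le> (2 * sqrt n + 1) * ?Nz" using s(3) Nz by (intro mult_right_mono) auto
    finally show ?thesis .
  qed
  have "(\<Sum>u<n. ?r u) / s\<^sup>2 - ?Nz = ((\<Sum>u<n. ?r u) - s\<^sup>2 * ?Nz) / s\<^sup>2"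
    using s(1) by (simp add: field_simps)
  then have "\<bar>(\<Sum>u<n. ?r u) / s\<^sup>2 - ?Nz\<bar> = \<bar>(\<Sum>u<n. ?r u) - s\<^sup>2 * ?Nz\<bar> / s\<^sup>2"
    by simp
  also have "\<dots> \<le> ((K\<^sup>2 + K + t + 2 * sqrt n + 1) * ?Nz) / s\<^sup>2"
    using 2 3 by (intro divide_right_mono) (auto simp: distrib_right)
  also have "\<dots> \<le> ((K\<^sup>2 + K + t + 2 * sqrt n + 1) * (?Ny + ?Nz)) / s\<^sup>2"
    using Ny K t by (intro divide_right_mono mult_left_mono) auto
  finally have 4: "\<bar>(\<Sum>u<n. ?r u) / s\<^sup>2 - ?Nz\<bar> \<le> (K\<^sup>2 + K + t + 2 * sqrt n + 1) / s\<^sup>2 * (?Ny + ?Nz)"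
    by simp
  have 5: "\<bar>2 / s * (\<Sum>u<n. y u * row_product n E z u)\<bar> \<le> (2 * \<tau> + 1) / s * (?Ny + ?Nz)"
    using mult_left_mono[OF 1, of "2 / s"] s(1) by (simp add: abs_mult field_simps)
  have "\<bar>distortion n s E y z\<bar> \<le> \<bar>2 / s * (\<Sum>u<n. y u * row_product n E z u)\<bar> + \<bar>(\<Sum>u<n. ?r u) / s\<^sup>2 - ?Nz\<bar>"
    unfolding distortion_expand by linarith
  also have "\<dots> \<le> (2 * \<tau> + 1) / s * (?Ny + ?Nz) + (K\<^sup>2 + K + t + 2 * sqrt n + 1) / s\<^sup>2 * (?Ny + ?Nz)"
    using 5 4 by (rule add_mono)
  finally show ?thesis by (simp only: distrib_right)
qed

lemma card_distortion_large:
  fixes K t \<tau> s :: real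
  assumes K: "card {v. v < n \<and> z v \<noteq> 0} \<le> K" "1 \<le> K" and "\<tau> \<ge> 0" "t \<ge> 0"
    and s: "s > 0" "n \<le> s\<^sup>2" "s\<^sup>2 \<le> n + 2 * sqrt n + 1"
    and N: "sq_norm n y + sq_norm n z > 0"
  shows "card {E. E \<subseteq> edges n \<and> \<bar>distortion n s E y z\<bar> >
      ((2 * \<tau> + 1) / s + (K\<^sup>2 + K + t + 2 * sqrt n + 1) / s\<^sup>2) * (sq_norm n y + sq_norm n z)}
    \<le> 2 ^ card (edges n) * (2 * exp (- \<tau>\<^sup>2) + 2 * exp (- t / K + 2 * real n / K\<^sup>2))"
proof -
  let ?\<eta> = "(2 * \<tau> + 1) / s + (K\<^sup>2 + K + t + 2 * sqrt n + 1) / s\<^sup>2"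
  let ?S = "{v. v < n \<and> z v \<noteq> 0}" and ?N = "sq_norm n y + sq_norm n z"
  let ?A = "{E. E \<subseteq> edges n \<and> \<bar>distortion n s E y z\<bar> > ?\<eta> * ?N}"
  let ?B = "{E. E \<subseteq> edges n \<and> \<bar>cross n E y z\<bar> \<ge> \<tau> * ?N}"
  \<comment> \<open>The strict inequality makes this event empty for z = 0, a case that
    \<open>card_rows_large\<close> excludes.\<close>
  let ?C = "{E. E \<subseteq> edges n \<and> \<bar>\<Sum>u\<in>{..<n} - ?S. (row_product n E z u)\<^sup>2 - sq_norm n z\<bar> > t * sq_norm n z}"
  have S: "?S \<subseteq> {..<n}" "\<And>v. v < n \<Longrightarrow> v \<notin> ?S \<Longrightarrow> z v = 0" by auto
  have fin: "finite {E. E \<subseteq> edges n \<and> P E}" for P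
    using finite_edges by (auto intro: finite_subset[of _ "Pow (edges n)"])
  have "?A \<subseteq> ?B \<union> ?C"
  proof
    fix E
    assume E: "E \<in> ?A"
    show "E \<in> ?B \<union> ?C"
    proof (rule ccontr)
      assume "E \<notin> ?B \<union> ?C"
      then have "\<bar>distortion n s E y z\<bar> \<le> ?\<eta> * ?N"
        using E by (intro distortion_bound[OF _ S K(1) s \<open>t \<ge> 0\<close>]) auto
      then show False using E by auto
    qed
  qed
  then have "card ?A \<le> card (?B \<union> ?C)" using fin by (intro card_mono) auto
  also have "\<dots> \<le> card ?B + card ?C" by (rule card_Un_le)
  finally have "real (card ?A) \<le> real (card ?B) + real (card ?C)" by linarith
  also have "\<dots> \<le> 2 ^ card (edges n) * (2 * exp (- \<tau>\<^sup>2)) + 2 ^ card (edges n) * (2 * exp (- t / K + 2 * real n / K\<^sup>2))"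
  proof (rule add_mono)
    show "real (card ?B) \<le> 2 ^ card (edges n) * (2 * exp (- \<tau>\<^sup>2))"
      by (rule card_cross_large[OF \<open>\<tau> \<ge> 0\<close> N])
    show "real (card ?C) \<le> 2 ^ card (edges n) * (2 * exp (- t / K + 2 * real n / K\<^sup>2))"
    proof (cases "sq_norm n z = 0")
      case True
      then have "z v = 0" if "v < n" for v
        using that by (auto simp: sq_norm_def sum_nonneg_eq_0_iff)
      then have "row_product n E z u = 0" for E u by (simp add: row_product_def)
      then have C: "?C = {}" using True by simp
      show ?thesis unfolding C by simp
    next
      case False
      then have "sq_norm n z > 0" using sq_norm_nonneg[of n z] by linarith
      have le: "card {E. E \<subseteq> edges n \<and> \<bar>\<Sum>u\<in>{..<n} - ?S. (row_product n E z u)\<^sup>2 - sq_norm n z\<bar> \<ge> t * sq_norm n z}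
          \<le> 2 ^ card (edges n) * (2 * exp (- t / K + 2 * real n / K\<^sup>2))"
        by (rule card_rows_large[OF S(1) _ K \<open>sq_norm n z > 0\<close>]) auto
      have "card ?C \<le> card {E. E \<subseteq> edges n \<and> \<bar>\<Sum>u\<in>{..<n} - ?S. (row_product n E z u)\<^sup>2 - sq_norm n z\<bar> \<ge> t * sq_norm n z}"
        using fin by (intro card_mono) auto
      then show ?thesis using le by linarith
    qed
  qed
  finally show ?thesis by (simp add: distrib_left)
qed

section \<open>The matrix in interleaved coordinates and the lower bound from a clique\<close>

definition evens :: "(nat \<Rightarrow> 'a) \<Rightarrow> nat \<Rightarrow> 'a" where
  "evens x u = x (2 * u)"

definition odds :: "(nat \<Rightarrow> 'a) \<Rightarrow> nat \<Rightarrow> 'a" where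
  "odds x u = x (Suc (2 * u))"

abbreviation "distortion2 n s E x \<equiv> distortion n s E (evens x) (odds x)"

lemma sum_evens_odds: "(\<Sum>i<2 * n. f i) = (\<Sum>u<n. f (2 * u) + f (Suc (2 * u)))"
  for f :: "nat \<Rightarrow> 'a :: comm_monoid_add"
  by (induction n) (auto simp: add.assoc)

lemma sq_norm_evens_odds: "sq_norm n (evens x) + sq_norm n (odds x) = sq_norm (2 * n) x"
  by (simp add: sq_norm_def sum_evens_odds sum.distrib evens_def odds_def)

lemma reduced_matrix_mult:
  assumes s: "s > 0" and x: "x \<in> carrier_vec (2 * n)"
  shows "(norm2 (map_mat real_of_rat (reduced_matrix n E s) *\<^sub>v x))\<^sup>2 =
    (\<Sum>u<n. (evens (vec_index x) u + row_product n E (odds (vec_index x)) u / s)\<^sup>2)"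
proof -
  let ?A = "map_mat real_of_rat (reduced_matrix n E s)"
  have dim: "dim_row ?A = 2 * n" "dim_col ?A = 2 * n" by (auto simp: reduced_matrix_def)
  have ix: "vec_index (?A *\<^sub>v x) i = (\<Sum>j<2 * n. real_of_rat (reduced_entry E s (i, j)) * vec_index x j)"
    if "i < 2 * n" for i
    using that x by (auto simp: reduced_matrix_def scalar_prod_def atLeast0LessThan intro!: sum.cong)
  have even: "vec_index (?A *\<^sub>v x) (2 * u) = 0" if "u < n" for u
    using that by (subst ix) (auto simp: reduced_entry_def)
  have odd: "vec_index (?A *\<^sub>v x) (Suc (2 * u)) =
      evens (vec_index x) u + row_product n E (odds (vec_index x)) u / s" if u: "u < n" for u
  proof -
    have e: "real_of_rat (reduced_entry E s (Suc (2 * u), 2 * v)) = (if u = v then 1 else 0)"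
      "real_of_rat (reduced_entry E s (Suc (2 * u), Suc (2 * v))) = adj E u v / s" for v
      by (auto simp: reduced_entry_def adj_def pm_one_def of_rat_divide)
    have "vec_index (?A *\<^sub>v x) (Suc (2 * u)) =
        (\<Sum>v<n. (if u = v then vec_index x (2 * v) else 0) + adj E u v / s * vec_index x (Suc (2 * v)))"
      using u by (subst ix) (auto simp: sum_evens_odds e intro!: sum.cong)
    then show ?thesis using u
      by (simp add: sum.distrib evens_def odds_def row_product_def sum_divide_distrib)
  qed
  have "(norm2 (?A *\<^sub>v x))\<^sup>2 = (\<Sum>i<2 * n. (vec_index (?A *\<^sub>v x) i)\<^sup>2)"
    unfolding norm2_squared dim_mult_mat_vec dim ..
  also have "\<dots> = (\<Sum>u<n. (evens (vec_index x) u + row_product n E (odds (vec_index x)) u / s)\<^sup>2)"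
    unfolding sum_evens_odds by (rule sum.cong) (auto simp: even odd)
  finally show ?thesis .
qed

text \<open>Both inequalities of the RIP together are one bound on the absolute distortion. Vectors
  turn into functions, of which only the values below 2n are looked at.\<close>

lemma RIP_reduced_matrix:
  assumes s: "s > 0"
  shows "RIP k \<delta> (map_mat real_of_rat (reduced_matrix n E s)) \<longleftrightarrow>
    (\<forall>x. card {i. i < 2 * n \<and> x i \<noteq> 0} \<le> k \<longrightarrow> \<bar>distortion2 n s E x\<bar> \<le> \<delta> * sq_norm (2 * n) x)"
proof -
  let ?A = "map_mat real_of_rat (reduced_matrix n E s)"
  have dim: "dim_col ?A = 2 * n" by (auto simp: reduced_matrix_def)
  have rip: "((1 - \<delta>) * (norm2 x)\<^sup>2 \<le> (norm2 (?A *\<^sub>v x))\<^sup>2 \<and> (norm2 (?A *\<^sub>v x))\<^sup>2 \<le> (1 + \<delta>) * (norm2 x)\<^sup>2)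
      \<longleftrightarrow> \<bar>distortion2 n s E (vec_index x)\<bar> \<le> \<delta> * sq_norm (2 * n) (vec_index x)"
    if x: "x \<in> carrier_vec (2 * n)" for x
  proof -
    have "(norm2 x)\<^sup>2 = sq_norm (2 * n) (vec_index x)" using x by (simp add: norm2_squared sq_norm_def)
    then show ?thesis unfolding distortion_def sq_norm_evens_odds reduced_matrix_mult[OF s x] abs_le_iff
      by (auto simp: algebra_simps)
  qed
  show ?thesis
  proof
    assume R: "RIP k \<delta> ?A"
    show "\<forall>x. card {i. i < 2 * n \<and> x i \<noteq> 0} \<le> k \<longrightarrow> \<bar>distortion2 n s E x\<bar> \<le> \<delta> * sq_norm (2 * n) x"
    proof (intro allI impI)
      fix x :: "nat \<Rightarrow> real"
      assume c: "card {i. i < 2 * n \<and> x i \<noteq> 0} \<le> k"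
      let ?v = "vec (2 * n) x"
      have "sparse k ?v" using c by (simp add: sparse_def cong: conj_cong)
      then have "\<bar>distortion2 n s E (vec_index ?v)\<bar> \<le> \<delta> * sq_norm (2 * n) (vec_index ?v)"
        using R rip[of ?v] dim by (auto simp: RIP_def)
      moreover have "sq_norm (2 * n) (vec_index ?v) = sq_norm (2 * n) x" by (simp add: sq_norm_def)
      moreover have "distortion2 n s E (vec_index ?v) = distortion2 n s E x"
        by (simp add: distortion_def sq_norm_def evens_def odds_def row_product_def)
      ultimately show "\<bar>distortion2 n s E x\<bar> \<le> \<delta> * sq_norm (2 * n) x" by simp
    qed
  next
    assume R: "\<forall>x. card {i. i < 2 * n \<and> x i \<noteq> 0} \<le> k \<longrightarrow> \<bar>distortion2 n s E x\<bar> \<le> \<delta> * sq_norm (2 * n) x"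
    show "RIP k \<delta> ?A"
      unfolding RIP_def dim using R by (auto simp: rip sparse_def)
  qed
qed

text \<open>
  The test vectors are the indicators of two disjoint halves of the clique with the two choices of
  their relative sign. The bilinear term changes sign, the quadratic term, over which there is no
  control in an arbitrary graph with a clique, cancels in the difference.
\<close>

lemma clique_distortion:
  assumes clique: "has_clique n E k" and h: "2 * h \<le> k" "h \<ge> 1" and s: "s > 0"
    and rip: "\<And>x. card {i. i < 2 * n \<and> x i \<noteq> 0} \<le> k' \<Longrightarrow> \<bar>distortion2 n s E x\<bar> \<le> \<delta> * sq_norm (2 * n) x"
    and k': "k \<le> k'"
  shows "h / s \<le> \<delta>"
proof -
  obtain K where K: "K \<subseteq> {..<n}" "card K = k" "\<And>u v. u \<in> K \<Longrightarrow> v \<in> K \<Longrightarrow> u \<noteq> v \<Longrightarrow> {u, v} \<in> E"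
    using clique by (auto simp: has_clique_def)
  have fK: "finite K" using K(1) finite_subset by blast
  obtain K1 where K1: "K1 \<subseteq> K" "card K1 = h" using obtain_subset_with_card_n[of h K] h K by auto
  have "h \<le> card (K - K1)" using K1 K h fK by (simp add: card_Diff_subset finite_subset)
  then obtain K2 where K2: "K2 \<subseteq> K - K1" "card K2 = h" by (meson obtain_subset_with_card_n)
  have fin: "finite K1" "finite K2" using K1 K2 fK by (auto intro: finite_subset)
  \<comment> \<open>One half sits on identity columns, the other on adjacency columns. As they are
    disjoint, the diagonal entries -1 stay out of the bilinear term and every entry that occurs in
    it is 1.\<close>
  define x where "x \<mu> i = (if even i then if i div 2 \<in> K1 then 1 else 0 else if i div 2 \<in> K2 then \<mu> else 0)"
    for \<mu> :: real and i :: nat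
  have ev: "evens (x \<mu>) = (\<lambda>u. if u \<in> K1 then 1 else 0)" for \<mu> by (auto simp: x_def evens_def)
  have od: "odds (x \<mu>) = (\<lambda>u. if u \<in> K2 then \<mu> else 0)" for \<mu> by (auto simp: x_def odds_def)
  have sub: "{..<n} \<inter> K1 = K1" "{..<n} \<inter> K2 = K2" using K K1 K2 by auto
  have row: "row_product n E (odds (x \<mu>)) u = \<mu> * (\<Sum>v\<in>K2. adj E u v)" for \<mu> u
  proof -
    have "row_product n E (odds (x \<mu>)) u = (\<Sum>v<n. if v \<in> K2 then adj E u v * \<mu> else 0)"
      unfolding row_product_def od by (intro sum.cong) auto
    also have "\<dots> = (\<Sum>v\<in>K2. adj E u v * \<mu>)" by (subst sum.inter_restrict[symmetric]) (auto simp: sub)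
    finally show ?thesis by (simp add: sum_distrib_left mult.commute)
  qed
  have cross: "(\<Sum>u<n. evens (x \<mu>) u * row_product n E (odds (x \<mu>)) u) = \<mu> * (h * h)" for \<mu>
  proof -
    have "(\<Sum>u<n. evens (x \<mu>) u * row_product n E (odds (x \<mu>)) u) =
        (\<Sum>u<n. if u \<in> K1 then \<mu> * (\<Sum>v\<in>K2. adj E u v) else 0)"
      unfolding row ev by (intro sum.cong) auto
    also have "\<dots> = (\<Sum>u\<in>K1. \<mu> * (\<Sum>v\<in>K2. adj E u v))" by (subst sum.inter_restrict[symmetric]) (auto simp: sub)
    also have "\<dots> = (\<Sum>u\<in>K1. \<mu> * (\<Sum>v\<in>K2. 1))"
    proof (intro sum.cong refl arg_cong2[where f = "(*)"])
      fix u v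
      assume "u \<in> K1" "v \<in> K2"
      then have "{u, v} \<in> E" using K(3)[of u v] K1 K2 by blast
      then show "adj E u v = 1" by (simp add: adj_def pm_one_def)
    qed
    finally show ?thesis using K1 K2 by simp
  qed
  have odd_norm: "sq_norm n (odds (x \<mu>)) = h" if "\<mu>\<^sup>2 = 1" for \<mu>
  proof -
    have "sq_norm n (odds (x \<mu>)) = (\<Sum>u<n. if u \<in> K2 then 1 else 0)"
      unfolding sq_norm_def od using that by (intro sum.cong) auto
    also have "\<dots> = h" by (subst sum.inter_restrict[symmetric]) (auto simp: sub K2)
    finally show ?thesis .
  qed
  have norm: "sq_norm (2 * n) (x \<mu>) = 2 * h" if "\<mu>\<^sup>2 = 1" for \<mu>
  proof -
    have "sq_norm n (evens (x \<mu>)) = (\<Sum>u<n. if u \<in> K1 then 1 else 0)"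
      unfolding sq_norm_def ev by (intro sum.cong) auto
    also have "\<dots> = h" by (subst sum.inter_restrict[symmetric]) (auto simp: sub K1)
    finally show ?thesis using odd_norm[OF that] by (simp flip: sq_norm_evens_odds)
  qed
  have supp: "card {i. i < 2 * n \<and> x \<mu> i \<noteq> 0} \<le> k'" for \<mu>
  proof -
    have "{i. i < 2 * n \<and> x \<mu> i \<noteq> 0} \<subseteq> (\<lambda>u. 2 * u) ` K1 \<union> (\<lambda>u. Suc (2 * u)) ` K2"
    proof
      fix i
      assume "i \<in> {i. i < 2 * n \<and> x \<mu> i \<noteq> 0}"
      then show "i \<in> (\<lambda>u. 2 * u) ` K1 \<union> (\<lambda>u. Suc (2 * u)) ` K2"
        by (cases "even i") (auto simp: x_def elim!: evenE oddE split: if_splits)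
    qed
    then have "card {i. i < 2 * n \<and> x \<mu> i \<noteq> 0} \<le> card ((\<lambda>u. 2 * u) ` K1 \<union> (\<lambda>u. Suc (2 * u)) ` K2)"
      using fin by (intro card_mono) auto
    also have "\<dots> \<le> card ((\<lambda>u. 2 * u) ` K1) + card ((\<lambda>u. Suc (2 * u)) ` K2)" by (rule card_Un_le)
    also have "\<dots> \<le> card K1 + card K2" using fin by (intro add_mono card_image_le)
    finally show ?thesis using K1 K2 h k' by simp
  qed
  have D: "distortion2 n s E (x 1) - distortion2 n s E (x (- 1)) = 4 * (real h * real h) / s"
    unfolding distortion_expand cross by (simp add: row odd_norm power_mult_distrib)
  have "\<bar>distortion2 n s E (x 1)\<bar> \<le> \<delta> * (2 * h)" "\<bar>distortion2 n s E (x (- 1))\<bar> \<le> \<delta> * (2 * h)"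
    using rip[OF supp, of 1] rip[OF supp, of "- 1"] norm[of 1] norm[of "- 1"] by auto
  moreover have "\<delta> * (2 * h) = 2 * (real h * \<delta>)" by simp
  ultimately have "4 * (real h * real h) / s \<le> 4 * (real h * \<delta>)" using D by linarith
  then have "(4 * real h) * (h / s) \<le> (4 * real h) * \<delta>" by (simp add: mult.assoc)
  then show ?thesis using h by (subst (asm) mult_le_cancel_left_pos) auto
qed

section \<open>Rounding sparse vectors to an integer grid\<close>

definition grid :: "nat \<Rightarrow> nat \<Rightarrow> nat \<Rightarrow> (nat \<Rightarrow> int) set" where
  "grid m k R = {g. {i. g i \<noteq> 0} \<subseteq> {..<m} \<and> card {i. g i \<noteq> 0} \<le> k \<and> (\<forall>i. \<bar>g i\<bar> \<le> int R)}"

text \<open>A grid point is recovered from a list of k pairs of an index and its value by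
  \<open>map_of\<close>, and there are m (2 R + 1) such pairs.\<close>

lemma grid_finite_card:
  assumes "m > 0"
  shows "finite (grid m k R)" "card (grid m k R) \<le> (m * (2 * R + 1)) ^ k"
proof -
  let ?P = "{..<m} \<times> {- int R..int R}"
  let ?L = "{xs. set xs \<subseteq> ?P \<and> length xs = k}"
  let ?\<phi> = "\<lambda>xs i. case map_of xs i of None \<Rightarrow> (0 :: int) | Some v \<Rightarrow> v"
  have sub: "grid m k R \<subseteq> ?\<phi> ` ?L"
  proof
    fix g
    assume g: "g \<in> grid m k R"
    then have fin: "finite {i. g i \<noteq> 0}" by (auto simp: grid_def intro: finite_subset)
    obtain ys where ys: "set ys = {i. g i \<noteq> 0}" "distinct ys" using finite_distinct_list[OF fin] by blast
    then have len: "length ys \<le> k" using g by (metis (no_types, lifting) distinct_card grid_def mem_Collect_eq)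
    \<comment> \<open>Shorter supports are padded with index 0, a valid index since m > 0. It is
      paired with its true value \<open>g 0\<close>, so the recovered function is unchanged.\<close>
    define js where "js = ys @ replicate (k - length ys) 0"
    have js: "set js \<subseteq> {..<m}" "{i. g i \<noteq> 0} \<subseteq> set js" "length js = k"
      using ys len g assms by (auto simp: js_def grid_def)
    let ?xs = "map (\<lambda>i. (i, g i)) js"
    have "g i \<in> {- int R..int R}" for i
    proof -
      have "\<bar>g i\<bar> \<le> int R" using g by (simp add: grid_def)
      then show ?thesis by simp linarith
    qed
    then have "?xs \<in> ?L" using js(1,3) by auto
    moreover have "g = ?\<phi> ?xs"
    proof
      fix i
      have "map_of ?xs i = (if i \<in> set js then Some (g i) else None)"
        by (simp add: map_of_map_restrict restrict_map_def)
      then show "g i = ?\<phi> ?xs i" using js(2) by (cases "i \<in> set js") auto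
    qed
    ultimately show "g \<in> ?\<phi> ` ?L" by blast
  qed
  have fP: "finite ?P" by simp
  have fL: "finite ?L" by (rule finite_lists_length_eq[OF fP])
  show "finite (grid m k R)" by (rule finite_surj[OF fL sub])
  have "card (grid m k R) \<le> card ?L" by (rule surj_card_le[OF fL sub])
  also have "card ?L = card ?P ^ k" by (rule card_lists_length_eq[OF fP])
  also have "card ?P = m * (2 * R + 1)" by (simp add: card_cartesian_product nat_add_distrib nat_mult_distrib)
  finally show "card (grid m k R) \<le> (m * (2 * R + 1)) ^ k" .
qed

lemma abs_diff_square_le:
  fixes a b c e :: real
  assumes "\<bar>a\<bar> \<le> c" "\<bar>b\<bar> \<le> c" "\<bar>a - b\<bar> \<le> e"
  shows "\<bar>a\<^sup>2 - b\<^sup>2\<bar> \<le> 2 * c * e"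
proof -
  have "\<bar>a\<^sup>2 - b\<^sup>2\<bar> = \<bar>a + b\<bar> * \<bar>a - b\<bar>"
    by (simp add: power2_eq_square algebra_simps flip: abs_mult)
  also have "\<dots> \<le> (2 * c) * e" using assms by (intro mult_mono) auto
  finally show ?thesis .
qed

text \<open>A crude constant of order n^3 suffices because the grid width may be any polynomial and
  enters the count only through its logarithm.\<close>

lemma distortion_lipschitz:
  fixes a b :: "nat \<Rightarrow> real"
  assumes s: "s \<ge> 1" and ab: "\<And>i. \<bar>a i\<bar> \<le> 1" "\<And>i. \<bar>b i\<bar> \<le> 1" "\<And>i. \<bar>a i - b i\<bar> \<le> e"
  shows "\<bar>distortion2 n s E a - distortion2 n s E b\<bar> \<le> (2 * real n * (1 + real n)\<^sup>2 + 4 * real n) * e"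
proof -
  have e: "e \<ge> 0" using ab(3)[of 0] by linarith
  let ?L = "\<lambda>a u. evens a u + row_product n E (odds a) u / s"
  have row: "\<bar>row_product n E (odds x) u / s\<bar> \<le> n * c" if "\<And>i. \<bar>x i\<bar> \<le> c" for x u and c :: real
  proof -
    have "\<bar>row_product n E (odds x) u\<bar> \<le> (\<Sum>v<n. c)"
      unfolding row_product_def using that
      by (intro order_trans[OF sum_abs] sum_mono) (auto simp: abs_mult odds_def)
    then have "\<bar>row_product n E (odds x) u\<bar> / s \<le> n * c / 1"
      using s by (intro frac_le) auto
    then show ?thesis using s by simp
  qed
  have L: "\<bar>?L x u\<bar> \<le> (1 + n) * c" if x: "\<And>i. \<bar>x i\<bar> \<le> c" for x u and c :: real
    using row[of x, OF x, of u] x[of "2 * u"] unfolding evens_def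
    by (intro order_trans[OF abs_triangle_ineq]) (simp add: distrib_right)
  have "?L a u - ?L b u = ?L (\<lambda>i. a i - b i) u" for u
    by (simp add: evens_def odds_def row_product_def sum_subtractf right_diff_distrib diff_divide_distrib)
  then have "\<bar>?L a u - ?L b u\<bar> \<le> (1 + n) * e" for u using L[where x = "\<lambda>i. a i - b i" and c = e and u = u] ab(3) by simp
  then have "\<bar>(?L a u)\<^sup>2 - (?L b u)\<^sup>2\<bar> \<le> 2 * real (1 + n) * (real (1 + n) * e)" for u
    using L[where x = a and c = 1 and u = u] L[where x = b and c = 1 and u = u] ab by (intro abs_diff_square_le) auto
  then have "\<bar>\<Sum>u<n. (?L a u)\<^sup>2 - (?L b u)\<^sup>2\<bar> \<le> (\<Sum>u<n. 2 * real (1 + n) * (real (1 + n) * e))"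
    by (intro order_trans[OF sum_abs] sum_mono)
  then have 1: "\<bar>(\<Sum>u<n. (?L a u)\<^sup>2) - (\<Sum>u<n. (?L b u)\<^sup>2)\<bar> \<le> 2 * real n * (1 + real n)\<^sup>2 * e"
    by (simp add: sum_subtractf power2_eq_square algebra_simps)
  have "\<bar>(a i)\<^sup>2 - (b i)\<^sup>2\<bar> \<le> 2 * 1 * e" for i by (rule abs_diff_square_le[OF ab])
  then have "\<bar>\<Sum>i<2 * n. (a i)\<^sup>2 - (b i)\<^sup>2\<bar> \<le> (\<Sum>i<2 * n. 2 * 1 * e)"
    by (intro order_trans[OF sum_abs] sum_mono)
  then have 2: "\<bar>sq_norm (2 * n) a - sq_norm (2 * n) b\<bar> \<le> 4 * real n * e"
    by (simp add: sum_subtractf sq_norm_def)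
  show ?thesis unfolding distortion_def sq_norm_evens_odds distrib_right using 1 2 by linarith
qed

lemma distortion_scale: "distortion2 n s E (\<lambda>i. c * x i) = c\<^sup>2 * distortion2 n s E x"
proof -
  have row: "row_product n E (odds (\<lambda>i. c * x i)) u = c * row_product n E (odds x) u" for u
    by (simp add: row_product_def odds_def sum_distrib_left algebra_simps)
  have "(evens (\<lambda>i. c * x i) u + c * row_product n E (odds x) u / s)\<^sup>2 =
      c\<^sup>2 * (evens x u + row_product n E (odds x) u / s)\<^sup>2" for u
    by (simp add: evens_def algebra_simps flip: power_mult_distrib)
  then show ?thesis
    by (simp add: distortion_def row sq_norm_evens_odds right_diff_distrib sum_distrib_left)
      (simp add: sq_norm_def power_mult_distrib sum_distrib_left)
qed

lemma sq_norm_scale: "sq_norm m (\<lambda>i. c * x i) = c\<^sup>2 * sq_norm m x"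
  by (simp add: sq_norm_def power_mult_distrib sum_distrib_left)

text \<open>Scale to norm one, multiply by \<open>R\<close> and round. The relative bound at the
  grid point becomes an absolute bound \<open>\<eta>\<close>, since its norm after division by
  \<open>R\<close> is at most one; homogeneity returns to \<open>x\<close>.\<close>

lemma distortion_grid:
  assumes s: "s \<ge> 1" and R: "R > 0" and \<eta>: "\<eta> \<ge> 0"
    and grid: "\<And>g. g \<in> grid (2 * n) k R \<Longrightarrow> \<bar>distortion2 n s E (\<lambda>i. of_int (g i))\<bar> \<le> \<eta> * sq_norm (2 * n) (\<lambda>i. of_int (g i))"
    and x: "card {i. i < 2 * n \<and> x i \<noteq> 0} \<le> k"
  shows "\<bar>distortion2 n s E x\<bar> \<le> (\<eta> + (2 * real n * (1 + real n)\<^sup>2 + 4 * real n) / R) * sq_norm (2 * n) x"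
proof (cases "sq_norm (2 * n) x = 0")
  case True
  then have x0: "x i = 0" if "i < 2 * n" for i using that by (auto simp: sq_norm_def sum_nonneg_eq_0_iff)
  have "distortion2 n s E x = 0"
    unfolding distortion_def sq_norm_evens_odds True
    by (auto simp: evens_def odds_def row_product_def x0 intro!: sum.neutral)
  then show ?thesis using True by simp
next
  case False
  define r where "r = sqrt (sq_norm (2 * n) x)"
  have r: "r > 0" "r\<^sup>2 = sq_norm (2 * n) x" using False sq_norm_nonneg[of "2 * n" x] by (auto simp: r_def)
  define w where "w i = (if i < 2 * n then x i / r else 0)" for i
  \<comment> \<open>Rounding towards zero enlarges neither the support nor any absolute value, so
    sparsity and the norm bound survive.\<close>
  define g where "g i = (if w i \<ge> 0 then \<lfloor>R * w i\<rfloor> else \<lceil>R * w i\<rceil>)" for i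
  let ?x' = "\<lambda>i. 1 / R * of_int (g i)"
  have D: "distortion2 n s E x = r\<^sup>2 * distortion2 n s E w"
  proof -
    have "distortion2 n s E x = distortion2 n s E (\<lambda>i. r * w i)"
      using r by (simp add: distortion_def sq_norm_def evens_def odds_def row_product_def w_def)
    then show ?thesis by (simp add: distortion_scale)
  qed
  have nw: "sq_norm (2 * n) w = 1"
  proof -
    have "sq_norm (2 * n) x = sq_norm (2 * n) (\<lambda>i. r * w i)" using r by (simp add: sq_norm_def w_def)
    then have "r\<^sup>2 * sq_norm (2 * n) w = r\<^sup>2 * 1" using r(2) by (simp only: sq_norm_scale mult_1_right)
    then show ?thesis using r(1) by simp
  qed
  have w1: "\<bar>w i\<bar> \<le> 1" for i
  proof (cases "i < 2 * n")
    case True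
    then have "(w i)\<^sup>2 \<le> sq_norm (2 * n) w" unfolding sq_norm_def by (intro member_le_sum) auto
    then show ?thesis using nw by (simp add: abs_square_le_1)
  qed (simp add: w_def)
  have g_le: "\<bar>of_int (g i)\<bar> \<le> R * \<bar>w i\<bar>" and g_diff: "\<bar>R * w i - of_int (g i)\<bar> \<le> 1" for i
  proof -
    have "\<bar>of_int (g i)\<bar> \<le> R * \<bar>w i\<bar> \<and> \<bar>R * w i - of_int (g i)\<bar> \<le> 1"
    proof (cases "w i \<ge> 0")
      case True
      then have "0 \<le> R * w i" by simp
      then have "0 \<le> \<lfloor>R * w i\<rfloor>" by simp
      then show ?thesis using True unfolding g_def by simp linarith
    next
      case False
      then have "R * w i \<le> 0" by (simp add: mult_nonneg_nonpos)
      then have "\<lceil>R * w i\<rceil> \<le> 0" by simp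
      then show ?thesis using False unfolding g_def by simp linarith
    qed
    then show "\<bar>of_int (g i)\<bar> \<le> R * \<bar>w i\<bar>" "\<bar>R * w i - of_int (g i)\<bar> \<le> 1" by auto
  qed
  have x'_le: "\<bar>?x' i\<bar> \<le> \<bar>w i\<bar>" and x'_diff: "\<bar>w i - ?x' i\<bar> \<le> 1 / R" for i
  proof -
    show "\<bar>?x' i\<bar> \<le> \<bar>w i\<bar>" using g_le[of i] R by (simp add: abs_mult field_simps)
    have "w i - ?x' i = (R * w i - of_int (g i)) / R" using R by (simp add: field_simps)
    then have "\<bar>w i - ?x' i\<bar> = \<bar>R * w i - of_int (g i)\<bar> / R" by simp
    also have "\<dots> \<le> 1 / R" using g_diff[of i] R by (intro divide_right_mono) auto
    finally show "\<bar>w i - ?x' i\<bar> \<le> 1 / R" .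
  qed
  have "g \<in> grid (2 * n) k R"
  proof -
    have "\<bar>g i\<bar> \<le> int R" for i
    proof -
      have "real R * \<bar>w i\<bar> \<le> real R * 1" using w1[of i] by (intro mult_left_mono) auto
      then have "\<bar>real_of_int (g i)\<bar> \<le> real R" using g_le[of i] by linarith
      then show ?thesis by linarith
    qed
    moreover have sub: "{i. g i \<noteq> 0} \<subseteq> {i. i < 2 * n \<and> x i \<noteq> 0}" by (auto simp: g_def w_def split: if_splits)
    moreover have "card {i. g i \<noteq> 0} \<le> k" using card_mono[OF _ sub] x by simp
    ultimately show ?thesis unfolding grid_def by auto
  qed
  from grid[OF this] have "(1 / R)\<^sup>2 * \<bar>distortion2 n s E (\<lambda>i. of_int (g i))\<bar> \<le>
      (1 / R)\<^sup>2 * (\<eta> * sq_norm (2 * n) (\<lambda>i. of_int (g i)))"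
    by (rule mult_left_mono) simp
  then have "\<bar>distortion2 n s E ?x'\<bar> \<le> \<eta> * sq_norm (2 * n) ?x'"
    unfolding distortion_scale sq_norm_scale by (simp add: abs_mult mult.left_commute)
  also have "\<dots> \<le> \<eta> * 1"
  proof (rule mult_left_mono[OF _ \<eta>])
    have "(?x' i)\<^sup>2 \<le> (w i)\<^sup>2" for i using x'_le[of i] by (simp only: abs_le_square_iff)
    then have "sq_norm (2 * n) ?x' \<le> sq_norm (2 * n) w" unfolding sq_norm_def by (intro sum_mono)
    then show "sq_norm (2 * n) ?x' \<le> 1" using nw by simp
  qed
  finally have "\<bar>distortion2 n s E ?x'\<bar> \<le> \<eta>" by simp
  moreover have "\<bar>distortion2 n s E w - distortion2 n s E ?x'\<bar> \<le> (2 * real n * (1 + real n)\<^sup>2 + 4 * real n) * (1 / R)"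
    by (rule distortion_lipschitz[OF s w1 order_trans[OF x'_le w1] x'_diff])
  ultimately have "\<bar>distortion2 n s E w\<bar> \<le> \<eta> + (2 * real n * (1 + real n)\<^sup>2 + 4 * real n) / R" by simp
  then have "r\<^sup>2 * \<bar>distortion2 n s E w\<bar> \<le> r\<^sup>2 * (\<eta> + (2 * real n * (1 + real n)\<^sup>2 + 4 * real n) / R)"
    by (rule mult_left_mono) simp
  then show ?thesis unfolding D r(2) by (simp add: abs_mult sq_norm_nonneg mult.commute)
qed

section \<open>Asymptotics\<close>

lemma ceil_sqrt_bounds:
  "n \<le> (real (ceil_sqrt n))\<^sup>2" "real (ceil_sqrt n) \<le> sqrt n + 1"
  "(real (ceil_sqrt n))\<^sup>2 \<le> n + 2 * sqrt n + 1"
proof -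
  let ?s = "ceil_sqrt n"
  show 1: "n \<le> (real ?s)\<^sup>2" using ceil_sqrt(1)[of n] by (simp flip: of_nat_power)
  show 2: "real ?s \<le> sqrt n + 1"
  proof (cases "?s = 0")
    case False
    then have "(?s - 1)\<^sup>2 < n" by (intro ceil_sqrt(2)) simp
    then have "(real (?s - 1))\<^sup>2 < n" by (simp flip: of_nat_power)
    then have "real (?s - 1) \<le> sqrt n" by (intro real_le_rsqrt) simp
    then show ?thesis using False by (simp add: of_nat_diff)
  qed simp
  have "(real ?s)\<^sup>2 \<le> (sqrt n + 1)\<^sup>2" using 2 by (intro power_mono) auto
  also have "\<dots> = n + 2 * sqrt n + 1" by (simp add: power2_sum)
  finally show "(real ?s)\<^sup>2 \<le> n + 2 * sqrt n + 1" .
qed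

lemma rip_bound_clique:
  assumes "\<delta> = rip_parameter k' (map_mat real_of_rat (reduced_matrix n E s))" "s > 0"
    and "has_clique n E k" "2 * h \<le> k" "h \<ge> 1" "k \<le> k'"
  shows "h / s \<le> \<delta>"
proof -
  have "RIP k' \<delta> (map_mat real_of_rat (reduced_matrix n E s))"
    unfolding assms(1) by (rule rip_parameter_least(2))
  then show ?thesis
    using clique_distortion[of n E k h s k' \<delta>] assms unfolding RIP_reduced_matrix[OF assms(2)] by simp
qed

text \<open>The thresholds are powers of the dimension 2n with exponents -1/6 and -1/4, the
  estimates powers of n; the change costs at most a factor 2.\<close>

lemma powr_double_bounds:
  fixes x a :: real
  assumes "x \<ge> 0" "- 1 \<le> a" "a \<le> 0"
  shows "(2 * x) powr a \<le> x powr a" "x powr a / 2 \<le> (2 * x) powr a"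
proof -
  have "(2 * x) powr a = 2 powr a * x powr a" using assms by (simp add: powr_mult)
  moreover have "2 powr a * x powr a \<le> 1 * x powr a"
    using powr_mono[of a 0 "2 :: real"] assms by (intro mult_right_mono) auto
  moreover have "1 / 2 * x powr a \<le> 2 powr a * x powr a"
    using powr_mono[of "- 1" a "2 :: real"] assms by (intro mult_right_mono) (auto simp: powr_minus)
  ultimately show "(2 * x) powr a \<le> x powr a" "x powr a / 2 \<le> (2 * x) powr a" by auto
qed

text \<open>With h about n^(1/3) / 2 and s about sqrt n the quotient h / s is about n^(-1/6) / 2,
  twice the required value. This slack absorbs the roundings.\<close>

lemma eventually_clique_bound:
  "\<forall>\<^sub>F n :: nat in sequentially. \<forall>E. has_clique n E (nat \<lfloor>real n powr (1/2 - 1/6)\<rfloor>) \<longrightarrow>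
     rip_parameter (nat \<lfloor>real (2 * n) powr (1/3)\<rfloor>) (map_mat real_of_rat (reduced_matrix n E (ceil_sqrt n)))
       \<ge> real (2 * n) powr (- 1/6) / 4"
proof -
  have "\<forall>\<^sub>F n :: nat in sequentially. (real n powr (1/3) / 2 - 1) / (sqrt n + 1) \<ge> real n powr (- 1/6) / 4"
    by real_asymp
  moreover have "\<forall>\<^sub>F n :: nat in sequentially. real n powr (1/3) \<ge> 4" by real_asymp
  moreover have "\<forall>\<^sub>F n :: nat in sequentially. n > 0" by (rule eventually_gt_at_top)
  ultimately show ?thesis
  proof eventually_elim
    case (elim n)
    let ?s = "ceil_sqrt n" and ?k = "nat \<lfloor>real n powr (1/3)\<rfloor>" and ?k' = "nat \<lfloor>real (2 * n) powr (1/3)\<rfloor>"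
    have s: "?s > 0" using ceil_sqrt(1)[of n] elim(3) by (cases "?s") auto
    have "real n powr (1/3) \<le> real (2 * n) powr (1/3)" by (intro powr_mono2) auto
    then have k': "?k \<le> ?k'" by (intro nat_mono floor_mono)
    define h where "h = ?k div 2"
    have k: "real n powr (1/3) - 1 \<le> real ?k" by linarith
    have h: "2 * h \<le> ?k" "real ?k \<le> 2 * real h + 1" unfolding h_def by linarith+
    \<comment> \<open>The floor costs at most 1 before halving and an odd clique size at most 1/2,
      together at most 1; hence n^(1/3) >= 4 gives h >= 1.\<close>
    then have h_ge: "real n powr (1/3) / 2 - 1 \<le> h" using k by linarith
    then have h1: "h \<ge> 1" using elim(2) by linarith
    show ?case
    proof (intro allI impI)
      fix E
      assume "has_clique n E (nat \<lfloor>real n powr (1/2 - 1/6)\<rfloor>)"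
      then have "has_clique n E ?k" by simp
      from rip_bound_clique[OF refl s this h(1) h1 k']
      have "h / ?s \<le> rip_parameter ?k' (map_mat real_of_rat (reduced_matrix n E ?s))" .
      moreover have "(real n powr (1/3) / 2 - 1) / (sqrt n + 1) \<le> h / ?s"
        using h_ge ceil_sqrt_bounds(2)[of n] s elim(2) by (intro frac_le) auto
      ultimately show "rip_parameter ?k' (map_mat real_of_rat (reduced_matrix n E ?s)) \<ge> real (2 * n) powr (- 1/6) / 4"
        using elim(1) powr_double_bounds(1)[of "real n" "- 1/6"] unfolding of_nat_mult of_nat_numeral by linarith
    qed
  qed
qed

text \<open>Union bound over the grid: a graph that is good at all grid points satisfies the RIP by
  \<open>distortion_grid\<close>. The sparsity enters through a real bound \<open>K\<close>, so that
  (2n)^(1/3) can be inserted without its floor.\<close>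

lemma card_not_RIP:
  fixes n R k :: nat and K t \<tau> :: real
  assumes n: "n > 0" and R: "R > 0" and K: "k \<le> K" "1 \<le> K" and \<tau>: "\<tau> \<ge> 0" and t: "t \<ge> 0"
    and \<delta>: "(2 * \<tau> + 1) / sqrt n + (K\<^sup>2 + K + t + 2 * sqrt n + 1) / n + (2 * real n * (1 + real n)\<^sup>2 + 4 * real n) / R \<le> \<delta>"
  shows "card {E. E \<subseteq> edges n \<and> \<not> RIP k \<delta> (map_mat real_of_rat (reduced_matrix n E (ceil_sqrt n)))}
    \<le> 2 ^ card (edges n) * ((2 * real n * (2 * R + 1)) powr K * (2 * exp (- \<tau>\<^sup>2) + 2 * exp (- t / K + 2 * real n / K\<^sup>2)))"
proof -
  let ?s = "real (ceil_sqrt n)" and ?p = "2 * exp (- \<tau>\<^sup>2) + 2 * exp (- t / K + 2 * real n / K\<^sup>2)"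
  let ?G = "grid (2 * n) k R" and ?x = "\<lambda>g i. real_of_int (g i)"
  let ?M = "\<lambda>E. map_mat real_of_rat (reduced_matrix n E (ceil_sqrt n))"
  define \<eta> where "\<eta> = (2 * \<tau> + 1) / ?s + (K\<^sup>2 + K + t + 2 * sqrt n + 1) / ?s\<^sup>2"
  let ?bad = "\<lambda>g. {E. E \<subseteq> edges n \<and> \<bar>distortion2 n ?s E (?x g)\<bar> > \<eta> * sq_norm (2 * n) (?x g)}"
  have s: "ceil_sqrt n > 0" using ceil_sqrt(1)[of n] n by (cases "ceil_sqrt n") auto
  have sn: "sqrt n \<le> ?s" using ceil_sqrt_bounds(1)[of n] by (intro real_le_lsqrt) auto
  have \<eta>0: "\<eta> \<ge> 0" unfolding \<eta>_def using \<tau> K t s by (intro add_nonneg_nonneg divide_nonneg_nonneg) auto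
  have "\<eta> \<le> (2 * \<tau> + 1) / sqrt n + (K\<^sup>2 + K + t + 2 * sqrt n + 1) / n"
    unfolding \<eta>_def using sn ceil_sqrt_bounds(1)[of n] n \<tau> t K
    by (intro add_mono frac_le) auto
  then have \<eta>\<delta>: "\<eta> + (2 * real n * (1 + real n)\<^sup>2 + 4 * real n) / R \<le> \<delta>" using \<delta> by linarith
  have fin: "finite {E. E \<subseteq> edges n \<and> P E}" for P
    using finite_edges by (auto intro: finite_subset[of _ "Pow (edges n)"])
  have "{E. E \<subseteq> edges n \<and> \<not> RIP k \<delta> (?M E)} \<subseteq> (\<Union>g\<in>?G. ?bad g)"
  proof (rule ccontr)
    assume "\<not> {E. E \<subseteq> edges n \<and> \<not> RIP k \<delta> (?M E)} \<subseteq> (\<Union>g\<in>?G. ?bad g)"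
    then obtain E where "E \<in> {E. E \<subseteq> edges n \<and> \<not> RIP k \<delta> (?M E)}" and not_bad: "E \<notin> (\<Union>g\<in>?G. ?bad g)"
      by blast
    then have E: "E \<subseteq> edges n" "\<not> RIP k \<delta> (?M E)" by auto
    have le: "\<bar>distortion2 n ?s E (?x g)\<bar> \<le> \<eta> * sq_norm (2 * n) (?x g)" if "g \<in> ?G" for g
      using not_bad that E(1) by (auto simp: not_less)
    have "\<bar>distortion2 n ?s E x\<bar> \<le> \<delta> * sq_norm (2 * n) x" if x: "card {i. i < 2 * n \<and> x i \<noteq> 0} \<le> k" for x
    proof -
      have "\<bar>distortion2 n ?s E x\<bar> \<le> (\<eta> + (2 * real n * (1 + real n)\<^sup>2 + 4 * real n) / R) * sq_norm (2 * n) x"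
        using s by (intro distortion_grid[OF _ R \<eta>0 le x]) auto
      also have "\<dots> \<le> \<delta> * sq_norm (2 * n) x" by (rule mult_right_mono[OF \<eta>\<delta> sq_norm_nonneg])
      finally show ?thesis .
    qed
    then show False using E(2) unfolding RIP_reduced_matrix[OF s] by blast
  qed
  then have "card {E. E \<subseteq> edges n \<and> \<not> RIP k \<delta> (?M E)} \<le> card (\<Union>g\<in>?G. ?bad g)"
    using grid_finite_card(1)[of "2 * n" k R] n fin by (intro card_mono) auto
  also have "\<dots> \<le> (\<Sum>g\<in>?G. card (?bad g))"
    using grid_finite_card(1)[of "2 * n" k R] n by (intro card_UN_le) auto
  finally have "real (card {E. E \<subseteq> edges n \<and> \<not> RIP k \<delta> (?M E)}) \<le> (\<Sum>g\<in>?G. real (card (?bad g)))"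
    by (simp flip: of_nat_sum)
  also have "\<dots> \<le> (\<Sum>g\<in>?G. 2 ^ card (edges n) * ?p)"
  proof (rule sum_mono)
    fix g
    assume g: "g \<in> ?G"
    show "real (card (?bad g)) \<le> 2 ^ card (edges n) * ?p"
    \<comment> \<open>The tail bounds are relative to the norm. The zero vector of the grid has no
      distortion and is treated apart.\<close>
    proof (cases "sq_norm (2 * n) (?x g) = 0")
      case True
      then have x0: "g i = 0" if "i < 2 * n" for i using that by (auto simp: sq_norm_def sum_nonneg_eq_0_iff)
      have "distortion2 n ?s E (?x g) = 0" for E
        unfolding distortion_def sq_norm_evens_odds True
        by (auto simp: evens_def odds_def row_product_def x0 intro!: sum.neutral)
      then have bad: "?bad g = {}" using True by simp
      show ?thesis unfolding bad by simp
    next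
      case False
      have pos: "sq_norm n (evens (?x g)) + sq_norm n (odds (?x g)) > 0"
        using False sq_norm_nonneg[of "2 * n" "?x g"] unfolding sq_norm_evens_odds by linarith
      have "card {v. v < n \<and> odds (?x g) v \<noteq> 0} \<le> k"
      proof -
        have fin_supp: "finite {i. g i \<noteq> 0}" using g by (auto simp: grid_def intro: finite_subset)
        have "card {v. v < n \<and> odds (?x g) v \<noteq> 0} = card ((\<lambda>v. Suc (2 * v)) ` {v. v < n \<and> odds (?x g) v \<noteq> 0})"
          by (rule card_image[symmetric]) (auto simp: inj_on_def)
        also have "\<dots> \<le> card {i. g i \<noteq> 0}" using fin_supp by (intro card_mono) (auto simp: odds_def)
        finally show ?thesis using g by (simp add: grid_def)
      qed
      then have "real (card {v. v < n \<and> odds (?x g) v \<noteq> 0}) \<le> K" using K(1) by linarith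
      from card_distortion_large[OF this K(2) \<tau> t _ ceil_sqrt_bounds(1,3) pos]
      show ?thesis using s unfolding sq_norm_evens_odds \<eta>_def by simp
    qed
  qed
  also have "\<dots> = real (card ?G) * (2 ^ card (edges n) * ?p)" by simp
  also have "\<dots> \<le> (2 * real n * (2 * R + 1)) powr K * (2 ^ card (edges n) * ?p)"
  proof (rule mult_right_mono)
    have "real (card ?G) \<le> real ((2 * n * (2 * R + 1)) ^ k)"
      using grid_finite_card(2)[of "2 * n" k R] n by (intro of_nat_mono) auto
    also have "\<dots> = (2 * real n * (2 * R + 1)) powr k"
      using n by (subst powr_realpow) (auto simp: algebra_simps intro: add_pos_nonneg)
    also have "\<dots> \<le> (2 * real n * (2 * R + 1)) powr K"
    proof (rule powr_mono[OF K(1)])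
      have "1 * 1 \<le> (2 * real n) * (2 * real R + 1)" using n by (intro mult_mono) auto
      then show "1 \<le> 2 * real n * (2 * R + 1)" by (simp add: add.commute)
    qed
    finally show "real (card ?G) \<le> (2 * real n * (2 * R + 1)) powr K" .
  qed simp
  finally show ?thesis by (simp add: mult.left_commute mult.assoc)
qed

text \<open>The choice \<tau> = n^(1/4) / 20, t = n^(3/4) / 20, R = n^4 gives main errors n^(-1/4) /
  10 and n^(-1/4) / 20, all others being of lower order; this is below n^(-1/4) / 2 and so below
  (2n)^(-1/4). The failure exponents n^(1/2) / 400 and t / K, of order n^(5/12), exceed both 2 n /
  K^2 and the logarithm of the grid size, of order n^(1/3) log n.\<close>

lemma prob_not_RIP_tendsto:
  "(\<lambda>n. card {E. E \<subseteq> edges n \<and> \<not> RIP (nat \<lfloor>real (2 * n) powr (1/3)\<rfloor>) (real (2 * n) powr (- 1/4))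
      (map_mat real_of_rat (reduced_matrix n E (ceil_sqrt n)))} / 2 ^ card (edges n)) \<longlonglongrightarrow> 0"
proof -
  let ?K = "\<lambda>n :: nat. (2 * real n) powr (1/3)"
  let ?\<tau> = "\<lambda>n :: nat. real n powr (1/4) / 20" and ?t = "\<lambda>n :: nat. real n powr (3/4) / 20"
  let ?b = "\<lambda>n :: nat. (2 * real n * (2 * real n ^ 4 + 1)) powr ?K n *
    (2 * exp (- (?\<tau> n)\<^sup>2) + 2 * exp (- ?t n / ?K n + 2 * real n / (?K n)\<^sup>2))"
  let ?A = "\<lambda>n. {E. E \<subseteq> edges n \<and> \<not> RIP (nat \<lfloor>real (2 * n) powr (1/3)\<rfloor>) (real (2 * n) powr (- 1/4))
      (map_mat real_of_rat (reduced_matrix n E (ceil_sqrt n)))}"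
  have "\<forall>\<^sub>F n :: nat in sequentially. (2 * ?\<tau> n + 1) / sqrt n + ((?K n)\<^sup>2 + ?K n + ?t n + 2 * sqrt n + 1) / n +
      (2 * real n * (1 + real n)\<^sup>2 + 4 * real n) / real n ^ 4 \<le> real n powr (- 1/4) / 2"
    by real_asymp
  moreover have "\<forall>\<^sub>F n :: nat in sequentially. 1 \<le> ?K n" by real_asymp
  moreover have "\<forall>\<^sub>F n :: nat in sequentially. n > 0" by (rule eventually_gt_at_top)
  ultimately have "\<forall>\<^sub>F n in sequentially. card (?A n) / 2 ^ card (edges n) \<le> ?b n"
  proof eventually_elim
    case (elim n)
    have k: "real (nat \<lfloor>real (2 * n) powr (1/3)\<rfloor>) \<le> ?K n" by simp
    have \<delta>: "(2 * ?\<tau> n + 1) / sqrt n + ((?K n)\<^sup>2 + ?K n + ?t n + 2 * sqrt n + 1) / n +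
      (2 * real n * (1 + real n)\<^sup>2 + 4 * real n) / real (n ^ 4) \<le> real (2 * n) powr (- 1/4)"
    proof -
      have "real n powr (- 1/4) / 2 \<le> (2 * real n) powr (- 1/4)" by (rule powr_double_bounds(2)) auto
      from order_trans[OF elim(1) this] show ?thesis by (simp only: of_nat_mult of_nat_numeral of_nat_power)
    qed
    have "card (?A n) \<le> 2 ^ card (edges n) * ((2 * real n * (2 * (n ^ 4) + 1)) powr ?K n *
      (2 * exp (- (?\<tau> n)\<^sup>2) + 2 * exp (- ?t n / ?K n + 2 * real n / (?K n)\<^sup>2)))"
      by (rule card_not_RIP[OF elim(3) _ k elim(2) _ _ \<delta>]) (use elim(3) in auto)
    then show ?case by (simp add: divide_le_eq mult.commute add.commute)
  qed
  moreover have "?b \<longlonglongrightarrow> 0" by real_asymp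
  moreover have "\<forall>\<^sub>F n in sequentially. 0 \<le> card (?A n) / 2 ^ card (edges n)"
    by (intro always_eventually allI divide_nonneg_nonneg of_nat_0_le_iff) simp
  ultimately show ?thesis by - (rule tendsto_sandwich[OF _ _ tendsto_const])
qed

theorem theorem3:
  assumes "hidden_clique_hypothesis (1/6)"
  shows "\<not> (\<exists>M. poly_time_algorithm matrix_instances M \<and>
           (\<exists>N. \<forall>n \<ge> N. \<forall>\<Phi> \<in> carrier_mat n n.
              let \<delta> = rip_parameter (nat \<lfloor>real n powr (1/3)\<rfloor>) (map_mat real_of_rat \<Phi>) in
                (\<delta> \<le> real n powr (- 1/4) \<longrightarrow> outputs_yes M (encode_matrix \<Phi>)) \<and>
                (\<delta> \<ge> real n powr (- 1/6) / 4 \<longrightarrow> outputs_no M (encode_matrix \<Phi>))))"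
proof
  assume "\<exists>M. poly_time_algorithm matrix_instances M \<and>
           (\<exists>N. \<forall>n \<ge> N. \<forall>\<Phi> \<in> carrier_mat n n.
              let \<delta> = rip_parameter (nat \<lfloor>real n powr (1/3)\<rfloor>) (map_mat real_of_rat \<Phi>) in
                (\<delta> \<le> real n powr (- 1/4) \<longrightarrow> outputs_yes M (encode_matrix \<Phi>)) \<and>
                (\<delta> \<ge> real n powr (- 1/6) / 4 \<longrightarrow> outputs_no M (encode_matrix \<Phi>)))"
  then obtain M N0 where M: "poly_time_algorithm matrix_instances M"
    and N0: "\<And>n \<Phi>. n \<ge> N0 \<Longrightarrow> \<Phi> \<in> carrier_mat n n \<Longrightarrow>
      rip_parameter (nat \<lfloor>real n powr (1/3)\<rfloor>) (map_mat real_of_rat \<Phi>) \<le> real n powr (- 1/4) \<Longrightarrow>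
      outputs_yes M (encode_matrix \<Phi>)"
      "\<And>n \<Phi>. n \<ge> N0 \<Longrightarrow> \<Phi> \<in> carrier_mat n n \<Longrightarrow>
      rip_parameter (nat \<lfloor>real n powr (1/3)\<rfloor>) (map_mat real_of_rat \<Phi>) \<ge> real n powr (- 1/6) / 4 \<Longrightarrow>
      outputs_no M (encode_matrix \<Phi>)"
    unfolding Let_def by blast
  obtain N1 where N1: "\<And>n E. n \<ge> N1 \<Longrightarrow> has_clique n E (nat \<lfloor>real n powr (1/2 - 1/6)\<rfloor>) \<Longrightarrow>
     rip_parameter (nat \<lfloor>real (2 * n) powr (1/3)\<rfloor>) (map_mat real_of_rat (reduced_matrix n E (ceil_sqrt n)))
       \<ge> real (2 * n) powr (- 1/6) / 4"
    using eventually_clique_bound unfolding eventually_sequentially by blast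
  \<comment> \<open>From \<open>N\<close> on, both the promise of \<open>M\<close> at dimension 2n
    >= N0 and the clique estimate hold; N >= 1 is what the test by \<open>lefts N\<close>
    requires.\<close>
  define N where "N = max 1 (max N0 N1)"
  have N_ge: "N \<ge> 1" "N \<ge> N0" "N \<ge> N1" by (auto simp: N_def)
  interpret clique_to_rip M N using M N_ge(1) by unfold_locales
  \<comment> \<open>The hypothesis asks for a correct "yes" at every n, not only at large ones;
    below \<open>N\<close> this is the immediate answer of the machine.\<close>
  have yes: "outputs_yes machine (encode_graph n E)"
    if "has_clique n E (nat \<lfloor>real n powr (1/2 - 1/6)\<rfloor>)" for n E
  proof (cases "n < N")
    case False
    have "outputs_no M (encode_matrix (instance_matrix n E))"
      by (rule N0(2)[OF _ instance_matrix_carrier])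
        (use False N_ge N1[OF _ that] in \<open>auto simp: instance_matrix_def\<close>)
    then show ?thesis using False by (intro machine_large(1)) auto
  qed (rule machine_yes_small)
  let ?k = "\<lambda>n. nat \<lfloor>real (2 * n) powr (1/3)\<rfloor>" and ?\<delta> = "\<lambda>n. real (2 * n) powr (- 1/4)"
  let ?bad = "\<lambda>n. {E. E \<subseteq> edges n \<and> \<not> RIP (?k n) (?\<delta> n) (map_mat real_of_rat (reduced_matrix n E (ceil_sqrt n)))}"
  \<comment> \<open>Only graphs that violate the RIP bound can escape the answer "no": for all
    others the parameter is small and the promise makes \<open>M\<close> say "yes".\<close>
  have no: "1 - card (?bad n) / 2 ^ card (edges n) \<le>
      measure_pmf.prob (G_half n) {E. outputs_no machine (encode_graph n E)}" if n: "n \<ge> N" for n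
  proof -
    let ?good = "Pow (edges n) \<inter> {E. outputs_no machine (encode_graph n E)}"
    have "Pow (edges n) - ?good \<subseteq> ?bad n"
    proof (rule ccontr)
      assume "\<not> Pow (edges n) - ?good \<subseteq> ?bad n"
      then obtain E where E: "\<not> outputs_no machine (encode_graph n E)"
        "RIP (?k n) (?\<delta> n) (map_mat real_of_rat (reduced_matrix n E (ceil_sqrt n)))" by auto
      then have "rip_parameter (?k n) (map_mat real_of_rat (instance_matrix n E)) \<le> ?\<delta> n"
        unfolding instance_matrix_def by (intro rip_parameter_least(3)) auto
      then have "outputs_yes M (encode_matrix (instance_matrix n E))"
        using n N_ge by (intro N0(1)[OF _ instance_matrix_carrier]) auto
      then show False using machine_large(2)[OF n] E(1) by blast
    qed
    then have "card (Pow (edges n) - ?good) \<le> card (?bad n)"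
      using finite_edges by (intro card_mono) (auto intro: finite_subset[of _ "Pow (edges n)"])
    moreover have "card ?good + card (Pow (edges n) - ?good) = 2 ^ card (edges n)"
      using finite_edges[of n] card_mono[of "Pow (edges n)" ?good]
      by (simp add: card_Diff_subset card_Pow)
    then have "real (card ?good) + real (card (Pow (edges n) - ?good)) = 2 ^ card (edges n)"
      by (simp flip: of_nat_add)
    ultimately have "2 ^ card (edges n) - real (card ?good) \<le> card (?bad n)" by linarith
    moreover have "measure_pmf.prob (G_half n) {E. outputs_no machine (encode_graph n E)} =
        card ?good / 2 ^ card (edges n)"
      unfolding G_half_def graphs_Pow using finite_edges
      by (subst measure_pmf_of_set) (auto simp: card_Pow)
    ultimately show ?thesis by (simp add: field_simps)
  qed
  have "(\<lambda>n. measure_pmf.prob (G_half n) {E. outputs_no machine (encode_graph n E)}) \<longlonglongrightarrow> 1"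
  proof (rule tendsto_sandwich)
    show "(\<lambda>n. 1 - card (?bad n) / 2 ^ card (edges n)) \<longlonglongrightarrow> 1"
      using tendsto_diff[OF tendsto_const[of 1] prob_not_RIP_tendsto] by simp
    show "\<forall>\<^sub>F n in sequentially. 1 - card (?bad n) / 2 ^ card (edges n) \<le>
        measure_pmf.prob (G_half n) {E. outputs_no machine (encode_graph n E)}"
      using no eventually_sequentially by blast
  qed (auto intro: tendsto_const)
  then show False using assms poly_time yes unfolding hidden_clique_hypothesis_def by blast
qed

end
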